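(* Let $G\in C^r(B,\bar B)$ and $z(\cdot)\in C^r(U,B)$ with $z(0)=0$, and let $L(\varepsilon)=G'[z(\varepsilon)]$. Assume $z(\varepsilon)$ to be an approximation of order $2k$, i.e. $G[z(\varepsilon)]=\varepsilon^{2k}\,\bar b(\varepsilon)$, and the family $L(\varepsilon)$ to be $k$-surjective with $k\ge1$ and all subspaces closed in the associated direct sums $B=N_1^c\oplus\cdots\oplus N_{k+1}^c\oplus N_{k+1}$, $\bar B=R_1\oplus\cdots\oplus R_{k+1}$. Let $S_1,\dots,S_{k+1}$ and $p_k(\varepsilon)$ be the associated operators (see context), let $\mathcal P_i$ denote the projection of $\bar B$ to $R_i$, $i=1,\dots,k+1$, with respect to the direct sum of $\bar B$, and let $\mathcal B_0:=\tfrac12G''[0]$. (i) Assume $\|\mathcal P_{k+1}\cdot\bar b(0)\|\ll1$. Then, for $\varepsilon\in U$ and $\|n_{k+1}\|\ll1$ ($n_{k+1}\in N_{k+1}$), there exists a smooth mapping of the form $$\hat n^c(\varepsilon,n_{k+1})=\varepsilon^k\,\bar n_1^c(\varepsilon,n_{k+1})+\cdots+\varepsilon\,\bar n_k^c(\varepsilon,n_{k+1})+\bar n_{k+1}^c(\varepsilon,n_{k+1}),\qquad \bar n_i^c(\varepsilon,n_{k+1})\in N_i^c,$$ such that $$z=z(\varepsilon)+\varepsilon^kp_k(\varepsilon)\{\hat n^c(\varepsilon,n_{k+1})+n_{k+1}\}$$ defines solutions of $G[z]=0$. For $\varepsilon=0$, the last summand $\bar n_{k+1}^c(0,n_{k+1})\in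 N_{k+1}^c$ is a solution $n_{k+1}^c$ of the quadratic equation $$S_{k+1}n_{k+1}^c+\mathcal P_{k+1}\mathcal B_0\cdot(n_{k+1}^c+n_{k+1})^2+\mathcal P_{k+1}\bar b(0)=0,$$ and $\|\bar n_{k+1}^c(\varepsilon,n_{k+1})\|\ll1$, whereas the first $k$ summands satisfy $$\bar n_i^c(0,n_{k+1})=-S_i^{-1}\big\{\mathcal P_i\mathcal B_0\cdot[\bar n_{k+1}^c(0,n_{k+1})+n_{k+1}]^2+\mathcal P_i\bar b(0)\big\}\in N_i^c,\qquad i=1,\dots,k.$$ (ii) Assume that the curvature of $G$ at $z=0$ in the direction of $N_{k+1}^c$ equals zero, i.e. $\mathcal B_0\cdot(n_{k+1}^c)^2=0$ for all $n_{k+1}^c\in N_{k+1}^c$. Then, for $\varepsilon\in U$ and $\|n_{k+1}\|\ll1$, there exists a smooth mapping of the form $$\tilde n^c(\varepsilon,n_{k+1})=\varepsilon^k\,\bar n_1^c(\varepsilon,n_{k+1})+\cdots+\varepsilon\,\bar n_k^c(\varepsilon,n_{k+1})+\bar n_{k+1}^c(\varepsilon,n_{k+1}),\qquad \bar n_i^c(\varepsilon,n_{k+1})\in N_i^c,$$ such that $$z=z(\varepsilon)+\varepsilon^kp_k(\varepsilon)\{\tilde n^c(\varepsilon,n_{k+1})+n_{k+1}\}$$ defines solutions of $G[z]=0$. For $\varepsilon=0$, the last summand is explicitly given by $$\bar n_{k+1}^c(0,n_{k+1})=-(S_{k+1}+2\,\mathcal P_{k+1}\mathcal B_0\cdot n_{k+1})^{-1}\,\mathcal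 P_{k+1}\big[\mathcal B_0\cdot(n_{k+1})^2+\bar b(0)\big],$$ whereas the first $k$ summands are again given by $$\bar n_i^c(0,n_{k+1})=-S_i^{-1}\big\{\mathcal P_i\mathcal B_0\cdot[\bar n_{k+1}^c(0,n_{k+1})+n_{k+1}]^2+\mathcal P_i\bar b(0)\big\}\in N_i^c,\qquad i=1,\dots,k.$$
   Context: $B,\bar B$ are real or complex Banach spaces over $\mathbb K=\mathbb R$ or $\mathbb C$; $U\subset\mathbb K$ is an open neighbourhood of $0$, which may be shrunk; $r\ge2$ is chosen sufficiently large. "Smooth" means continuously differentiable up to some finite order, which may be prescribed provided $r$ is large enough (depending on $k$). The function $\bar b(\cdot):U\to\bar B$ is smooth. "$\ll1$" means "less than a sufficiently small positive constant"; for $\|\mathcal P_{k+1}\bar b(0)\|\ll1$ this constant depends only on $S_{k+1}|_{N_{k+1}^c}$, $\mathcal P_{k+1}$ and $\mathcal B_0$. $L[X,Y]$ denotes bounded linear operators, $GL[X,Y]$ bounded bijective linear operators with bounded inverse. For a symmetric bilinear map $\mathcal B_0$, $\mathcal B_0\cdot v^2:=\mathcal B_0(v,v)$ and $\mathcal B_0\cdot n_{k+1}$ denotes the linear operator $v\mapsto\mathcal B_0(n_{k+1},v)$. $S_i^{-1}$ denotes the inverse of $S_i|_{N_i^c}:N_i^c\to R_i$, and $(S_{k+1}+2\mathcal P_{k+1}\mathcal B_0\cdot n_{k+1})^{-1}$ the inverse of this operator restricted to $N_{k+1}^c\to R_{k+1}$. $k$-surjectivity: the family $L(\varepsilon)\in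 L[B,\bar B]$, $\varepsilon\in U$, is called $k$-surjective if for every $\bar b\in\bar B$ there are $b_0,\dots,b_k\in B$ such that $b(\varepsilon)=b_0+\varepsilon b_1+\cdots+\varepsilon^kb_k$ satisfies $L(\varepsilon)b(\varepsilon)=\varepsilon^k\bar b+\varepsilon^{k+1}r(\varepsilon)$ with a smooth remainder $r(\varepsilon)$. Associated direct sums: it is known that $k$-surjectivity of $L(\varepsilon)$ is equivalent to the existence of direct sums $B=N_1^c\oplus\cdots\oplus N_{k+1}^c\oplus N_{k+1}$, $\bar B=R_1\oplus\cdots\oplus R_{k+1}$, operators $S_1,\dots,S_{k+1}\in L[B,\bar B]$ whose restrictions satisfy $S_i\in GL[N_i^c,R_i]$, and a polynomial family $p_k(\varepsilon)=I_B+\varepsilon\phi_1+\cdots+\varepsilon^k\phi_k$ with $\phi_i\in L[B,N_1^c\oplus\cdots\oplus N_{k+1-i}^c]$, $i=1,\dots,k$, such that $$L(\varepsilon)p_k(\varepsilon)n_{i+1}^c=\varepsilon^iS_{i+1}n_{i+1}^c+O(\varepsilon^{i+1})\ (n_{i+1}^c\in N_{i+1}^c,\ i=0,\dots,k),\qquad L(\varepsilon)p_k(\varepsilon)n_{k+1}=O(\varepsilon^{k+1})\ (n_{k+1}\in N_{k+1}),$$ and such that $P_k(\varepsilon)=S_1+\varepsilon S_2+\cdots+\varepsilon^kS_{k+1}$ is lower triangular with respect to these direct sums (zero on $N_{k+1}$; $(R_j,N_i^c)$ block zero for $j<i$; $(R_i,N_i^c)$ block equal to $\varepsilon^{i-1}S_i$).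 These are the associated direct sums, operators $S_i$ and family $p_k(\varepsilon)$ used in the claim. *)

theory Defs
  imports "HOL-Analysis.Analysis" "HOL-Library.Landau_Symbols"
begin

(* A Banach space over the scalar field 'k.  Since a commutative real normed field with
   multiplicative norm is isomorphic to the reals or to the complex numbers, quantifying over
   'k :: real_normed_field covers exactly these two cases.  Real Frechet derivatives that are
   linear for the given scaling are derivatives over 'k (complex derivatives if 'k = complex). *)
locale banach_over = vector_space scale
  for scale :: "'k::real_normed_field \<Rightarrow> 'a::banach \<Rightarrow> 'a" +
  assumes norm_scale: "norm (scale c x) = norm c * norm x"
    and scale_of_real: "scale (of_real t) x = t *\<^sub>R x"

definition prod_scale :: "('k \<Rightarrow> 'a \<Rightarrow> 'a) \<Rightarrow> ('k \<Rightarrow> 'b \<Rightarrow> 'b) \<Rightarrow> 'k \<Rightarrow> 'a \<times> 'b \<Rightarrow> 'a \<times> 'b" where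
  "prod_scale s s' c p = (s c (fst p), s' c (snd p))"

definition bounded_operator ::
    "('k::real_normed_field \<Rightarrow> 'a::real_normed_vector \<Rightarrow> 'a) \<Rightarrow>
     ('k \<Rightarrow> 'b::real_normed_vector \<Rightarrow> 'b) \<Rightarrow> ('a \<Rightarrow> 'b) \<Rightarrow> bool" where
  "bounded_operator s s' T \<longleftrightarrow> Vector_Spaces.linear s s' T \<and> bounded_linear T"

(* GL[X,Y] for subspaces X, Y; only the restriction of T to X matters. *)
definition GL_on ::
    "('k::real_normed_field \<Rightarrow> 'a::real_normed_vector \<Rightarrow> 'a) \<Rightarrow>
     ('k \<Rightarrow> 'b::real_normed_vector \<Rightarrow> 'b) \<Rightarrow> 'a set \<Rightarrow> 'b set \<Rightarrow> ('a \<Rightarrow> 'b) \<Rightarrow> bool" where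
  "GL_on s s' X Y T \<longleftrightarrow>
     (\<forall>x\<in>X. \<forall>y\<in>X. T (x + y) = T x + T y) \<and>
     (\<forall>c. \<forall>x\<in>X. T (s c x) = s' c (T x)) \<and>
     (\<exists>M. \<forall>x\<in>X. norm (T x) \<le> M * norm x) \<and>
     bij_betw T X Y \<and>
     (\<exists>M. \<forall>y\<in>Y. norm (inv_into X T y) \<le> M * norm y)"

definition bounded_multilinear_on ::
    "('k \<Rightarrow> 'a::real_normed_vector \<Rightarrow> 'a) \<Rightarrow> ('k \<Rightarrow> 'b::real_normed_vector \<Rightarrow> 'b) \<Rightarrow>
     'a set \<Rightarrow> nat \<Rightarrow> ('a list \<Rightarrow> 'b) \<Rightarrow> bool" where
  "bounded_multilinear_on s s' E j T \<longleftrightarrow>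
     (\<forall>us\<in>lists E. \<forall>vs\<in>lists E. length us + 1 + length vs = j \<longrightarrow>
        (\<forall>x\<in>E. \<forall>y\<in>E. T (us @ (x + y) # vs) = T (us @ x # vs) + T (us @ y # vs)) \<and>
        (\<forall>c. \<forall>x\<in>E. T (us @ s c x # vs) = s' c (T (us @ x # vs)))) \<and>
     (\<exists>M. \<forall>vs\<in>lists E. length vs = j \<longrightarrow> norm (T vs) \<le> M * prod_list (map norm vs))"

(* f is r times continuously Frechet differentiable on S, a relatively open subset of the
   subspace E.  D j x is the j-th derivative at x, a j-linear map on E encoded as a function on
   lists of length j; differentiability of D j and continuity of D r are with respect to the
   operator norm of multilinear maps. *)
definition C_on ::
    "('k \<Rightarrow> 'a::real_normed_vector \<Rightarrow> 'a) \<Rightarrow> ('k \<Rightarrow> 'b::real_normed_vector \<Rightarrow> 'b) \<Rightarrow>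
     nat \<Rightarrow> 'a set \<Rightarrow> 'a set \<Rightarrow> ('a \<Rightarrow> 'b) \<Rightarrow> bool" where
  "C_on s s' r E S f \<longleftrightarrow> openin (top_of_set E) S \<and>
     (\<exists>D :: nat \<Rightarrow> 'a \<Rightarrow> 'a list \<Rightarrow> 'b.
        (\<forall>x\<in>S. D 0 x [] = f x) \<and>
        (\<forall>j\<le>r. \<forall>x\<in>S. bounded_multilinear_on s s' E j (D j x)) \<and>
        (\<forall>j<r. \<forall>x\<in>S. \<forall>e>0. \<exists>d>0. \<forall>h\<in>E. norm h < d \<and> x + h \<in> S \<longrightarrow>
           (\<forall>vs\<in>lists E. length vs = j \<longrightarrow>
              norm (D j (x + h) vs - D j x vs - D (Suc j) x (h # vs))
                \<le> e * norm h * prod_list (map norm vs))) \<and>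
        (\<forall>x\<in>S. \<forall>e>0. \<exists>d>0. \<forall>y\<in>S. dist y x < d \<longrightarrow>
           (\<forall>vs\<in>lists E. length vs = r \<longrightarrow>
              norm (D r y vs - D r x vs) \<le> e * prod_list (map norm vs))))"

definition half_second_derivative ::
    "('a::real_normed_vector \<Rightarrow> 'b::real_normed_vector) \<Rightarrow> 'a \<Rightarrow> 'a \<Rightarrow> 'a \<Rightarrow> 'b" where
  "half_second_derivative G x v w =
     (1/2) *\<^sub>R blinfun_apply
       (frechet_derivative (\<lambda>y. Blinfun (frechet_derivative G (at y))) (at x) v) w"

definition subspace_sum :: "nat set \<Rightarrow> (nat \<Rightarrow> 'a::ab_group_add set) \<Rightarrow> 'a set" where
  "subspace_sum I M = {(\<Sum>i\<in>I. f i) | f. \<forall>i\<in>I. f i \<in> M i}"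

definition direct_sum ::
    "('k::field \<Rightarrow> 'a::ab_group_add \<Rightarrow> 'a) \<Rightarrow> nat set \<Rightarrow> (nat \<Rightarrow> 'a set) \<Rightarrow> bool" where
  "direct_sum s I M \<longleftrightarrow>
     (\<forall>i\<in>I. module.subspace s (M i)) \<and>
     (\<forall>x. \<exists>!f. f \<in> (\<Pi>\<^sub>E i\<in>I. M i) \<and> x = (\<Sum>i\<in>I. f i))"

definition component :: "nat set \<Rightarrow> (nat \<Rightarrow> 'a::ab_group_add set) \<Rightarrow> nat \<Rightarrow> 'a \<Rightarrow> 'a" where
  "component I M i x = (THE f. f \<in> (\<Pi>\<^sub>E i\<in>I. M i) \<and> x = (\<Sum>i\<in>I. f i)) i"

(* q is the order of smoothness required of the remainder. *)
definition k_surjective ::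
    "('k::real_normed_field \<Rightarrow> 'a::real_normed_vector \<Rightarrow> 'a) \<Rightarrow>
     ('k \<Rightarrow> 'b::real_normed_vector \<Rightarrow> 'b) \<Rightarrow> nat \<Rightarrow> nat \<Rightarrow> 'k set \<Rightarrow> ('k \<Rightarrow> 'a \<Rightarrow> 'b) \<Rightarrow> bool" where
  "k_surjective sB sC q k U L \<longleftrightarrow>
     (\<forall>y. \<exists>b :: nat \<Rightarrow> 'a. \<exists>rem :: 'k \<Rightarrow> 'b. C_on (*) sC q UNIV U rem \<and>
        (\<forall>\<epsilon>\<in>U. L \<epsilon> (\<Sum>i\<le>k. sB (\<epsilon> ^ i) (b i)) = sC (\<epsilon> ^ k) y + sC (\<epsilon> ^ (k + 1)) (rem \<epsilon>)))"

definition p_family ::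
    "('k::real_normed_field \<Rightarrow> 'a::real_normed_vector \<Rightarrow> 'a) \<Rightarrow> nat \<Rightarrow> (nat \<Rightarrow> 'a \<Rightarrow> 'a) \<Rightarrow>
     'k \<Rightarrow> 'a \<Rightarrow> 'a" where
  "p_family sB k \<phi> \<epsilon> v = v + (\<Sum>i\<in>{1..k}. sB (\<epsilon> ^ i) (\<phi> i v))"

definition P_family ::
    "('k::real_normed_field \<Rightarrow> 'b::real_normed_vector \<Rightarrow> 'b) \<Rightarrow> nat \<Rightarrow> (nat \<Rightarrow> 'a \<Rightarrow> 'b) \<Rightarrow>
     'k \<Rightarrow> 'a \<Rightarrow> 'b" where
  "P_family sC k S \<epsilon> v = (\<Sum>i\<in>{1..k+1}. sC (\<epsilon> ^ (i - 1)) (S i v))"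

(* Nc i, R i, S i are used for i = 1, ..., k+1 and \<phi> i for i = 1, ..., k.  In the direct sum
   of the domain, N is placed as the summand of index k+2. *)
definition associated_sums ::
    "('k::real_normed_field \<Rightarrow> 'a::real_normed_vector \<Rightarrow> 'a) \<Rightarrow>
     ('k \<Rightarrow> 'b::real_normed_vector \<Rightarrow> 'b) \<Rightarrow> nat \<Rightarrow> ('k \<Rightarrow> 'a \<Rightarrow> 'b) \<Rightarrow>
     (nat \<Rightarrow> 'a set) \<Rightarrow> 'a set \<Rightarrow> (nat \<Rightarrow> 'b set) \<Rightarrow> (nat \<Rightarrow> 'a \<Rightarrow> 'b) \<Rightarrow> (nat \<Rightarrow> 'a \<Rightarrow> 'a) \<Rightarrow> bool" where
  "associated_sums sB sC k L Nc N R S \<phi> \<longleftrightarrow>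
     direct_sum sB {1..k+2} (Nc(k+2 := N)) \<and>
     direct_sum sC {1..k+1} R \<and>
     (\<forall>i\<in>{1..k+1}. bounded_operator sB sC (S i) \<and> GL_on sB sC (Nc i) (R i) (S i)) \<and>
     (\<forall>i\<in>{1..k}. bounded_operator sB sB (\<phi> i) \<and> range (\<phi> i) \<subseteq> subspace_sum {1..k+1-i} Nc) \<and>
     (\<forall>i\<le>k. \<forall>n\<in>Nc (i+1).
        (\<lambda>\<epsilon>. norm (L \<epsilon> (p_family sB k \<phi> \<epsilon> n) - sC (\<epsilon> ^ i) (S (i+1) n)))
          \<in> O[at 0](\<lambda>\<epsilon>. norm \<epsilon> ^ (i+1))) \<and>
     (\<forall>n\<in>N. (\<lambda>\<epsilon>. norm (L \<epsilon> (p_family sB k \<phi> \<epsilon> n))) \<in> O[at 0](\<lambda>\<epsilon>. norm \<epsilon> ^ (k+1))) \<and>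
     (\<forall>\<epsilon>. (\<forall>n\<in>N. P_family sC k S \<epsilon> n = 0) \<and>
        (\<forall>i\<in>{1..k+1}. \<forall>n\<in>Nc i.
           (\<forall>j\<in>{1..<i}. component {1..k+1} R j (P_family sC k S \<epsilon> n) = 0) \<and>
           component {1..k+1} R i (P_family sC k S \<epsilon> n) = sC (\<epsilon> ^ (i - 1)) (S i n)))"

(* q is the prescribed order of smoothness.  The bound on r makes "r sufficiently large" explicit:
   bbar and the remainders in k_surjective, obtained from functions of class r and r - 1 by
   division by powers of \<epsilon> of degree 2k and k+1, are then automatically of class q. *)
locale approximate_solution = B: banach_over sB + C: banach_over sC
  for sB :: "'k::real_normed_field \<Rightarrow> 'a::banach \<Rightarrow> 'a"
    and sC :: "'k \<Rightarrow> 'b::banach \<Rightarrow> 'b" +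
  fixes k q r :: nat
    and U :: "'k set"
    and G :: "'a \<Rightarrow> 'b"
    and z :: "'k \<Rightarrow> 'a"
    and bbar :: "'k \<Rightarrow> 'b"
    and Nc :: "nat \<Rightarrow> 'a set"
    and N :: "'a set"
    and R :: "nat \<Rightarrow> 'b set"
    and S :: "nat \<Rightarrow> 'a \<Rightarrow> 'b"
    and \<phi> :: "nat \<Rightarrow> 'a \<Rightarrow> 'a"
  assumes k_pos: "1 \<le> k"
    and q_pos: "1 \<le> q"
    and r_large: "2 * k + q + 2 \<le> r"
    and U_open: "open U"
    and U_zero: "0 \<in> U"
    and G_smooth: "C_on sB sC r UNIV UNIV G"
    and z_smooth: "C_on (*) sB r UNIV U z"
    and z_zero: "z 0 = 0"
    and bbar_smooth: "C_on (*) sC q UNIV U bbar"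
    and approx: "\<epsilon> \<in> U \<Longrightarrow> G (z \<epsilon>) = sC (\<epsilon> ^ (2 * k)) (bbar \<epsilon>)"
    and surj: "k_surjective sB sC q k U (\<lambda>\<epsilon>. frechet_derivative G (at (z \<epsilon>)))"
    and assoc: "associated_sums sB sC k (\<lambda>\<epsilon>. frechet_derivative G (at (z \<epsilon>))) Nc N R S \<phi>"
    and closed_Nc: "i \<in> {1..k+1} \<Longrightarrow> closed (Nc i)"
    and closed_N: "closed N"
    and closed_R: "i \<in> {1..k+1} \<Longrightarrow> closed (R i)"

definition hat_map ::
    "('k::real_normed_field \<Rightarrow> 'a::real_normed_vector \<Rightarrow> 'a) \<Rightarrow> nat \<Rightarrow>
     (nat \<Rightarrow> 'k \<Rightarrow> 'a \<Rightarrow> 'a) \<Rightarrow> 'k \<Rightarrow> 'a \<Rightarrow> 'a" where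
  "hat_map sB k nbar \<epsilon> n = (\<Sum>i\<in>{1..k+1}. sB (\<epsilon> ^ (k + 1 - i)) (nbar i \<epsilon> n))"

(* Smooth dependence on (\<epsilon>, n) is differentiability on the Banach space of pairs of a scalar and
   an element of N. *)
definition solution_family ::
    "('k::real_normed_field \<Rightarrow> 'a::real_normed_vector \<Rightarrow> 'a) \<Rightarrow> nat \<Rightarrow> nat \<Rightarrow>
     ('a \<Rightarrow> 'b::zero) \<Rightarrow> ('k \<Rightarrow> 'a) \<Rightarrow> (nat \<Rightarrow> 'a set) \<Rightarrow> 'a set \<Rightarrow> (nat \<Rightarrow> 'a \<Rightarrow> 'a) \<Rightarrow>
     'k set \<Rightarrow> real \<Rightarrow> (nat \<Rightarrow> 'k \<Rightarrow> 'a \<Rightarrow> 'a) \<Rightarrow> bool" where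
  "solution_family sB k q G z Nc N \<phi> V \<rho> nbar \<longleftrightarrow>
     (\<forall>i\<in>{1..k+1}. C_on (prod_scale (*) sB) sB q (UNIV \<times> N) (V \<times> (N \<inter> ball 0 \<rho>))
        (\<lambda>(\<epsilon>, n). nbar i \<epsilon> n)) \<and>
     C_on (prod_scale (*) sB) sB q (UNIV \<times> N) (V \<times> (N \<inter> ball 0 \<rho>))
        (\<lambda>(\<epsilon>, n). hat_map sB k nbar \<epsilon> n) \<and>
     (\<forall>\<epsilon>\<in>V. \<forall>n \<in> N \<inter> ball 0 \<rho>.
        (\<forall>i\<in>{1..k+1}. nbar i \<epsilon> n \<in> Nc i) \<and>
        G (z \<epsilon> + sB (\<epsilon> ^ k) (p_family sB k \<phi> \<epsilon> (hat_map sB k nbar \<epsilon> n + n))) = 0)"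

end

theory Submission
  imports Defs
begin

text \<open>With the unknown written as \<open>n\<^sub>i\<^sup>c = S\<^sub>i\<^sup>-\<^sup>1 \<P>\<^sub>i y\<close> for \<open>y\<close> in the target space, inserting the
  ansatz into \<open>G\<close> gives a function of \<open>(\<epsilon>, n, y)\<close> that vanishes to order \<open>2 k\<close> in \<open>\<epsilon>\<close>, by the
  approximation property and the estimates for \<open>L(\<epsilon>) p\<^sub>k(\<epsilon>)\<close> on the summands. The quotient
  by \<open>\<epsilon>\<^sup>2\<^sup>k\<close> is a Taylor remainder integral, hence smooth, and equals
  \<open>y + b(0) + \<B>\<^sub>0 (n\<^sub>k\<^sub>+\<^sub>1\<^sup>c + n)\<^sup>2\<close> at \<open>\<epsilon> = 0\<close>. In both cases of the theorem the derivative of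
  this function in \<open>y\<close> at the starting point is close to the identity, so its zeros are the
  fixed points of a contraction with parameters.

  Smoothness is tracked through locally bounded derivatives: class \<open>C\<^sup>n\<close> implies \<open>n\<close> locally
  bounded derivatives, and these imply class \<open>C\<^sup>n\<^sup>-\<^sup>1\<close>. The bound on \<open>r\<close> leaves room for exactly
  the two orders that are lost, one in the parameter integral and one in the return to \<open>C\<^sup>q\<close>.\<close>

subsection \<open>Normed scalings and multilinear maps\<close>

text \<open>Taking \<open>y\<close> in the target space as unknown makes the linear part of the
  divided equation the identity: \<open>S i\<close> composed with \<open>T i\<close> is the
  projection to \<open>R i\<close>, and these projections sum to the identity. The obstacle is the
  division by \<epsilon>^(2k). The estimates for L(\<epsilon>) p_k(\<epsilon>) hold for each vector
  separately, with a constant depending on that vector, so they yield no smooth quotient by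
  themselves. They serve only to compute, for fixed \<open>n\<close> and \<open>y\<close>, the limit
  of the quotient as \<epsilon> tends to 0 through positive reals. That this limit exists forces the
  lower Taylor coefficients in \<epsilon> to vanish, and its value identifies the quotient at
  \<epsilon> = 0. Derivatives are real Frechet derivatives throughout; linearity over the scalar
  field is carried along as a homogeneity condition, so one argument serves real and complex
  scalars. Functions of \<open>n\<close> are extended from \<open>N\<close> to the whole space by a
  bounded projection, which keeps all domains open until the last step.\<close>

locale normed_scale = vector_space scale
  for scale :: "'k::real_normed_field \<Rightarrow> 'a::real_normed_vector \<Rightarrow> 'a" +
  assumes norm_scale: "norm (scale c x) = norm c * norm x"
    and scale_of_real: "scale (of_real t) x = t *\<^sub>R x"
begin

lemma scale_scaleR: "scale c (t *\<^sub>R x) = t *\<^sub>R scale c x"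
  by (metis scale_of_real scale_left_commute)

lemma bounded_linear_scale: "bounded_linear (scale c)"
  by (rule bounded_linear_intro[where K="norm c"])
     (simp_all add: scale_right_distrib scale_scaleR norm_scale mult.commute)

lemma bounded_bilinear_scale: "bounded_bilinear scale"
proof
  show "scale (r *\<^sub>R a) b = r *\<^sub>R scale a b" for r a b
    by (metis scale_of_real scale_scale scaleR_conv_of_real)
  show "\<exists>K. \<forall>a b. norm (scale a b) \<le> norm a * norm b * K"
    by (rule exI[of _ 1]) (simp add: norm_scale)
qed (simp_all add: scale_right_distrib scale_left_distrib scale_scaleR)

end

lemma banach_over_imp_normed_scale: "banach_over s \<Longrightarrow> normed_scale s"
  by (simp add: banach_over_def normed_scale_def banach_over_axioms_def normed_scale_axioms_def)

text \<open>The scalars acting on themselves. This instance is the reason why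
  \<open>normed_scale\<close> drops completeness from \<open>banach_over\<close>: the type of
  scalars is only a real normed field.\<close>

lemma normed_scale_mult: "normed_scale ((*) :: 'k::real_normed_field \<Rightarrow> 'k \<Rightarrow> 'k)"
  by unfold_locales (simp_all add: norm_mult algebra_simps scaleR_conv_of_real)

lemma normed_scale_prod:
  assumes "normed_scale s" "normed_scale s'"
  shows "normed_scale (prod_scale s s')"
proof -
  interpret A: normed_scale s by fact
  interpret B: normed_scale s' by fact
  show ?thesis
    by unfold_locales
      (auto simp: prod_scale_def A.scale_right_distrib A.scale_left_distrib B.scale_right_distrib
        B.scale_left_distrib A.norm_scale B.norm_scale A.scale_of_real B.scale_of_real norm_prod_def
        power_mult_distrib real_sqrt_mult simp flip: distrib_left)
qed

text \<open>The algebraic half of \<open>bounded_multilinear_on\<close> on the whole space. The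
  bound is kept apart because later it has to hold with one constant near a point.\<close>

definition multilin ::
    "('k \<Rightarrow> 'a::real_normed_vector \<Rightarrow> 'a) \<Rightarrow> ('k \<Rightarrow> 'b::real_normed_vector \<Rightarrow> 'b) \<Rightarrow>
     nat \<Rightarrow> ('a list \<Rightarrow> 'b) \<Rightarrow> bool" where
  "multilin s s' j T \<longleftrightarrow>
     (\<forall>us vs. length us + 1 + length vs = j \<longrightarrow>
        (\<forall>x y. T (us @ (x + y) # vs) = T (us @ x # vs) + T (us @ y # vs)) \<and>
        (\<forall>c x. T (us @ s c x # vs) = s' c (T (us @ x # vs))))"

lemma multilin_add:
  "multilin s s' j T \<Longrightarrow> length us + 1 + length vs = j \<Longrightarrow>
    T (us @ (x + y) # vs) = T (us @ x # vs) + T (us @ y # vs)"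
  by (simp add: multilin_def)

lemma multilin_scale:
  "multilin s s' j T \<Longrightarrow> length us + 1 + length vs = j \<Longrightarrow>
    T (us @ s c x # vs) = s' c (T (us @ x # vs))"
  by (simp add: multilin_def)

lemma multilin_scaleR:
  assumes "multilin s s' j T" "normed_scale s" "normed_scale s'" "length us + 1 + length vs = j"
  shows "T (us @ t *\<^sub>R x # vs) = t *\<^sub>R T (us @ x # vs)"
  using multilin_scale[OF assms(1,4), of "of_real t" x] assms(2,3)
  by (simp add: normed_scale.scale_of_real)

lemma multilin_diff:
  assumes "multilin s s' j T" "length us + 1 + length vs = j"
  shows "T (us @ (x - y) # vs) = T (us @ x # vs) - T (us @ y # vs)"
  using multilin_add[OF assms, of "x - y" y] by simp

lemma multilin_normalize:
  assumes T: "multilin s s' j T" and s: "normed_scale s" "normed_scale s'"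
    and "length us + length vs = j"
  shows "T (us @ vs) = prod_list (map norm vs) *\<^sub>R T (us @ map sgn vs)"
  using assms(4)
proof (induction vs arbitrary: us)
  case (Cons v vs)
  have "T (us @ v # vs) = T (us @ norm v *\<^sub>R sgn v # vs)"
    by (cases "v = 0") (simp_all add: sgn_div_norm)
  also have "\<dots> = norm v *\<^sub>R T ((us @ [sgn v]) @ vs)"
    using Cons.prems by (subst multilin_scaleR[OF T s]) auto
  also have "T ((us @ [sgn v]) @ vs) = prod_list (map norm vs) *\<^sub>R T ((us @ [sgn v]) @ map sgn vs)"
    using Cons.prems by (intro Cons.IH) auto
  finally show ?case by simp
qed simp

text \<open>Scaling each argument to norm at most 1 (\<open>sgn\<close> sends 0 to 0, which is
  harmless) turns a bound on the unit ball into an operator norm bound. The families in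
  \<open>lip_class\<close> are controlled only for directions of bounded norm, so this is the way
  back to multilinear estimates.\<close>

lemma multilin_bound:
  assumes "multilin s s' j T" "normed_scale s" "normed_scale s'"
    and M: "\<And>vs. length vs = j \<Longrightarrow> (\<forall>v\<in>set vs. norm v \<le> 1) \<Longrightarrow> norm (T vs) \<le> M"
    and "length vs = j"
  shows "norm (T vs) \<le> M * prod_list (map norm vs)"
proof -
  have "T vs = prod_list (map norm vs) *\<^sub>R T (map sgn vs)"
    using multilin_normalize[OF assms(1-3), of "[]" vs] assms(5) by simp
  moreover have "norm (T (map sgn vs)) \<le> M"
    using assms(5) by (intro M) (auto simp: norm_sgn)
  moreover have "0 \<le> prod_list (map norm vs)" by (induction vs) auto
  ultimately show ?thesis by (simp add: mult.commute[of M] mult_left_mono)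
qed

lemma prod_list_norm_nonneg: "0 \<le> prod_list (map norm vs)"
  by (induction vs) auto

text \<open>The list convention is that of \<^const>\<open>C_on\<close>: the direction of the last differentiation
  comes first.\<close>

definition lip_jet ::
    "('k \<Rightarrow> 'a::real_normed_vector \<Rightarrow> 'a) \<Rightarrow> ('k \<Rightarrow> 'b::real_normed_vector \<Rightarrow> 'b) \<Rightarrow>
     nat \<Rightarrow> 'a set \<Rightarrow> (nat \<Rightarrow> 'a \<Rightarrow> 'a list \<Rightarrow> 'b) \<Rightarrow> bool" where
  "lip_jet s s' n S D \<longleftrightarrow> open S \<and>
     (\<forall>j\<le>n. \<forall>x\<in>S. multilin s s' j (D j x)) \<and>
     (\<forall>j\<le>n. \<forall>x\<in>S. \<exists>d>0. \<exists>M. \<forall>y\<in>S \<inter> ball x d. \<forall>vs. length vs = j \<longrightarrow>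
        norm (D j y vs) \<le> M * prod_list (map norm vs)) \<and>
     (\<forall>j<n. \<forall>x\<in>S. \<forall>vs. length vs = j \<longrightarrow>
        ((\<lambda>x. D j x vs) has_derivative (\<lambda>h. D (Suc j) x (h # vs))) (at x))"

lemma lip_jet_open: "lip_jet s s' n S D \<Longrightarrow> open S"
  by (simp add: lip_jet_def)

lemma lip_jet_multilin: "lip_jet s s' n S D \<Longrightarrow> j \<le> n \<Longrightarrow> x \<in> S \<Longrightarrow> multilin s s' j (D j x)"
  by (simp add: lip_jet_def)

lemma lip_jet_deriv:
  "lip_jet s s' n S D \<Longrightarrow> j < n \<Longrightarrow> x \<in> S \<Longrightarrow> length vs = j \<Longrightarrow>
    ((\<lambda>x. D j x vs) has_derivative (\<lambda>h. D (Suc j) x (h # vs))) (at x)"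
  by (simp add: lip_jet_def)

text \<open>Finitely many orders are involved, so the least radius and the greatest constant serve
  all of them at once.\<close>

lemma lip_jet_bounded:
  assumes J: "lip_jet s s' n S D" and x: "x \<in> S"
  shows "\<exists>d>0. \<exists>M\<ge>0. ball x d \<subseteq> S \<and> (\<forall>j\<le>n. \<forall>y\<in>ball x d. \<forall>vs. length vs = j \<longrightarrow>
        norm (D j y vs) \<le> M * prod_list (map norm vs))"
proof -
  have "\<forall>j\<in>{..n}. \<exists>d>0. \<exists>M. \<forall>y\<in>S \<inter> ball x d. \<forall>vs. length vs = j \<longrightarrow>
        norm (D j y vs) \<le> M * prod_list (map norm vs)"
    using J x unfolding lip_jet_def by simp
  from bchoice[OF this] obtain d where d': "\<forall>j\<in>{..n}. d j > 0 \<and> (\<exists>M. \<forall>y\<in>S \<inter> ball x (d j).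
      \<forall>vs. length vs = j \<longrightarrow> norm (D j y vs) \<le> M * prod_list (map norm vs))"
    by (elim exE)
  then have d: "d j > 0" if "j \<le> n" for j using that by simp
  from d' have "\<forall>j\<in>{..n}. \<exists>M. \<forall>y\<in>S \<inter> ball x (d j).
      \<forall>vs. length vs = j \<longrightarrow> norm (D j y vs) \<le> M * prod_list (map norm vs)"
    by simp
  from bchoice[OF this] obtain M where M': "\<forall>j\<in>{..n}. \<forall>y\<in>S \<inter> ball x (d j).
      \<forall>vs. length vs = j \<longrightarrow> norm (D j y vs) \<le> M j * prod_list (map norm vs)"
    by (elim exE)
  have M: "norm (D j y vs) \<le> M j * prod_list (map norm vs)"
    if "j \<le> n" "y \<in> S" "y \<in> ball x (d j)" "length vs = j" for j y vs
    using M' that by simp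
  obtain d0 where d0: "d0 > 0" "ball x d0 \<subseteq> S"
    using lip_jet_open[OF J] x open_contains_ball by blast
  define e where "e = min d0 (Min (d ` {..n}))"
  define K where "K = Max (insert 0 (M ` {..n}))"
  have e: "e > 0" using d d0 by (auto simp: e_def)
  have "norm (D j y vs) \<le> K * prod_list (map norm vs)"
    if "j \<le> n" "y \<in> ball x e" "length vs = j" for j y vs
  proof -
    have "e \<le> d j" unfolding e_def using that(1) by (intro min.coboundedI2 Min_le) auto
    then have "norm (D j y vs) \<le> M j * prod_list (map norm vs)"
      using that d0 by (intro M) (auto simp: e_def)
    also have "\<dots> \<le> K * prod_list (map norm vs)"
      unfolding K_def using that(1) by (intro mult_right_mono prod_list_norm_nonneg Max_ge) auto
    finally show ?thesis .
  qed
  moreover have "K \<ge> 0" unfolding K_def by (intro Max_ge) auto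
  moreover have "ball x e \<subseteq> S" using d0 by (auto simp: e_def)
  ultimately show ?thesis using e by (intro exI[of _ e] conjI exI[of _ K]) simp_all
qed

text \<open>\<open>lip_jet\<close> demands differentiability only for a fixed argument list. The
  bound on the next order and the mean value inequality make the increment small uniformly in
  \<open>vs\<close>, that is, in operator norm.\<close>

lemma lip_jet_lipschitz:
  assumes J: "lip_jet s s' n S D" and C: "convex C" "C \<subseteq> S"
    and M: "\<And>y vs. y \<in> C \<Longrightarrow> length vs = Suc j \<Longrightarrow> norm (D (Suc j) y vs) \<le> M * prod_list (map norm vs)"
    and M0: "0 \<le> M"
    and j: "j < n" "length vs = j" and y: "y \<in> C" "y' \<in> C"
  shows "norm (D j y vs - D j y' vs) \<le> M * norm (y - y') * prod_list (map norm vs)"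
proof -
  have "norm (D j y vs - D j y' vs) \<le> (M * prod_list (map norm vs)) * norm (y - y')"
  proof (rule differentiable_bound[OF C(1) _ _ y])
    fix z assume z: "z \<in> C"
    show "((\<lambda>x. D j x vs) has_derivative (\<lambda>h. D (Suc j) z (h # vs))) (at z within C)"
      using lip_jet_deriv[OF J j(1) _ j(2)] z C(2) by (blast intro: has_derivative_at_withinI)
    show "onorm (\<lambda>h. D (Suc j) z (h # vs)) \<le> M * prod_list (map norm vs)"
    proof (rule onorm_bound)
      show "norm (D (Suc j) z (h # vs)) \<le> M * prod_list (map norm vs) * norm h" for h
        using M[OF z, of "h # vs"] j by (simp add: algebra_simps)
    qed (simp add: M0 prod_list_norm_nonneg)
  qed
  then show ?thesis by (simp add: algebra_simps)
qed

text \<open>On the segment from \<open>y\<close> to \<open>y'\<close> the derivative deviates from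
  its value at \<open>y\<close> by at most the Lipschitz bound, which gives the first-order Taylor
  error uniformly in \<open>vs\<close>. It needs a bound two orders up; this is where an order is
  lost on the way back to \<open>C_on\<close>.\<close>

lemma lip_jet_quadratic:
  assumes J: "lip_jet s s' n S D" and C: "convex C" "C \<subseteq> S"
    and M: "\<And>y vs. y \<in> C \<Longrightarrow> length vs = Suc (Suc j) \<Longrightarrow>
      norm (D (Suc (Suc j)) y vs) \<le> M * prod_list (map norm vs)"
    and M0: "0 \<le> M"
    and j: "Suc j < n" "length vs = j" and y: "y \<in> C" "y' \<in> C"
  shows "norm (D j y' vs - D j y vs - D (Suc j) y ((y' - y) # vs))
    \<le> M * (norm (y' - y))\<^sup>2 * prod_list (map norm vs)"
proof -
  let ?L = "closed_segment y y'"
  have L: "?L \<subseteq> C" using C(1) y by (simp add: closed_segment_subset)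
  have "norm (D j y' vs - D j y vs - D (Suc j) y ((y' - y) # vs))
      \<le> norm (y' - y) * (M * norm (y' - y) * prod_list (map norm vs))"
  proof (rule differentiable_bound_linearization[where S="?L"])
    show "y + t *\<^sub>R (y' - y) \<in> ?L" if "t \<in> {0..1}" for t
      using that by (auto simp: in_segment algebra_simps intro!: exI[of _ t])
    show "((\<lambda>x. D j x vs) has_derivative (\<lambda>h. D (Suc j) z (h # vs))) (at z within ?L)" if "z \<in> ?L" for z
      using lip_jet_deriv[OF J _ _ j(2)] that L C(2) j(1)
      by (meson Suc_lessD has_derivative_at_withinI subset_iff)
    show "y \<in> ?L" by simp
    show "onorm ((\<lambda>h. D (Suc j) z (h # vs)) - (\<lambda>h. D (Suc j) y (h # vs)))
        \<le> M * norm (y' - y) * prod_list (map norm vs)" if z: "z \<in> ?L" for z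
    proof (rule onorm_bound)
      show "0 \<le> M * norm (y' - y) * prod_list (map norm vs)"
        by (simp add: M0 prod_list_norm_nonneg)
      fix h
      have "norm (D (Suc j) z (h # vs) - D (Suc j) y (h # vs))
          \<le> M * norm (z - y) * prod_list (map norm (h # vs))"
        using z L y by (intro lip_jet_lipschitz[OF J C M M0]) (use j in auto)
      also have "\<dots> \<le> M * norm (y' - y) * prod_list (map norm (h # vs))"
        using segment_bound1[OF z] M0
        by (intro mult_right_mono mult_left_mono prod_list_norm_nonneg) 
      finally show "norm (((\<lambda>h. D (Suc j) z (h # vs)) - (\<lambda>h. D (Suc j) y (h # vs))) h)
          \<le> M * norm (y' - y) * prod_list (map norm vs) * norm h"
        by (simp add: algebra_simps)
    qed
  qed
  then show ?thesis by (simp add: power2_eq_square algebra_simps)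
qed

text \<open>No order is lost in this direction: the local bound at order \<open>n\<close> comes from
  continuity of the top derivative, those at lower orders from the differentiability estimate
  itself, taken with error factor 1.\<close>

lemma C_on_imp_lip_jet:
  assumes "C_on s s' n UNIV S f" and s: "normed_scale s" "normed_scale s'"
  shows "\<exists>D. lip_jet s s' n S D \<and> (\<forall>x\<in>S. D 0 x [] = f x)"
proof -
  from assms(1) have S: "open S" by (simp add: C_on_def)
  from assms(1) obtain D where "(\<forall>x\<in>S. D 0 x [] = f x) \<and>
        (\<forall>j\<le>n. \<forall>x\<in>S. bounded_multilinear_on s s' UNIV j (D j x)) \<and>
        (\<forall>j. j < n \<longrightarrow> (\<forall>x\<in>S. \<forall>e>0. \<exists>d>0. \<forall>h\<in>UNIV. norm h < d \<and> x + h \<in> S \<longrightarrow>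
           (\<forall>vs\<in>lists UNIV. length vs = j \<longrightarrow>
              norm (D j (x + h) vs - D j x vs - D (Suc j) x (h # vs))
                \<le> e * norm h * prod_list (map norm vs)))) \<and>
        (\<forall>x\<in>S. \<forall>e>0. \<exists>d>0. \<forall>y\<in>S. dist y x < d \<longrightarrow>
           (\<forall>vs\<in>lists UNIV. length vs = n \<longrightarrow>
              norm (D n y vs - D n x vs) \<le> e * prod_list (map norm vs)))"
    (is "?A \<and> ?B \<and> ?C \<and> ?E")
    using assms(1)[unfolded C_on_def, THEN conjunct2] by (elim exE)
  then have D0: ?A and B: ?B and C: ?C and E: ?E by simp_all
  have ml: "bounded_multilinear_on s s' UNIV j (D j x)" if "j \<le> n" "x \<in> S" for j x
    using B that by blast
  have df: "\<exists>d>0. \<forall>h. norm h < d \<and> x + h \<in> S \<longrightarrow>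
           (\<forall>vs. length vs = j \<longrightarrow> norm (D j (x + h) vs - D j x vs - D (Suc j) x (h # vs))
                \<le> e * norm h * prod_list (map norm vs))"
    if "j < n" "x \<in> S" "e > 0" for j x e
    using bspec[OF C[THEN spec, THEN mp, OF that(1)] that(2), THEN spec, THEN mp, OF that(3)] by simp
  have ct: "\<exists>d>0. \<forall>y\<in>S. dist y x < d \<longrightarrow>
           (\<forall>vs. length vs = n \<longrightarrow> norm (D n y vs - D n x vs) \<le> e * prod_list (map norm vs))"
    if "x \<in> S" "e > 0" for x e
    using bspec[OF E that(1), THEN spec, THEN mp, OF that(2)] by simp
  have bd: "\<exists>M\<ge>0. \<forall>vs. length vs = j \<longrightarrow> norm (D j x vs) \<le> M * prod_list (map norm vs)"
    if jx: "j \<le> n" "x \<in> S" for j x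
  proof -
    obtain M where M: "\<And>vs. length vs = j \<Longrightarrow> norm (D j x vs) \<le> M * prod_list (map norm vs)"
      using ml[OF jx, unfolded bounded_multilinear_on_def, THEN conjunct2] by auto
    have "norm (D j x vs) \<le> max 0 M * prod_list (map norm vs)" if "length vs = j" for vs
      by (rule order_trans[OF M[OF that] mult_right_mono[OF max.cobounded2 prod_list_norm_nonneg]])
    then show ?thesis by (intro exI[of _ "max 0 M"]) auto
  qed
  have mm: "multilin s s' j (D j x)" if "j \<le> n" "x \<in> S" for j x
    using ml[OF that, unfolded bounded_multilinear_on_def, THEN conjunct1]
    unfolding multilin_def lists_UNIV by blast
  have lb: "\<exists>d>0. \<exists>M. \<forall>y\<in>S \<inter> ball x d. \<forall>vs. length vs = j \<longrightarrow>
        norm (D j y vs) \<le> M * prod_list (map norm vs)" if j: "j \<le> n" and x: "x \<in> S" for j x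
  proof (cases "j = n")
    case True
    obtain M where M: "\<And>vs. length vs = j \<Longrightarrow> norm (D j x vs) \<le> M * prod_list (map norm vs)"
      using bd[OF j x] by auto
    obtain d where d: "d > 0" "\<And>y vs. y \<in> S \<Longrightarrow> dist y x < d \<Longrightarrow> length vs = n \<Longrightarrow>
        norm (D n y vs - D n x vs) \<le> 1 * prod_list (map norm vs)"
      using ct[OF x zero_less_one] by auto
    have "norm (D j y vs) \<le> (M + 1) * prod_list (map norm vs)"
      if "y \<in> S \<inter> ball x d" "length vs = j" for y vs
      using d(2)[of y vs] M[of vs] that True norm_triangle_sub[of "D n y vs" "D n x vs"]
      by (auto simp: dist_commute algebra_simps)
    then show ?thesis using d(1) by (intro exI[of _ d] conjI exI[of _ "M + 1"]) simp_all
  next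
    case False
    then have jn: "j < n" using j by simp
    obtain M where M: "\<And>vs. length vs = j \<Longrightarrow> norm (D j x vs) \<le> M * prod_list (map norm vs)"
      using bd[OF j x] by auto
    obtain M' where M': "M' \<ge> 0" "\<And>vs. length vs = Suc j \<Longrightarrow> norm (D (Suc j) x vs) \<le> M' * prod_list (map norm vs)"
      using bd[OF _ x, of "Suc j"] jn by (auto simp: Suc_le_eq)
    obtain d where d: "d > 0" "\<And>h vs. norm h < d \<Longrightarrow> x + h \<in> S \<Longrightarrow> length vs = j \<Longrightarrow>
        norm (D j (x + h) vs - D j x vs - D (Suc j) x (h # vs)) \<le> 1 * norm h * prod_list (map norm vs)"
      using df[OF jn x zero_less_one] by auto
    have "norm (D j y vs) \<le> (M + M' * d + d) * prod_list (map norm vs)"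
      if y: "y \<in> S \<inter> ball x d" and l: "length vs = j" for y vs
    proof -
      define h where "h = y - x"
      have h: "norm h < d" "y = x + h" using y by (auto simp: h_def dist_norm norm_minus_commute)
      have "norm (D j y vs - D j x vs - D (Suc j) x (h # vs)) \<le> norm h * prod_list (map norm vs)"
        using d(2)[of h vs] h l y by auto
      also have "\<dots> \<le> d * prod_list (map norm vs)"
        using h by (intro mult_right_mono prod_list_norm_nonneg) auto
      finally have 1: "norm (D j y vs - D j x vs - D (Suc j) x (h # vs)) \<le> d * prod_list (map norm vs)" .
      have "norm (D (Suc j) x (h # vs)) \<le> M' * (norm h * prod_list (map norm vs))"
        using M'(2)[of "h # vs"] l by simp
      also have "\<dots> \<le> M' * (d * prod_list (map norm vs))"
        using h M'(1) by (intro mult_left_mono mult_right_mono prod_list_norm_nonneg) auto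
      finally have 2: "norm (D (Suc j) x (h # vs)) \<le> M' * d * prod_list (map norm vs)" by simp
      have "norm (D j y vs) \<le> norm (D j y vs - D j x vs - D (Suc j) x (h # vs))
          + (norm (D j x vs) + norm (D (Suc j) x (h # vs)))"
        using norm_triangle_ineq[of "D j y vs - D j x vs - D (Suc j) x (h # vs)" "D j x vs + D (Suc j) x (h # vs)"]
          norm_triangle_ineq[of "D j x vs" "D (Suc j) x (h # vs)"] by simp
      then show ?thesis using 1 2 M[OF l] by (simp add: algebra_simps)
    qed
    then show ?thesis using d(1) by (intro exI[of _ d] conjI exI[of _ "M + M' * d + d"]) simp_all
  qed
  have dd: "((\<lambda>x. D j x vs) has_derivative (\<lambda>h. D (Suc j) x (h # vs))) (at x)"
    if j: "j < n" and x: "x \<in> S" and l: "length vs = j" for j x vs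
    unfolding has_derivative_at_alt
  proof (intro conjI allI impI)
    obtain M' where M': "\<And>vs. length vs = Suc j \<Longrightarrow> norm (D (Suc j) x vs) \<le> M' * prod_list (map norm vs)"
      using bd[OF _ x, of "Suc j"] j by (auto simp: Suc_le_eq)
    show "bounded_linear (\<lambda>h. D (Suc j) x (h # vs))"
    proof (rule bounded_linear_intro[where K="M' * prod_list (map norm vs)"])
      have m: "multilin s s' (Suc j) (D (Suc j) x)" using mm[OF _ x, of "Suc j"] j by auto
      show "D (Suc j) x ((h + h') # vs) = D (Suc j) x (h # vs) + D (Suc j) x (h' # vs)" for h h'
        using multilin_add[OF m, of "[]" vs] l by simp
      show "D (Suc j) x (t *\<^sub>R h # vs) = t *\<^sub>R D (Suc j) x (h # vs)" for t h
        using multilin_scaleR[OF m s, of "[]" vs] l by simp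
      show "norm (D (Suc j) x (h # vs)) \<le> norm h * (M' * prod_list (map norm vs))" for h
        using M'[of "h # vs"] l by (simp add: algebra_simps)
    qed
    fix e :: real assume e: "e > 0"
    define P where "P = prod_list (map norm vs)"
    have P: "P \<ge> 0" unfolding P_def by (rule prod_list_norm_nonneg)
    \<comment> \<open>\<open>P + 1\<close> instead of \<open>P\<close> in the denominator, since an
      argument list containing 0 has \<open>P = 0\<close>.\<close>
    obtain d where d: "d > 0" "\<And>h. norm h < d \<Longrightarrow> x + h \<in> S \<Longrightarrow>
        norm (D j (x + h) vs - D j x vs - D (Suc j) x (h # vs)) \<le> e / (P + 1) * norm h * P"
      using df[OF j x, of "e / (P + 1)"] e P l by (auto simp: P_def)
    obtain d0 where d0: "d0 > 0" "ball x d0 \<subseteq> S"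
      using S x open_contains_ball by blast
    have "norm (D j y vs - D j x vs - D (Suc j) x ((y - x) # vs)) \<le> e * norm (y - x)"
      if "norm (y - x) < min d d0" for y
    proof -
      have "x + (y - x) \<in> S" using that d0 by (auto simp: dist_norm norm_minus_commute)
      then have "norm (D j (x + (y - x)) vs - D j x vs - D (Suc j) x ((y - x) # vs))
          \<le> e / (P + 1) * norm (y - x) * P"
        by (rule d(2)[rotated]) (use that in simp)
      also have "\<dots> = e * norm (y - x) * (P / (P + 1))" by simp
      also have "\<dots> \<le> e * norm (y - x) * 1"
      proof (rule mult_left_mono)
        show "P / (P + 1) \<le> 1" using P by (simp add: divide_le_eq)
        show "0 \<le> e * norm (y - x)" using e by simp
      qed
      finally show ?thesis by simp
    qed
    then show "\<exists>d>0. \<forall>y. norm (y - x) < d \<longrightarrow>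
        norm (D j y vs - D j x vs - D (Suc j) x ((y - x) # vs)) \<le> e * norm (y - x)"
      using d d0 by (intro exI[of _ "min d d0"]) auto
  qed
  have "lip_jet s s' n S D"
    unfolding lip_jet_def using S mm lb dd by auto
  then show ?thesis using D0 by blast
qed

subsection \<open>Classes of functions with locally bounded derivatives\<close>

text \<open>One bound serves all members of \<open>F\<close> near a point. With \<open>F\<close> a
  set of directional derivatives this becomes a local bound in operator norm.\<close>

definition loc_bdd :: "'a::metric_space set \<Rightarrow> ('a \<Rightarrow> 'b::real_normed_vector) set \<Rightarrow> bool" where
  "loc_bdd S F \<longleftrightarrow> (\<forall>x\<in>S. \<exists>d>0. \<exists>M. \<forall>y\<in>S \<inter> ball x d. \<forall>f\<in>F. norm (f y) \<le> M)"

lemma loc_bddE: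
  assumes "loc_bdd S F" "x \<in> S"
  obtains d M where "d > 0" "M \<ge> 0" "\<forall>y\<in>S. dist x y < d \<longrightarrow> (\<forall>f\<in>F. norm (f y) \<le> M)"
proof -
  have "\<exists>d>0. \<exists>M. \<forall>y\<in>S \<inter> ball x d. \<forall>f\<in>F. norm (f y) \<le> M"
    using assms unfolding loc_bdd_def by (rule bspec)
  then obtain d M where dM: "d > 0" "\<forall>y\<in>S \<inter> ball x d. \<forall>f\<in>F. norm (f y) \<le> M"
    by (elim exE conjE)
  show thesis
  proof (rule that[of d "max M 0"])
    show "\<forall>y\<in>S. dist x y < d \<longrightarrow> (\<forall>f\<in>F. norm (f y) \<le> max M 0)"
      using dM(2) by (simp add: le_max_iff_disj)
  qed (use dM in auto)
qed

lemma loc_bddI: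
  assumes "\<And>x. x \<in> S \<Longrightarrow> \<exists>d>0. \<exists>M. \<forall>y\<in>S. dist x y < d \<longrightarrow> (\<forall>f\<in>F. norm (f y) \<le> M)"
  shows "loc_bdd S F"
  unfolding loc_bdd_def
proof
  fix x assume "x \<in> S"
  from assms[OF this] obtain d M where "d > 0" "\<forall>y\<in>S. dist x y < d \<longrightarrow> (\<forall>f\<in>F. norm (f y) \<le> M)"
    by (elim exE conjE)
  then show "\<exists>d>0. \<exists>M. \<forall>y\<in>S \<inter> ball x d. \<forall>f\<in>F. norm (f y) \<le> M"
    by (intro exI[of _ d] conjI exI[of _ M]) simp_all
qed

lemma loc_bdd_mono:
  assumes "loc_bdd S F" "\<And>g. g \<in> G \<Longrightarrow> \<exists>f\<in>F. \<forall>x\<in>S. g x = f x"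
  shows "loc_bdd S G"
proof (rule loc_bddI)
  fix x assume "x \<in> S"
  with assms(1) obtain d M where "d > 0" "M \<ge> 0"
    "\<forall>y\<in>S. dist x y < d \<longrightarrow> (\<forall>f\<in>F. norm (f y) \<le> M)" by (rule loc_bddE)
  then show "\<exists>d>0. \<exists>M. \<forall>y\<in>S. dist x y < d \<longrightarrow> (\<forall>f\<in>G. norm (f y) \<le> M)"
    using assms(2) by (intro exI[of _ d] conjI exI[of _ M]) fastforce+
qed

lemma loc_bdd_comb:
  assumes F: "loc_bdd S F" and G: "loc_bdd S G"
    and B: "\<And>a b M N. norm a \<le> M \<Longrightarrow> norm b \<le> N \<Longrightarrow> norm (op a b) \<le> K M N"
  shows "loc_bdd S {\<lambda>x. op (f x) (g x) | f g. f \<in> F \<and> g \<in> G}"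
proof (rule loc_bddI)
  fix x assume x: "x \<in> S"
  from F x obtain d M where 1: "d > 0" "M \<ge> 0"
    "\<forall>y\<in>S. dist x y < d \<longrightarrow> (\<forall>f\<in>F. norm (f y) \<le> M)" by (rule loc_bddE)
  from G x obtain d' M' where 2: "d' > 0" "M' \<ge> 0"
    "\<forall>y\<in>S. dist x y < d' \<longrightarrow> (\<forall>f\<in>G. norm (f y) \<le> M')" by (rule loc_bddE)
  show "\<exists>d>0. \<exists>N. \<forall>y\<in>S. dist x y < d \<longrightarrow> (\<forall>f\<in>{\<lambda>x. op (f x) (g x) | f g. f \<in> F \<and> g \<in> G}. norm (f y) \<le> N)"
    using 1 2 by (intro exI[of _ "min d d'"] conjI exI[of _ "K M M'"]) (auto intro!: B)
qed

text \<open>Iterated derivatives live in an infinite tower of function types, over which one cannot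
  induct. A set \<open>F\<close> of functions is used instead: the derivatives of its members in
  all directions of norm at most \<open>\<rho>\<close> form a set of functions of the same type.\<close>

primrec lip_class ::
    "('k \<Rightarrow> 'a::real_normed_vector \<Rightarrow> 'a) \<Rightarrow> ('k \<Rightarrow> 'b::real_normed_vector \<Rightarrow> 'b) \<Rightarrow>
     nat \<Rightarrow> 'a set \<Rightarrow> ('a \<Rightarrow> 'b) set \<Rightarrow> bool" where
  "lip_class s s' 0 S F \<longleftrightarrow> loc_bdd S F"
| "lip_class s s' (Suc n) S F \<longleftrightarrow> loc_bdd S F \<and>
     (\<forall>f\<in>F. \<forall>x\<in>S. f differentiable (at x) \<and>
        (\<forall>c v. frechet_derivative f (at x) (s c v) = s' c (frechet_derivative f (at x) v))) \<and>
     (\<forall>\<rho>. lip_class s s' n S {\<lambda>x. frechet_derivative f (at x) v | f v. f \<in> F \<and> norm v \<le> \<rho>})"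

lemma lip_class_loc_bdd: "lip_class s s' n S F \<Longrightarrow> loc_bdd S F"
  by (cases n) auto

text \<open>Members of \<open>G\<close> need only agree with members of \<open>F\<close> on
  \<open>S\<close>. As \<open>S\<close> is open, this also identifies their derivatives there,
  whereas \<open>frechet_derivative\<close> at points outside \<open>S\<close> may be anything. The
  sets produced by the rules of calculus rarely match literally, so this rule is the usual way to
  pass from one to another.\<close>

lemma lip_class_mono:
  assumes "open S" "lip_class s s' n S F" "\<And>g. g \<in> G \<Longrightarrow> \<exists>f\<in>F. \<forall>x\<in>S. g x = f x"
  shows "lip_class s s' n S G"
  using assms(2,3)
proof (induction n arbitrary: F G)
  case 0
  show ?case using loc_bdd_mono[OF _ 0(2)] 0(1) by simp
next
  case (Suc n)
  have fd: "g differentiable (at x) \<and> frechet_derivative g (at x) = frechet_derivative f (at x)"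
    if "f \<in> F" "\<forall>x\<in>S. g x = f x" "x \<in> S" for f g x
  proof
    have f: "f differentiable at x" using Suc.prems(1) that by simp
    then show "g differentiable (at x)"
      using that assms(1) unfolding differentiable_def
      by (metis has_derivative_transform_within_open)
    show "frechet_derivative g (at x) = frechet_derivative f (at x)"
      by (rule frechet_derivative_transform_within_open[OF f assms(1) that(3), symmetric]) (simp add: that(2))
  qed
  have "loc_bdd S G" by (rule loc_bdd_mono[OF lip_class_loc_bdd[OF Suc.prems(1)] Suc.prems(2)])
  moreover have "g differentiable (at x) \<and>
        (\<forall>c v. frechet_derivative g (at x) (s c v) = s' c (frechet_derivative g (at x) v))"
    if gx: "g \<in> G" "x \<in> S" for g x
  proof -
    obtain f where f: "f \<in> F" "\<forall>x\<in>S. g x = f x" using Suc.prems(2)[OF gx(1)] by blast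
    show ?thesis using fd[OF f gx(2)] Suc.prems(1) f(1) gx(2) by simp
  qed
  moreover have "lip_class s s' n S {\<lambda>x. frechet_derivative f (at x) v | f v. f \<in> G \<and> norm v \<le> \<rho>}" for \<rho>
  proof (rule Suc.IH)
    show "lip_class s s' n S {\<lambda>x. frechet_derivative f (at x) v | f v. f \<in> F \<and> norm v \<le> \<rho>}"
      using Suc.prems(1) by simp
    fix h assume "h \<in> {\<lambda>x. frechet_derivative f (at x) v | f v. f \<in> G \<and> norm v \<le> \<rho>}"
    then obtain g v where g: "g \<in> G" "norm v \<le> \<rho>" "h = (\<lambda>x. frechet_derivative g (at x) v)" by blast
    obtain f where f: "f \<in> F" "\<forall>x\<in>S. g x = f x" using Suc.prems(2)[OF g(1)] by blast
    have "(\<lambda>x. frechet_derivative f (at x) v) \<in> {\<lambda>x. frechet_derivative f (at x) v | f v. f \<in> F \<and> norm v \<le> \<rho>}"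
      using f g by blast
    moreover have "\<forall>x\<in>S. h x = frechet_derivative f (at x) v" using fd[OF f] g by simp
    ultimately show "\<exists>f\<in>{\<lambda>x. frechet_derivative f (at x) v | f v. f \<in> F \<and> norm v \<le> \<rho>}. \<forall>x\<in>S. h x = f x"
      by (intro bexI)
  qed
  ultimately show ?case by simp
qed

text \<open>Introduction with an explicit derivative \<open>d\<close> in place of
  \<open>frechet_derivative\<close>, and with any class \<open>H \<rho>\<close> that contains the
  derivatives in directions of norm at most \<rho>. In applications \<open>H\<close> is built from
  smaller classes by the operation under study, so that an induction on the order closes.\<close>

lemma lip_class_SucI:
  assumes "open S" "loc_bdd S F" "\<And>\<rho>. lip_class s s' n S (H \<rho>)"
    and d: "\<And>f. f \<in> F \<Longrightarrow> \<exists>d. (\<forall>x\<in>S. (f has_derivative d x) (at x) \<and> (\<forall>c v. d x (s c v) = s' c (d x v))) \<and>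
      (\<forall>\<rho> v. norm v \<le> \<rho> \<longrightarrow> (\<lambda>x. d x v) \<in> H \<rho>)"
  shows "lip_class s s' (Suc n) S F"
  unfolding lip_class.simps
proof (intro conjI ballI allI)
  show "loc_bdd S F" by fact
  fix f x assume fx: "f \<in> F" "x \<in> S"
  obtain d where d: "\<And>x. x \<in> S \<Longrightarrow> (f has_derivative d x) (at x)"
      "\<And>x c v. x \<in> S \<Longrightarrow> d x (s c v) = s' c (d x v)"
    using d[OF fx(1)] by blast
  have "frechet_derivative f (at x) = d x" by (rule frechet_derivative_at[OF d(1)[OF fx(2)], symmetric])
  then show "f differentiable (at x)"
    "\<And>c v. frechet_derivative f (at x) (s c v) = s' c (frechet_derivative f (at x) v)"
    using d fx by (auto simp: differentiable_def)
next
  fix \<rho>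
  show "lip_class s s' n S {\<lambda>x. frechet_derivative f (at x) v | f v. f \<in> F \<and> norm v \<le> \<rho>}"
  proof (rule lip_class_mono[OF assms(1) assms(3)[of \<rho>]])
    fix h assume "h \<in> {\<lambda>x. frechet_derivative f (at x) v | f v. f \<in> F \<and> norm v \<le> \<rho>}"
    then obtain f v where f: "f \<in> F" "norm v \<le> \<rho>" "h = (\<lambda>x. frechet_derivative f (at x) v)" by blast
    obtain d where d: "\<And>x. x \<in> S \<Longrightarrow> (f has_derivative d x) (at x)" "(\<lambda>x. d x v) \<in> H \<rho>"
      using d[OF f(1)] f(2) by blast
    then have "\<forall>x\<in>S. h x = d x v" using f(3) frechet_derivative_at by metis
    then show "\<exists>g\<in>H \<rho>. \<forall>x\<in>S. h x = g x" using d(2) by (rule rev_bexI[rotated])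
  qed
qed

abbreviation dirs :: "('a::real_normed_vector \<Rightarrow> 'b::real_normed_vector) set \<Rightarrow> real \<Rightarrow> ('a \<Rightarrow> 'b) set" where
  "dirs F \<rho> \<equiv> {\<lambda>x. frechet_derivative f (at x) v | f v. f \<in> F \<and> norm v \<le> \<rho>}"

lemma lip_class_SucD:
  assumes "lip_class s s' (Suc n) S F"
  shows "f \<in> F \<Longrightarrow> x \<in> S \<Longrightarrow> (f has_derivative frechet_derivative f (at x)) (at x)"
    and "f \<in> F \<Longrightarrow> x \<in> S \<Longrightarrow> frechet_derivative f (at x) (s c v) = s' c (frechet_derivative f (at x) v)"
    and "lip_class s s' n S (dirs F \<rho>)"
  using assms by (simp_all add: frechet_derivative_works[symmetric])

lemma dirsI: "f \<in> F \<Longrightarrow> norm v \<le> \<rho> \<Longrightarrow> (\<lambda>x. frechet_derivative f (at x) v) \<in> dirs F \<rho>"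
  by blast

lemma plus_memI: "p \<in> P \<Longrightarrow> q \<in> Q \<Longrightarrow> (\<lambda>x. p x + q x) \<in> {\<lambda>x. f x + g x | f g. f \<in> P \<and> g \<in> Q}"
  by blast

lemma lip_class_lower: "open S \<Longrightarrow> lip_class s s' (Suc n) S F \<Longrightarrow> lip_class s s' n S F"
proof (induction n arbitrary: F)
  case (Suc n)
  show ?case unfolding lip_class.simps(2)[of s s' n]
  proof (intro conjI allI)
    show "loc_bdd S F" using Suc.prems by simp
    show "lip_class s s' n S (dirs F \<rho>)" for \<rho>
      by (rule Suc.IH[OF Suc.prems(1) lip_class_SucD(3)[OF Suc.prems(2)]])
  qed (use Suc.prems(2) in simp)
qed simp

lemma lip_class_le: "open S \<Longrightarrow> lip_class s s' n S F \<Longrightarrow> m \<le> n \<Longrightarrow> lip_class s s' m S F"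
proof (induction n)
  case (Suc n)
  show ?case
  proof (cases "m = Suc n")
    case False
    then show ?thesis using Suc.prems(3) by (intro Suc.IH[OF Suc.prems(1) lip_class_lower[OF Suc.prems(1) Suc.prems(2)]]) simp
  qed (use Suc.prems in simp)
qed simp

lemma loc_bdd_subset: "loc_bdd S F \<Longrightarrow> S' \<subseteq> S \<Longrightarrow> loc_bdd S' F"
proof (rule loc_bddI)
  fix x assume F: "loc_bdd S F" and S: "S' \<subseteq> S" and x: "x \<in> S'"
  from F obtain d M where "d > 0" "M \<ge> 0" "\<forall>y\<in>S. dist x y < d \<longrightarrow> (\<forall>f\<in>F. norm (f y) \<le> M)"
    by (rule loc_bddE) (use S x in blast)
  then show "\<exists>d>0. \<exists>M. \<forall>y\<in>S'. dist x y < d \<longrightarrow> (\<forall>f\<in>F. norm (f y) \<le> M)"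
    using S by (intro exI[of _ d] conjI exI[of _ M]) auto
qed

lemma lip_class_subset: "lip_class s s' n S F \<Longrightarrow> S' \<subseteq> S \<Longrightarrow> lip_class s s' n S' F"
proof (induction n arbitrary: F)
  case (Suc n)
  show ?case unfolding lip_class.simps
  proof (intro conjI allI)
    show "loc_bdd S' F" by (rule loc_bdd_subset[OF lip_class_loc_bdd[OF Suc.prems(1)] Suc.prems(2)])
    show "lip_class s s' n S' (dirs F \<rho>)" for \<rho>
      by (rule Suc.IH[OF lip_class_SucD(3)[OF Suc.prems(1)] Suc.prems(2)])
  qed (use Suc.prems in \<open>simp add: subset_eq\<close>)
qed (simp add: loc_bdd_subset)

lemma lip_class_Un:
  fixes s :: "'k::real_normed_field \<Rightarrow> 'a::real_normed_vector \<Rightarrow> 'a" and s' :: "'k \<Rightarrow> 'b::real_normed_vector \<Rightarrow> 'b"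
  assumes "lip_class s s' n S F" "lip_class s s' n S G"
  shows "lip_class s s' n S (F \<union> G)"
proof -
  have bdd: "loc_bdd S (F \<union> G)" if "loc_bdd S F" "loc_bdd S G" for F G :: "('a \<Rightarrow> 'b) set"
  proof (rule loc_bddI)
    fix x assume x: "x \<in> S"
    from that(1) x obtain d M where 1: "d > 0" "M \<ge> 0"
      "\<forall>y\<in>S. dist x y < d \<longrightarrow> (\<forall>f\<in>F. norm (f y) \<le> M)" by (rule loc_bddE)
    from that(2) x obtain d' M' where 2: "d' > 0" "M' \<ge> 0"
      "\<forall>y\<in>S. dist x y < d' \<longrightarrow> (\<forall>f\<in>G. norm (f y) \<le> M')" by (rule loc_bddE)
    show "\<exists>d>0. \<exists>N. \<forall>y\<in>S. dist x y < d \<longrightarrow> (\<forall>f\<in>F \<union> G. norm (f y) \<le> N)"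
      using 1 2 by (intro exI[of _ "min d d'"] conjI exI[of _ "max M M'"]) (auto simp: le_max_iff_disj)
  qed
  show ?thesis using assms
  proof (induction n arbitrary: F G)
    case (Suc n)
    have eq: "dirs (F \<union> G) \<rho> = dirs F \<rho> \<union> dirs G \<rho>" for \<rho> by blast
    show ?case unfolding lip_class.simps eq
    proof (intro conjI allI)
      show "loc_bdd S (F \<union> G)" using Suc.prems by (simp add: bdd)
      show "lip_class s s' n S (dirs F \<rho> \<union> dirs G \<rho>)" for \<rho>
        by (rule Suc.IH) (rule lip_class_SucD(3)[OF Suc.prems(1)] lip_class_SucD(3)[OF Suc.prems(2)])+
    qed (use Suc.prems in \<open>simp add: ball_Un\<close>)
  qed (simp add: bdd)
qed

lemma lip_class_add:
  fixes s :: "'k::real_normed_field \<Rightarrow> 'a::real_normed_vector \<Rightarrow> 'a" and s' :: "'k \<Rightarrow> 'b::real_normed_vector \<Rightarrow> 'b"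
  assumes S: "open S" and s': "normed_scale s'" and "lip_class s s' n S F" "lip_class s s' n S G"
  shows "lip_class s s' n S {\<lambda>x. f x + g x | f g. f \<in> F \<and> g \<in> G}"
proof -
  interpret normed_scale s' by fact
  have bdd: "loc_bdd S {\<lambda>x. f x + g x | f g. f \<in> F \<and> g \<in> G}" if "loc_bdd S F" "loc_bdd S G" for F G :: "('a \<Rightarrow> 'b) set"
    by (rule loc_bdd_comb[OF that]) (rule norm_triangle_mono)
  show ?thesis using assms(3,4)
  proof (induction n arbitrary: F G)
    case (Suc n)
    show ?case
    proof (rule lip_class_SucI[OF S, where H="\<lambda>\<rho>. {\<lambda>x. f x + g x | f g. f \<in> dirs F \<rho> \<and> g \<in> dirs G \<rho>}"])
      show "loc_bdd S {\<lambda>x. f x + g x | f g. f \<in> F \<and> g \<in> G}"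
        using Suc.prems by (simp add: bdd)
      show "lip_class s s' n S {\<lambda>x. f x + g x | f g. f \<in> dirs F \<rho> \<and> g \<in> dirs G \<rho>}" for \<rho>
        by (rule Suc.IH) (rule lip_class_SucD(3)[OF Suc.prems(1)] lip_class_SucD(3)[OF Suc.prems(2)])+
      fix h assume "h \<in> {\<lambda>x. f x + g x | f g. f \<in> F \<and> g \<in> G}"
      then obtain f g where h: "h = (\<lambda>x. f x + g x)" and fg: "f \<in> F" "g \<in> G" by blast
      show "\<exists>d. (\<forall>x\<in>S. (h has_derivative d x) (at x) \<and> (\<forall>c v. d x (s c v) = s' c (d x v))) \<and>
          (\<forall>\<rho> v. norm v \<le> \<rho> \<longrightarrow> (\<lambda>x. d x v) \<in> {\<lambda>x. f x + g x | f g. f \<in> dirs F \<rho> \<and> g \<in> dirs G \<rho>})"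
      proof (intro exI[of _ "\<lambda>x v. frechet_derivative f (at x) v + frechet_derivative g (at x) v"] conjI ballI allI impI)
        fix x c v assume x: "x \<in> S"
        note fd = lip_class_SucD(1)[OF Suc.prems(1) fg(1) x] lip_class_SucD(2)[OF Suc.prems(1) fg(1) x] lip_class_SucD(1)[OF Suc.prems(2) fg(2) x] lip_class_SucD(2)[OF Suc.prems(2) fg(2) x]
        show "(h has_derivative (\<lambda>v. frechet_derivative f (at x) v + frechet_derivative g (at x) v)) (at x)"
          unfolding h by (intro has_derivative_add fd)
        show "frechet_derivative f (at x) (s c v) + frechet_derivative g (at x) (s c v) =
            s' c (frechet_derivative f (at x) v + frechet_derivative g (at x) v)"
          by (simp add: fd scale_right_distrib)
      next
        fix \<rho> and v :: 'a assume "norm v \<le> \<rho>"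
        then show "(\<lambda>x. frechet_derivative f (at x) v + frechet_derivative g (at x) v)
            \<in> {\<lambda>x. f x + g x | f g. f \<in> dirs F \<rho> \<and> g \<in> dirs G \<rho>}"
          using fg by (intro CollectI exI[of _ "\<lambda>x. frechet_derivative f (at x) v"] exI[of _ "\<lambda>x. frechet_derivative g (at x) v"] conjI refl dirsI)
      qed
    qed
  qed (simp add: bdd)
qed

lemma lip_class_sum:
  fixes s :: "'k::real_normed_field \<Rightarrow> 'a::real_normed_vector \<Rightarrow> 'a" and s' :: "'k \<Rightarrow> 'b::real_normed_vector \<Rightarrow> 'b" and m :: nat
  assumes S: "open S" and s': "normed_scale s'" and F: "lip_class s s' n S F"
  shows "lip_class s s' n S {\<lambda>x. (\<Sum>l<m. f l x) | f. \<forall>l<m. f l \<in> F}"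
proof (induction m)
  case 0
  interpret normed_scale s' by fact
  show ?case
  proof (induction n)
    case 0
    then show ?case by (auto intro!: loc_bddI exI[of _ 1])
  next
    case (Suc n)
    show ?case
    proof (rule lip_class_SucI[OF S _ Suc.IH])
      show "loc_bdd S {\<lambda>x::'a. (\<Sum>l<0::nat. f l x :: 'b) | f. \<forall>l<0. f l \<in> F}"
        by (auto intro!: loc_bddI exI[of _ 1])
    qed (auto intro!: exI[of _ "\<lambda>_ _. 0"])
  qed
next
  case (Suc m)
  show ?case
  proof (rule lip_class_mono[OF S lip_class_add[OF S s' Suc.IH F]])
    fix h assume "h \<in> {\<lambda>x. \<Sum>l<Suc m. f l x | f. \<forall>l<Suc m. f l \<in> F}"
    then obtain f where f: "h = (\<lambda>x. \<Sum>l<Suc m. f l x)" "\<forall>l<Suc m. f l \<in> F" by blast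
    have "(\<lambda>x. (\<Sum>l<m. f l x) + f m x) \<in>
        {\<lambda>x. p x + g x | p g. p \<in> {\<lambda>x. \<Sum>l<m. f l x |f. \<forall>l<m. f l \<in> F} \<and> g \<in> F}"
      using f(2) by (intro CollectI exI[of _ "\<lambda>x. \<Sum>l<m. f l x"] exI[of _ "f m"]) auto
    then show "\<exists>k\<in>{\<lambda>x. p x + g x | p g. p \<in> {\<lambda>x. \<Sum>l<m. f l x |f. \<forall>l<m. f l \<in> F} \<and> g \<in> F}. \<forall>x\<in>S. h x = k x"
      by (rule rev_bexI) (simp add: f)
  qed
qed

lemma lip_class_const:
  fixes s :: "'k::real_normed_field \<Rightarrow> 'a::real_normed_vector \<Rightarrow> 'a" and s' :: "'k \<Rightarrow> 'b::real_normed_vector \<Rightarrow> 'b"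
  assumes S: "open S" and s': "normed_scale s'"
  shows "lip_class s s' n S {\<lambda>_. v | v. norm v \<le> \<rho>}"
proof (induction n arbitrary: \<rho>)
  case (Suc n)
  interpret normed_scale s' by fact
  show ?case
  \<comment> \<open>The derivative is zero; the bound 0 in \<open>H\<close> leaves the zero function
    as its only member, whatever \<open>r\<close> is.\<close>
  proof (rule lip_class_SucI[OF S, where H="\<lambda>r. {\<lambda>_. v | v. norm v \<le> 0}"])
    show "lip_class s s' n S {\<lambda>_. v | v. norm v \<le> 0}" by (rule Suc.IH)
  qed (auto intro!: exI[of _ "\<lambda>_ _. 0"] loc_bddI intro: exI[of _ 1] exI[of _ \<rho>])
qed (auto intro!: loc_bddI intro: exI[of _ 1] exI[of _ \<rho>])

lemma loc_bdd_singleton: "continuous_on S f \<Longrightarrow> loc_bdd S {f}"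
proof (rule loc_bddI)
  fix x assume f: "continuous_on S f" and x: "x \<in> S"
  then obtain d where d: "d > 0" "\<And>y. y \<in> S \<Longrightarrow> dist y x < d \<Longrightarrow> dist (f y) (f x) < 1"
    unfolding continuous_on_iff by (metis zero_less_one)
  have "norm (f y) \<le> norm (f x) + 1" if "y \<in> S" "dist x y < d" for y
    using d(2)[of y] that norm_triangle_sub[of "f y" "f x"] by (simp add: dist_norm dist_commute)
  then show "\<exists>d>0. \<exists>M. \<forall>y\<in>S. dist x y < d \<longrightarrow> (\<forall>g\<in>{f}. norm (g y) \<le> M)"
    using d(1) by (intro exI[of _ d] conjI exI[of _ "norm (f x) + 1"]) auto
qed

lemma lip_class_linear:
  fixes s :: "'k::real_normed_field \<Rightarrow> 'a::real_normed_vector \<Rightarrow> 'a" and s' :: "'k \<Rightarrow> 'b::real_normed_vector \<Rightarrow> 'b"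
  assumes S: "open S" and s': "normed_scale s'" and A: "bounded_linear A" "\<And>c v. A (s c v) = s' c (A v)"
  shows "lip_class s s' n S {A}"
proof -
  interpret A: bounded_linear A by fact
  have b: "loc_bdd S {A}"
    by (rule loc_bdd_singleton) (rule A.continuous_on[OF continuous_on_id])
  obtain K where K: "K > 0" "\<And>x. norm (A x) \<le> norm x * K" using A.pos_bounded by blast
  show ?thesis
  proof (cases n)
    case (Suc m)
    show ?thesis unfolding Suc
    proof (rule lip_class_SucI[OF S b lip_class_const[OF S s', where \<rho>="\<rho> * K" for \<rho>]])
      fix f assume f: "f \<in> {A}"
      have "norm (A v) \<le> \<rho> * K" if "norm v \<le> \<rho>" for v \<rho>
        using K(2)[of v] mult_right_mono[OF that, of K] K(1) by linarith
      then show "\<exists>d. (\<forall>x\<in>S. (f has_derivative d x) (at x) \<and> (\<forall>c v. d x (s c v) = s' c (d x v))) \<and>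
          (\<forall>\<rho> v. norm v \<le> \<rho> \<longrightarrow> (\<lambda>x. d x v) \<in> {\<lambda>_. v |v. norm v \<le> \<rho> * K})"
        using f A.has_derivative[OF has_derivative_ident] A(2) by (intro exI[of _ "\<lambda>_. A"]) auto
    qed
  qed (use b in simp)
qed

lemma lip_class_linear_comp:
  fixes s :: "'k::real_normed_field \<Rightarrow> 'a::real_normed_vector \<Rightarrow> 'a" and s' :: "'k \<Rightarrow> 'b::real_normed_vector \<Rightarrow> 'b"
  assumes S: "open S" and A: "bounded_linear A" "\<And>c v. A (s1 c v) = s' c (A v)"
    and F: "lip_class s s1 n S F"
  shows "lip_class s s' n S {\<lambda>x. A (f x) | f. f \<in> F}"
proof -
  interpret A: bounded_linear A by fact
  obtain K where K: "K > 0" "\<And>x. norm (A x) \<le> norm x * K" using A.pos_bounded by blast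
  have bdd: "loc_bdd S {\<lambda>x. A (f x) | f. f \<in> F}" if "loc_bdd S F" for F
  proof (rule loc_bddI)
    fix x assume "x \<in> S"
    with that obtain d M where 1: "d > 0" "M \<ge> 0"
      "\<forall>y\<in>S. dist x y < d \<longrightarrow> (\<forall>f\<in>F. norm (f y) \<le> M)" by (rule loc_bddE)
    have "norm (A (f y)) \<le> M * K" if "y \<in> S" "dist x y < d" "f \<in> F" for y f
    proof -
      have "norm (f y) \<le> M" using 1(3) that by simp
      then show ?thesis using K(2)[of "f y"] mult_right_mono[of "norm (f y)" M K] K(1) by linarith
    qed
    then show "\<exists>d>0. \<exists>N. \<forall>y\<in>S. dist x y < d \<longrightarrow> (\<forall>g\<in>{\<lambda>x. A (f x) | f. f \<in> F}. norm (g y) \<le> N)"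
      using 1(1) by (intro exI[of _ d] conjI exI[of _ "M * K"]) auto
  qed
  show ?thesis using F
  proof (induction n arbitrary: F)
    case (Suc n)
    show ?case
    proof (rule lip_class_SucI[OF S bdd Suc.IH[OF lip_class_SucD(3)[OF Suc.prems]]])
      show "loc_bdd S F" using Suc.prems by simp
      fix h assume "h \<in> {\<lambda>x. A (f x) |f. f \<in> F}"
      then obtain f where f: "h = (\<lambda>x. A (f x))" "f \<in> F" by blast
      show "\<exists>d. (\<forall>x\<in>S. (h has_derivative d x) (at x) \<and> (\<forall>c v. d x (s c v) = s' c (d x v))) \<and>
            (\<forall>\<rho> v. norm v \<le> \<rho> \<longrightarrow> (\<lambda>x. d x v) \<in> {\<lambda>x. A (f x) | f. f \<in> dirs F \<rho>})"
      proof (intro exI[of _ "\<lambda>x v. A (frechet_derivative f (at x) v)"] conjI ballI allI impI)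
        fix x c v assume x: "x \<in> S"
        note fd = lip_class_SucD(1)[OF Suc.prems f(2) x] lip_class_SucD(2)[OF Suc.prems f(2) x]
        show "(h has_derivative (\<lambda>v. A (frechet_derivative f (at x) v))) (at x)"
          unfolding f by (intro A.has_derivative fd)
        show "A (frechet_derivative f (at x) (s c v)) = s' c (A (frechet_derivative f (at x) v))"
          by (simp add: fd A)
      next
        fix \<rho> and v :: 'a assume "norm v \<le> \<rho>"
        then show "(\<lambda>x. A (frechet_derivative f (at x) v)) \<in> {\<lambda>x. A (f x) | f. f \<in> dirs F \<rho>}"
          using f by (intro CollectI exI[of _ "\<lambda>x. frechet_derivative f (at x) v"] conjI refl dirsI)
      qed
    qed
  qed (simp add: bdd)
qed

text \<open>By the product rule a derivative is a sum of two products, in each of which one factor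
  is differentiated and the other is regarded as being of order one lower. Hence
  \<open>lip_class_lower\<close> appears beside \<open>lip_class_SucD\<close>.\<close>

lemma lip_class_scale:
  fixes s :: "'k::real_normed_field \<Rightarrow> 'a::real_normed_vector \<Rightarrow> 'a" and s' :: "'k \<Rightarrow> 'b::real_normed_vector \<Rightarrow> 'b"
  assumes S: "open S" and s': "normed_scale s'"
    and F: "lip_class s (*) n S F" and G: "lip_class s s' n S G"
  shows "lip_class s s' n S {\<lambda>x. s' (f x) (g x) | f g. f \<in> F \<and> g \<in> G}"
proof -
  interpret normed_scale s' by fact
  have bdd: "loc_bdd S {\<lambda>x. s' (f x) (g x) | f g. f \<in> F \<and> g \<in> G}" if "loc_bdd S F" "loc_bdd S G" for F G
    by (rule loc_bdd_comb[OF that, where K="(*)"])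
       (metis norm_scale mult_mono norm_ge_zero order_trans)
  show ?thesis using F G
  proof (induction n arbitrary: F G)
    case (Suc n)
    let ?E = "\<lambda>F G. {\<lambda>x. s' (f x) (g x) | f g. f \<in> F \<and> g \<in> G}"
    show ?case
    proof (rule lip_class_SucI[OF S, where H="\<lambda>\<rho>. {\<lambda>x. f x + g x | f g. f \<in> ?E F (dirs G \<rho>) \<and> g \<in> ?E (dirs F \<rho>) G}"])
      show "loc_bdd S (?E F G)" using Suc.prems by (simp add: bdd)
      show "lip_class s s' n S {\<lambda>x. f x + g x | f g. f \<in> ?E F (dirs G \<rho>) \<and> g \<in> ?E (dirs F \<rho>) G}" for \<rho>
        by (intro lip_class_add[OF S s'] Suc.IH lip_class_SucD(3)[OF Suc.prems(1)] lip_class_SucD(3)[OF Suc.prems(2)]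
           lip_class_lower[OF S Suc.prems(1)] lip_class_lower[OF S Suc.prems(2)])
      fix h assume "h \<in> ?E F G"
      then obtain f g where h: "h = (\<lambda>x. s' (f x) (g x))" and fg: "f \<in> F" "g \<in> G" by blast
      show "\<exists>d. (\<forall>x\<in>S. (h has_derivative d x) (at x) \<and> (\<forall>c v. d x (s c v) = s' c (d x v))) \<and>
          (\<forall>\<rho> v. norm v \<le> \<rho> \<longrightarrow> (\<lambda>x. d x v) \<in> {\<lambda>x. f x + g x | f g. f \<in> ?E F (dirs G \<rho>) \<and> g \<in> ?E (dirs F \<rho>) G})"
      proof (intro exI[of _ "\<lambda>x v. s' (f x) (frechet_derivative g (at x) v) + s' (frechet_derivative f (at x) v) (g x)"] conjI ballI allI impI)
        fix x c v assume x: "x \<in> S"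
        note fd = lip_class_SucD(1)[OF Suc.prems(1) fg(1) x] lip_class_SucD(2)[OF Suc.prems(1) fg(1) x] lip_class_SucD(1)[OF Suc.prems(2) fg(2) x] lip_class_SucD(2)[OF Suc.prems(2) fg(2) x]
        show "(h has_derivative (\<lambda>v. s' (f x) (frechet_derivative g (at x) v) + s' (frechet_derivative f (at x) v) (g x))) (at x)"
          unfolding h by (rule bounded_bilinear.FDERIV[OF bounded_bilinear_scale]) (rule fd)+
        show "s' (f x) (frechet_derivative g (at x) (s c v)) + s' (frechet_derivative f (at x) (s c v)) (g x) =
            s' c (s' (f x) (frechet_derivative g (at x) v) + s' (frechet_derivative f (at x) v) (g x))"
          by (simp add: fd scale_right_distrib mult.commute)
      next
        fix \<rho> and v :: 'a assume v: "norm v \<le> \<rho>"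
        have "(\<lambda>x. s' (f x) (frechet_derivative g (at x) v)) \<in> ?E F (dirs G \<rho>)"
          using fg v by (intro CollectI exI[of _ f] exI[of _ "\<lambda>x. frechet_derivative g (at x) v"] conjI refl dirsI)
        moreover have "(\<lambda>x. s' (frechet_derivative f (at x) v) (g x)) \<in> ?E (dirs F \<rho>) G"
          using fg v by (intro CollectI exI[of _ "\<lambda>x. frechet_derivative f (at x) v"] exI[of _ g] conjI refl dirsI)
        ultimately show "(\<lambda>x. s' (f x) (frechet_derivative g (at x) v) + s' (frechet_derivative f (at x) v) (g x))
            \<in> {\<lambda>x. f x + g x | f g. f \<in> ?E F (dirs G \<rho>) \<and> g \<in> ?E (dirs F \<rho>) G}"
          by (rule plus_memI)
      qed
    qed
  qed (simp add: bdd)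
qed

section \<open>Iterated directional derivatives and the return from \<open>lip_class\<close> to jets
  and to \<open>C_on\<close>\<close>

primrec iter_deriv :: "('a::real_normed_vector \<Rightarrow> 'b::real_normed_vector) \<Rightarrow> 'a list \<Rightarrow> 'a \<Rightarrow> 'b" where
  "iter_deriv f [] = f"
| "iter_deriv f (v # vs) = (\<lambda>x. frechet_derivative (iter_deriv f vs) (at x) v)"

lemma lip_class_iter_deriv:
  assumes S: "open S" and f: "lip_class s s' n S {f}" and "j \<le> n"
  shows "lip_class s s' (n - j) S {iter_deriv f vs | vs. length vs = j \<and> (\<forall>v\<in>set vs. norm v \<le> \<rho>)}"
  using assms(3)
proof (induction j)
  case 0
  have "{iter_deriv f vs | vs. length vs = 0 \<and> (\<forall>v\<in>set vs. norm v \<le> \<rho>)} = {f}" by auto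
  then show ?case using f by (simp only: minus_nat.diff_0)
next
  case (Suc j)
  let ?F = "\<lambda>j. {iter_deriv f vs | vs. length vs = j \<and> (\<forall>v\<in>set vs. norm v \<le> \<rho>)}"
  have "lip_class s s' (Suc (n - Suc j)) S (?F j)"
    using Suc by (simp only: Suc_diff_Suc Suc_le_eq less_imp_le)
  from lip_class_SucD(3)[OF this, of \<rho>] have "lip_class s s' (n - Suc j) S (dirs (?F j) \<rho>)" .
  then show ?case
  proof (rule lip_class_mono[OF S])
    fix g assume "g \<in> ?F (Suc j)"
    then obtain vs where vs: "g = iter_deriv f vs" "length vs = Suc j" "\<forall>v\<in>set vs. norm v \<le> \<rho>" by blast
    then obtain w ws where w: "vs = w # ws" by (cases vs) auto
    have "(\<lambda>x. frechet_derivative (iter_deriv f ws) (at x) w) \<in> dirs (?F j) \<rho>"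
      using vs w by (intro dirsI) auto
    then show "\<exists>h\<in>dirs (?F j) \<rho>. \<forall>x\<in>S. g x = h x"
      by (rule rev_bexI) (simp add: vs(1) w)
  qed
qed

lemma iter_deriv_differentiable:
  assumes S: "open S" and f: "lip_class s s' n S {f}" and "length vs < n" "x \<in> S"
  shows "(iter_deriv f vs has_derivative frechet_derivative (iter_deriv f vs) (at x)) (at x)"
    and "frechet_derivative (iter_deriv f vs) (at x) (s c v) = s' c (frechet_derivative (iter_deriv f vs) (at x) v)"
proof -
  \<comment> \<open>Any bound for the given directions would do: it places this single iterate in
    the class of \<open>lip_class_iter_deriv\<close>.\<close>
  define \<rho> where "\<rho> = Max (insert 0 (norm ` set vs))"
  let ?F = "{iter_deriv f us | us. length us = length vs \<and> (\<forall>v\<in>set us. norm v \<le> \<rho>)}"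
  have "\<forall>v\<in>set vs. norm v \<le> \<rho>" by (simp add: \<rho>_def)
  then have m: "iter_deriv f vs \<in> ?F" by blast
  have "lip_class s s' (n - length vs) S ?F"
    by (rule lip_class_iter_deriv[OF S f less_imp_le[OF assms(3)]])
  then have "lip_class s s' (Suc (n - Suc (length vs))) S ?F"
    using assms(3) by (simp only: Suc_diff_Suc)
  from lip_class_SucD(1)[OF this m assms(4)] lip_class_SucD(2)[OF this m assms(4)]
  show "(iter_deriv f vs has_derivative frechet_derivative (iter_deriv f vs) (at x)) (at x)"
    "frechet_derivative (iter_deriv f vs) (at x) (s c v) = s' c (frechet_derivative (iter_deriv f vs) (at x) v)"
    by this
qed

text \<open>In the head position this is linearity of a Frechet derivative. A further direction in
  front is handled by differentiating an identity of functions that holds on all of the open set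
  \<open>S\<close>, and by uniqueness of the derivative.\<close>

lemma iter_deriv_multilin:
  assumes S: "open S" and f: "lip_class s s' n S {f}" and s': "normed_scale s'"
  shows "length us + 1 + length vs \<le> n \<Longrightarrow> x \<in> S \<Longrightarrow>
      iter_deriv f (us @ (a + b) # vs) x = iter_deriv f (us @ a # vs) x + iter_deriv f (us @ b # vs) x"
    and "length us + 1 + length vs \<le> n \<Longrightarrow> x \<in> S \<Longrightarrow>
      iter_deriv f (us @ s c a # vs) x = s' c (iter_deriv f (us @ a # vs) x)"
proof (induction us arbitrary: x)
  case Nil
  { case 1
    have "bounded_linear (frechet_derivative (iter_deriv f vs) (at x))"
      using iter_deriv_differentiable(1)[OF S f _ 1(2), of vs] 1(1) has_derivative_bounded_linear by auto
    then show ?case by (simp add: bounded_linear.axioms(1) linear_add)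
  next
    case 2
    then show ?case using iter_deriv_differentiable(2)[OF S f _ 2(2), of vs] by simp
  }
next
  case (Cons u us)
  interpret normed_scale s' by fact
  have d: "(iter_deriv f (us @ w # vs) has_derivative frechet_derivative (iter_deriv f (us @ w # vs)) (at x)) (at x)"
    if "length (u # us) + 1 + length vs \<le> n" "x \<in> S" for w x
    using that by (intro iter_deriv_differentiable(1)[OF S f]) auto
  { case 1
    have A: "((\<lambda>x. iter_deriv f (us @ a # vs) x + iter_deriv f (us @ b # vs) x) has_derivative
        frechet_derivative (iter_deriv f (us @ (a + b) # vs)) (at x)) (at x)"
      by (rule has_derivative_transform_within_open[OF d[OF 1] S 1(2)]) (use Cons.IH(1) 1(1) in simp)
    have B: "((\<lambda>x. iter_deriv f (us @ a # vs) x + iter_deriv f (us @ b # vs) x) has_derivative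
        (\<lambda>h. frechet_derivative (iter_deriv f (us @ a # vs)) (at x) h + frechet_derivative (iter_deriv f (us @ b # vs)) (at x) h)) (at x)"
      by (intro has_derivative_add d[OF 1])
    show ?case using has_derivative_unique[OF A B] by simp
  next
    case 2
    have A: "((\<lambda>x. s' c (iter_deriv f (us @ a # vs) x)) has_derivative
        frechet_derivative (iter_deriv f (us @ s c a # vs)) (at x)) (at x)"
      by (rule has_derivative_transform_within_open[OF d[OF 2] S 2(2)]) (use Cons.IH(2) 2(1) in simp)
    have B: "((\<lambda>x. s' c (iter_deriv f (us @ a # vs) x)) has_derivative
        (\<lambda>h. s' c (frechet_derivative (iter_deriv f (us @ a # vs)) (at x) h))) (at x)"
      by (intro bounded_linear.has_derivative[OF bounded_linear_scale] d[OF 2])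
    show ?case using has_derivative_unique[OF A B] by simp
  }
qed

lemma lip_class_imp_lip_jet:
  assumes S: "open S" and f: "lip_class s s' n S {f}" and s: "normed_scale s" "normed_scale s'"
  shows "lip_jet s s' n S (\<lambda>j x vs. iter_deriv f vs x)"
  unfolding lip_jet_def
proof (intro conjI allI impI ballI)
  show ml: "multilin s s' j (\<lambda>vs. iter_deriv f vs x)" if "j \<le> n" "x \<in> S" for j x
    unfolding multilin_def using iter_deriv_multilin[OF S f s(2) _ that(2)] that(1) by simp
  show "\<exists>d>0. \<exists>M. \<forall>y\<in>S \<inter> ball x d. \<forall>vs. length vs = j \<longrightarrow>
      norm (iter_deriv f vs y) \<le> M * prod_list (map norm vs)" if jx: "j \<le> n" "x \<in> S" for j x
  proof -
    have "loc_bdd S {iter_deriv f vs | vs. length vs = j \<and> (\<forall>v\<in>set vs. norm v \<le> 1)}"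
      by (rule lip_class_loc_bdd[OF lip_class_iter_deriv[OF S f jx(1)]])
    then obtain d M where d: "d > 0" "M \<ge> 0" and M: "\<forall>y\<in>S. dist x y < d \<longrightarrow>
        (\<forall>g\<in>{iter_deriv f vs | vs. length vs = j \<and> (\<forall>v\<in>set vs. norm v \<le> 1)}. norm (g y) \<le> M)"
      using jx(2) by (rule loc_bddE)
    have "norm (iter_deriv f vs y) \<le> M * prod_list (map norm vs)"
      if y: "y \<in> S \<inter> ball x d" and l: "length vs = j" for y vs
    proof (rule multilin_bound[where T="\<lambda>vs. iter_deriv f vs y", OF ml s _ l])
      show "norm (iter_deriv f us y) \<le> M" if "length us = j" "\<forall>v\<in>set us. norm v \<le> 1" for us
      proof -
        have "iter_deriv f us \<in> {iter_deriv f vs | vs. length vs = j \<and> (\<forall>v\<in>set vs. norm v \<le> 1)}"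
          using that by blast
        then show ?thesis using M y by (auto simp del: mem_Collect_eq)
      qed
    qed (use jx y in auto)
    then show ?thesis using d(1) by (intro exI[of _ d] conjI exI[of _ M]) simp_all
  qed
  show "((iter_deriv f vs) has_derivative (\<lambda>h. iter_deriv f (h # vs) x)) (at x)"
    if "j < n" "x \<in> S" "length vs = j" for j x vs
    using iter_deriv_differentiable(1)[OF S f, of vs x] that by simp
qed (rule S)

text \<open>This direction costs one order: differentiability of \<open>D j\<close> in operator norm
  for j < n uses a bound at order j + 2, at most n + 1, and continuity of \<open>D n\<close> uses a
  bound at order n + 1.\<close>

lemma lip_class_imp_C_on:
  assumes S: "open S" and f: "lip_class s s' (Suc n) S {f}" and s: "normed_scale s" "normed_scale s'"
  shows "C_on s s' n UNIV S f"
proof -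
  define D where "D = (\<lambda>(j::nat) x vs. iter_deriv f vs x)"
  have J: "lip_jet s s' (Suc n) S D"
    unfolding D_def by (rule lip_class_imp_lip_jet[OF S f s])
  note bd = lip_jet_bounded[OF J]
  show ?thesis
    unfolding C_on_def
  proof (intro conjI exI[of _ D] allI impI ballI)
    show "openin (top_of_set UNIV) S" using S by simp
    show "D 0 x [] = f x" for x by (simp add: D_def)
    show "bounded_multilinear_on s s' UNIV j (D j x)" if jx: "j \<le> n" "x \<in> S" for j x
    proof -
      obtain d M where d: "d > 0" and M: "\<forall>j\<le>Suc n. \<forall>y\<in>ball x d. \<forall>vs. length vs = j \<longrightarrow>
          norm (D j y vs) \<le> M * prod_list (map norm vs)"
        using bd[OF jx(2)] by (elim exE conjE)
      have "\<forall>vs. length vs = j \<longrightarrow> norm (D j x vs) \<le> M * prod_list (map norm vs)"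
        using M[rule_format, of j x] d that(1) by simp
      moreover have "multilin s s' j (D j x)" using lip_jet_multilin[OF J _ that(2)] that(1) by simp
      ultimately show ?thesis
        unfolding bounded_multilinear_on_def multilin_def by (intro conjI exI[of _ M]) simp_all
    qed
    show "\<exists>d>0. \<forall>h\<in>UNIV. norm h < d \<and> x + h \<in> S \<longrightarrow> (\<forall>vs\<in>lists UNIV. length vs = j \<longrightarrow>
        norm (D j (x + h) vs - D j x vs - D (Suc j) x (h # vs)) \<le> e * norm h * prod_list (map norm vs))"
      if jn: "j < n" and x: "x \<in> S" and e: "0 < e" for j x e
    proof -
      obtain d M where d: "d > 0" "M \<ge> 0" "ball x d \<subseteq> S" and M: "\<forall>j\<le>Suc n. \<forall>y\<in>ball x d. \<forall>vs. length vs = j \<longrightarrow>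
          norm (D j y vs) \<le> M * prod_list (map norm vs)"
        using bd[OF x] by (elim exE conjE)
      \<comment> \<open>For \<open>norm h\<close> below \<open>e / (M + 1)\<close> the factor
        \<open>M * norm h\<close> of the quadratic error is at most \<open>e\<close>; adding 1 to
        \<open>M\<close> avoids a zero denominator.\<close>
      have "norm (D j (x + h) vs - D j x vs - D (Suc j) x (h # vs)) \<le> e * norm h * prod_list (map norm vs)"
        if h: "norm h < min d (e / (M + 1))" and l: "length vs = j" for h vs
      proof -
        have "norm (D j (x + h) vs - D j x vs - D (Suc j) x (((x + h) - x) # vs))
            \<le> M * (norm ((x + h) - x))\<^sup>2 * prod_list (map norm vs)"
        proof (rule lip_jet_quadratic[OF J convex_ball d(3) _ d(2)])
          show "norm (D (Suc (Suc j)) y vs) \<le> M * prod_list (map norm vs)"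
            if "y \<in> ball x d" "length vs = Suc (Suc j)" for y vs
            using M[rule_format, of "Suc (Suc j)" y vs] that jn by simp
        qed (use jn l h d in \<open>auto simp: dist_norm\<close>)
        also have "\<dots> = (M * norm h) * norm h * prod_list (map norm vs)"
          by (simp add: power2_eq_square)
        also have "\<dots> \<le> e * norm h * prod_list (map norm vs)"
        proof (intro mult_right_mono prod_list_norm_nonneg norm_ge_zero)
          have "(M + 1) * norm h \<le> e" using h d(2) by (simp add: pos_less_divide_eq mult.commute)
          then have "M * norm h + norm h \<le> e" by (simp add: algebra_simps)
          then show "M * norm h \<le> e" using norm_ge_zero[of h] by linarith
        qed
        finally show ?thesis by simp
      qed
      then show ?thesis
        using d e by (intro exI[of _ "min d (e / (M + 1))"] conjI) simp_all
    qed
    show "\<exists>d>0. \<forall>y\<in>S. dist y x < d \<longrightarrow> (\<forall>vs\<in>lists UNIV. length vs = n \<longrightarrow>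
        norm (D n y vs - D n x vs) \<le> e * prod_list (map norm vs))"
      if x: "x \<in> S" and e: "0 < e" for x e
    proof -
      obtain d M where d: "d > 0" "M \<ge> 0" "ball x d \<subseteq> S" and M: "\<forall>j\<le>Suc n. \<forall>y\<in>ball x d. \<forall>vs. length vs = j \<longrightarrow>
          norm (D j y vs) \<le> M * prod_list (map norm vs)"
        using bd[OF x] by (elim exE conjE)
      have "norm (D n y vs - D n x vs) \<le> e * prod_list (map norm vs)"
        if y: "dist y x < min d (e / (M + 1))" and l: "length vs = n" for y vs
      proof -
        have "norm (D n y vs - D n x vs) \<le> M * norm (y - x) * prod_list (map norm vs)"
        proof (rule lip_jet_lipschitz[OF J convex_ball d(3) _ d(2)])
          show "norm (D (Suc n) y vs) \<le> M * prod_list (map norm vs)"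
            if "y \<in> ball x d" "length vs = Suc n" for y vs
            using M[rule_format, of "Suc n" y vs] that by simp
        qed (use l y d in \<open>auto simp: dist_commute\<close>)
        also have "\<dots> \<le> e * prod_list (map norm vs)"
        proof (intro mult_right_mono prod_list_norm_nonneg)
          have "(M + 1) * norm (y - x) \<le> e"
            using y d(2) by (simp add: pos_less_divide_eq mult.commute dist_norm)
          then have "M * norm (y - x) + norm (y - x) \<le> e" by (simp add: algebra_simps)
          then show "M * norm (y - x) \<le> e" using norm_ge_zero[of "y - x"] by linarith
        qed
        finally show ?thesis .
      qed
      then show ?thesis
        using d e by (intro exI[of _ "min d (e / (M + 1))"] conjI) simp_all
    qed
  qed
qed

subsection \<open>Composition\<close>

lemma has_derivative_lipschitz_at:
  assumes "(f has_derivative f') (at x)"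
  obtains d C where "d > 0" "C \<ge> 0" "\<forall>y\<in>ball x d. norm (f y - f x) \<le> C * norm (y - x)"
proof -
  from assms have bl: "bounded_linear f'"
    and "\<forall>e>0. \<exists>d>0. \<forall>y. norm (y - x) < d \<longrightarrow> norm (f y - f x - f' (y - x)) \<le> e * norm (y - x)"
    unfolding has_derivative_at_alt by blast+
  from this(2)[rule_format, OF zero_less_one] obtain d where d: "d > 0"
    "\<And>y. norm (y - x) < d \<Longrightarrow> norm (f y - f x - f' (y - x)) \<le> 1 * norm (y - x)" by blast
  obtain K where K: "K > 0" "\<And>h. norm (f' h) \<le> norm h * K"
    using bounded_linear.pos_bounded[OF bl] by blast
  have "norm (f y - f x) \<le> (1 + K) * norm (y - x)" if "y \<in> ball x d" for y
  proof -
    have "norm (y - x) < d" using that by (simp add: dist_norm norm_minus_commute)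
    from d(2)[OF this] K(2)[of "y - x"] norm_triangle_sub[of "f y - f x" "f' (y - x)"]
    show ?thesis by (simp add: algebra_simps)
  qed
  with d(1) K(1) show thesis by (intro that[of d "1 + K"]) auto
qed

lemma has_derivative_zero_quadratic:
  assumes "d > 0" "\<And>y. y \<in> ball x d \<Longrightarrow> norm (f y) \<le> C * (norm (y - x))\<^sup>2"
  shows "(f has_derivative (\<lambda>_. 0)) (at x)"
  unfolding has_derivative_at_alt
proof (intro conjI allI impI)
  have fx: "f x = 0" using assms(2)[of x] assms(1) by simp
  fix e :: real assume e: "e > 0"
  have "norm (f y - f x - 0) \<le> e * norm (y - x)" if "norm (y - x) < min d (e / (\<bar>C\<bar> + 1))" for y
  proof -
    have "norm (f y) \<le> C * (norm (y - x))\<^sup>2"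
      using that by (intro assms(2)) (simp add: dist_norm norm_minus_commute)
    also have "\<dots> \<le> ((\<bar>C\<bar> + 1) * norm (y - x)) * norm (y - x)"
      unfolding power2_eq_square mult.assoc by (intro mult_right_mono) auto
    also have "\<dots> \<le> e * norm (y - x)"
      using that by (intro mult_right_mono) (auto simp: pos_less_divide_eq mult.commute intro: less_imp_le)
    finally show ?thesis using fx by simp
  qed
  then show "\<exists>d>0. \<forall>y. norm (y - x) < d \<longrightarrow> norm (f y - f x - 0) \<le> e * norm (y - x)"
    using assms(1) e by (intro exI[of _ "min d (e / (\<bar>C\<bar> + 1))"] conjI) simp_all
qed simp

text \<open>Only the length of \<open>vs0\<close> enters. The leading arguments \<open>vs\<close>
  stay free, with a bound uniform in them, because the induction step puts the first moving argument
  \<open>w y\<close> into a leading slot, where it varies with \<open>y\<close>.\<close>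

lemma jet_eval_lip:
  fixes g :: "'x::real_normed_vector \<Rightarrow> 'a::real_normed_vector" and D :: "nat \<Rightarrow> 'a \<Rightarrow> 'a list \<Rightarrow> 'b::real_normed_vector"
  assumes J: "lip_jet s s' N T D" and gx: "g x \<in> T" and i: "i < N"
    and g: "(g has_derivative g') (at x)"
  shows "length vs0 + length ws = i \<Longrightarrow> (\<And>w. w \<in> set ws \<Longrightarrow> (w has_derivative dw w) (at x)) \<Longrightarrow>
    \<exists>d>0. \<exists>C\<ge>0. \<forall>y\<in>ball x d. g y \<in> T \<and> (\<forall>vs. length vs = length vs0 \<longrightarrow>
      norm (D i (g y) (vs @ map (\<lambda>w. w y) ws) - D i (g x) (vs @ map (\<lambda>w. w x) ws))
        \<le> C * norm (y - x) * prod_list (map norm vs))"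
proof (induction ws arbitrary: vs0)
  case Nil
  obtain \<delta> M where \<delta>: "\<delta> > 0" "M \<ge> 0" "ball (g x) \<delta> \<subseteq> T"
    and M: "\<forall>j\<le>N. \<forall>y\<in>ball (g x) \<delta>. \<forall>vs. length vs = j \<longrightarrow> norm (D j y vs) \<le> M * prod_list (map norm vs)"
    using lip_jet_bounded[OF J gx] by (elim exE conjE)
  obtain d C where d: "d > 0" "C \<ge> 0" and C: "\<forall>y\<in>ball x d. norm (g y - g x) \<le> C * norm (y - x)"
    by (rule has_derivative_lipschitz_at[OF g])
  define e where "e = min d (\<delta> / (C + 1))"
  have e: "e > 0" using d \<delta> by (simp add: e_def)
  have near: "g y \<in> ball (g x) \<delta>" if y: "y \<in> ball x e" for y
  proof -
    have "norm (g y - g x) \<le> C * norm (y - x)" using C y by (simp add: e_def)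
    also have "\<dots> \<le> (C + 1) * norm (y - x)" by (intro mult_right_mono) auto
    also have "\<dots> < \<delta>" using y d(2) by (simp add: e_def pos_less_divide_eq mult.commute dist_norm norm_minus_commute)
    finally show ?thesis by (simp add: dist_norm norm_minus_commute)
  qed
  have "norm (D i (g y) vs - D i (g x) vs) \<le> M * C * norm (y - x) * prod_list (map norm vs)"
    if y: "y \<in> ball x e" and l: "length vs = i" for y vs
  proof -
    have "norm (D i (g y) vs - D i (g x) vs) \<le> M * norm (g y - g x) * prod_list (map norm vs)"
    proof (rule lip_jet_lipschitz[OF J convex_ball \<delta>(3) _ \<delta>(2)])
      show "norm (D (Suc i) y vs) \<le> M * prod_list (map norm vs)"
        if "y \<in> ball (g x) \<delta>" "length vs = Suc i" for y vs
        using M[rule_format, of "Suc i" y vs] that i by simp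
    qed (use i l near[OF y] \<delta> in auto)
    also have "\<dots> \<le> M * (C * norm (y - x)) * prod_list (map norm vs)"
      using C y \<delta>(2) by (intro mult_right_mono mult_left_mono prod_list_norm_nonneg) (auto simp: e_def)
    finally show ?thesis by (simp add: mult.assoc)
  qed
  moreover have "g y \<in> T" if "y \<in> ball x e" for y using near[OF that] \<delta>(3) by blast
  ultimately show ?case
    using Nil e d \<delta>(2) by (intro exI[of _ e] conjI exI[of _ "M * C"]) simp_all
next
  case (Cons w ws)
  \<comment> \<open>The entry \<open>undefined\<close> only lengthens the list, so that the
    induction hypothesis has one more free leading slot.\<close>
  have "length (undefined # vs0) + length ws = i" using Cons.prems by simp
  from Cons.IH[OF this Cons.prems(2)] obtain d C where d: "d > 0" "C \<ge> 0" and
    C: "\<forall>y\<in>ball x d. g y \<in> T \<and> (\<forall>vs. length vs = length (undefined # vs0) \<longrightarrow>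
      norm (D i (g y) (vs @ map (\<lambda>w. w y) ws) - D i (g x) (vs @ map (\<lambda>w. w x) ws))
        \<le> C * norm (y - x) * prod_list (map norm vs))" by auto
  have w: "(w has_derivative dw w) (at x)" using Cons.prems by simp
  obtain d' K where d': "d' > 0" "K \<ge> 0" and K: "\<forall>y\<in>ball x d'. norm (w y - w x) \<le> K * norm (y - x)"
    by (rule has_derivative_lipschitz_at[OF w])
  obtain \<delta> M where \<delta>: "\<delta> > 0" "M \<ge> 0"
    and M: "\<forall>j\<le>N. \<forall>y\<in>ball (g x) \<delta>. \<forall>vs. length vs = j \<longrightarrow> norm (D j y vs) \<le> M * prod_list (map norm vs)"
    using lip_jet_bounded[OF J gx] by (elim exE conjE)
  define W where "W = norm (w x) + K * d'"
  define P where "P = prod_list (map norm (map (\<lambda>w. w x) ws))"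
  have P: "P \<ge> 0" unfolding P_def by (rule prod_list_norm_nonneg)
  have main: "norm (D i (g y) (vs @ w y # map (\<lambda>w. w y) ws) - D i (g x) (vs @ w x # map (\<lambda>w. w x) ws))
      \<le> (C * W + M * K * P) * norm (y - x) * prod_list (map norm vs)"
    if y: "y \<in> ball x (min d d')" and l: "length vs = length vs0" for y vs
  proof -
    let ?Q = "prod_list (map norm vs)"
    have Q: "?Q \<ge> 0" by (rule prod_list_norm_nonneg)
    have Ky: "norm (w y - w x) \<le> K * norm (y - x)" using K y by simp
    have wy: "norm (w y) \<le> W"
    proof -
      have "norm (y - x) \<le> d'" using y by (simp add: dist_norm norm_minus_commute)
      then have "K * norm (y - x) \<le> K * d'" using d' by (simp add: mult_left_mono)
      then show ?thesis using Ky norm_triangle_sub[of "w y" "w x"] unfolding W_def by linarith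
    qed
    have "norm (D i (g y) ((vs @ [w y]) @ map (\<lambda>w. w y) ws) - D i (g x) ((vs @ [w y]) @ map (\<lambda>w. w x) ws))
        \<le> C * norm (y - x) * prod_list (map norm (vs @ [w y]))"
      using C y l by (simp del: append_assoc map_append)
    also have "prod_list (map norm (vs @ [w y])) = ?Q * norm (w y)" by simp
    also have "C * norm (y - x) * (?Q * norm (w y)) \<le> C * norm (y - x) * (?Q * W)"
      using wy Q d(2) by (intro mult_left_mono) auto
    finally have 1: "norm (D i (g y) (vs @ w y # map (\<lambda>w. w y) ws) - D i (g x) (vs @ w y # map (\<lambda>w. w x) ws))
        \<le> C * W * norm (y - x) * ?Q" by (simp add: algebra_simps)
    have ml: "multilin s s' i (D i (g x))" using lip_jet_multilin[OF J _ gx] i by simp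
    have A: "D i (g x) (vs @ w y # map (\<lambda>w. w x) ws) - D i (g x) (vs @ w x # map (\<lambda>w. w x) ws)
        = D i (g x) (vs @ (w y - w x) # map (\<lambda>w. w x) ws)"
      using l Cons.prems(1) by (intro multilin_diff[OF ml, symmetric]) simp
    have "norm (D i (g x) (vs @ (w y - w x) # map (\<lambda>w. w x) ws)) \<le> M * (?Q * (norm (w y - w x) * P))"
      using M[rule_format, of i "g x" "vs @ (w y - w x) # map (\<lambda>w. w x) ws"] i l Cons.prems(1) \<delta>(1)
      by (simp add: P_def)
    moreover have "M * (?Q * (norm (w y - w x) * P)) \<le> M * (?Q * ((K * norm (y - x)) * P))"
      using Ky P Q \<delta>(2) by (intro mult_left_mono mult_right_mono) auto
    moreover have "M * (?Q * ((K * norm (y - x)) * P)) = M * K * P * norm (y - x) * ?Q"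
      by (simp add: algebra_simps)
    ultimately have 2: "norm (D i (g x) (vs @ w y # map (\<lambda>w. w x) ws) - D i (g x) (vs @ w x # map (\<lambda>w. w x) ws))
        \<le> M * K * P * norm (y - x) * ?Q" unfolding A by linarith
    have "norm (D i (g y) (vs @ w y # map (\<lambda>w. w y) ws) - D i (g x) (vs @ w x # map (\<lambda>w. w x) ws))
      \<le> norm (D i (g y) (vs @ w y # map (\<lambda>w. w y) ws) - D i (g x) (vs @ w y # map (\<lambda>w. w x) ws))
        + norm (D i (g x) (vs @ w y # map (\<lambda>w. w x) ws) - D i (g x) (vs @ w x # map (\<lambda>w. w x) ws))"
      by norm
    with 1 2 show ?thesis by (simp add: algebra_simps)
  qed
  have "W \<ge> 0" using d' by (simp add: W_def)
  then have "C * W + M * K * P \<ge> 0" using d d' \<delta>(2) P by simp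
  moreover have "g y \<in> T" if "y \<in> ball x (min d d')" for y using C that by simp
  ultimately show ?case
    using d d' main by (intro exI[of _ "min d d'"] conjI exI[of _ "C * W + M * K * P"]) simp_all
qed

text \<open>The chain rule in the base point \<open>g\<close> combined with the Leibniz rule in the
  moving arguments \<open>ws\<close>. The induction freezes the first moving argument at
  \<open>w x\<close> and treats its increment separately.\<close>

lemma jet_eval_deriv:
  fixes g :: "'x::real_normed_vector \<Rightarrow> 'a::real_normed_vector" and D :: "nat \<Rightarrow> 'a \<Rightarrow> 'a list \<Rightarrow> 'b::real_normed_vector"
  assumes J: "lip_jet s s' N T D" and s: "normed_scale s" "normed_scale s'" and gx: "g x \<in> T" and i: "i < N"
    and g: "(g has_derivative g') (at x)"
  shows "length us + length ws = i \<Longrightarrow> (\<And>w. w \<in> set ws \<Longrightarrow> (w has_derivative dw w) (at x)) \<Longrightarrow>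
    ((\<lambda>y. D i (g y) (us @ map (\<lambda>w. w y) ws)) has_derivative
     (\<lambda>h. D (Suc i) (g x) (g' h # us @ map (\<lambda>w. w x) ws)
        + (\<Sum>l<length ws. D i (g x) (us @ (map (\<lambda>w. w x) ws)[l := dw (ws ! l) h])))) (at x)"
proof (induction ws arbitrary: us)
  case Nil
  have "((\<lambda>y. D i y us) has_derivative (\<lambda>h. D (Suc i) (g x) (h # us))) (at (g x))"
    using lip_jet_deriv[OF J i gx] Nil by simp
  from diff_chain_at[OF g this] show ?case by (simp add: o_def)
next
  case (Cons w ws)
  let ?us = "us @ [w x]"
  let ?W = "\<lambda>y. map (\<lambda>w. w y) ws"
  have l: "length ?us + length ws = i" using Cons.prems by simp
  have w: "(w has_derivative dw w) (at x)" using Cons.prems by simp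
  have dws: "(v has_derivative dw v) (at x)" if "v \<in> set ws" for v using Cons.prems(2) that by simp
  note IH = Cons.IH[OF l dws]
  obtain d C where d: "d > 0" "C \<ge> 0" and
    C: "\<forall>y\<in>ball x d. g y \<in> T \<and> (\<forall>vs. length vs = length ?us \<longrightarrow>
      norm (D i (g y) (vs @ map (\<lambda>w. w y) ws) - D i (g x) (vs @ map (\<lambda>w. w x) ws))
        \<le> C * norm (y - x) * prod_list (map norm vs))"
    using jet_eval_lip[OF J gx i g l dws] by auto
  obtain d' K where d': "d' > 0" "K \<ge> 0" and K: "\<forall>y\<in>ball x d'. norm (w y - w x) \<le> K * norm (y - x)"
    by (rule has_derivative_lipschitz_at[OF w])
  have ml: "multilin s s' i (D i y)" if "y \<in> T" for y using lip_jet_multilin[OF J _ that] i by simp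
  obtain \<delta> M where \<delta>: "\<delta> > 0" "M \<ge> 0"
    and M: "\<forall>j\<le>N. \<forall>y\<in>ball (g x) \<delta>. \<forall>vs. length vs = j \<longrightarrow> norm (D j y vs) \<le> M * prod_list (map norm vs)"
    using lip_jet_bounded[OF J gx] by (elim exE conjE)
  define A where "A = (\<lambda>v. D i (g x) (us @ v # ?W x))"
  have A: "bounded_linear A"
  proof (rule bounded_linear_intro[where K="M * prod_list (map norm us) * prod_list (map norm (?W x))"])
    show "A (v + v') = A v + A v'" for v v'
      unfolding A_def using l by (intro multilin_add[OF ml[OF gx]]) simp
    show "A (r *\<^sub>R v) = r *\<^sub>R A v" for r v
      unfolding A_def using l by (intro multilin_scaleR[OF ml[OF gx] s]) simp
    show "norm (A v) \<le> norm v * (M * prod_list (map norm us) * prod_list (map norm (?W x)))" for v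
      unfolding A_def using M[rule_format, of i "g x" "us @ v # ?W x"] i l \<delta>(1) by (simp add: algebra_simps)
  qed
  have D1: "((\<lambda>y. A (w y - w x)) has_derivative (\<lambda>h. A (dw w h))) (at x)"
    by (rule bounded_linear.has_derivative[OF A]) (use w in \<open>auto intro!: derivative_eq_intros\<close>)
  \<comment> \<open>The increment \<open>w y - w x\<close> and the change of the remaining data are
    both of first order in \<open>y - x\<close>, so \<open>E\<close> is quadratic and contributes no
    derivative.\<close>
  define E where "E = (\<lambda>y. D i (g y) (us @ (w y - w x) # ?W y) - A (w y - w x))"
  have D2: "(E has_derivative (\<lambda>_. 0)) (at x)"
  proof (rule has_derivative_zero_quadratic[where C="C * prod_list (map norm us) * K"])
    show "min d d' > 0" using d d' by simp
    fix y assume y: "y \<in> ball x (min d d')"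
    have "norm (D i (g y) ((us @ [w y - w x]) @ ?W y) - D i (g x) ((us @ [w y - w x]) @ ?W x))
        \<le> C * norm (y - x) * prod_list (map norm (us @ [w y - w x]))"
      using C y by (simp del: append_assoc map_append)
    also have "prod_list (map norm (us @ [w y - w x])) = prod_list (map norm us) * norm (w y - w x)" by simp
    also have "C * norm (y - x) * (prod_list (map norm us) * norm (w y - w x))
        \<le> C * norm (y - x) * (prod_list (map norm us) * (K * norm (y - x)))"
      using K y d(2) by (intro mult_left_mono) (auto simp: prod_list_norm_nonneg)
    finally show "norm (E y) \<le> C * prod_list (map norm us) * K * (norm (y - x))\<^sup>2"
      by (simp add: E_def A_def power2_eq_square algebra_simps)
  qed
  have sum: "((\<lambda>y. D i (g y) (?us @ ?W y) + (A (w y - w x) + E y)) has_derivative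
     (\<lambda>h. (D (Suc i) (g x) (g' h # ?us @ ?W x)
        + (\<Sum>l<length ws. D i (g x) (?us @ (?W x)[l := dw (ws ! l) h]))) + (A (dw w h) + 0))) (at x)"
    by (intro has_derivative_add IH D1 D2)
  have eq: "D i (g y) (?us @ ?W y) + (A (w y - w x) + E y) = D i (g y) (us @ map (\<lambda>w. w y) (w # ws))"
    if "y \<in> ball x d" for y
  proof -
    have "D i (g y) (us @ (w y - w x) # ?W y) = D i (g y) (us @ w y # ?W y) - D i (g y) (us @ w x # ?W y)"
      using C that l by (intro multilin_diff[OF ml]) auto
    then show ?thesis by (simp add: E_def)
  qed
  have "((\<lambda>y. D i (g y) (us @ map (\<lambda>w. w y) (w # ws))) has_derivative
     (\<lambda>h. (D (Suc i) (g x) (g' h # ?us @ ?W x)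
        + (\<Sum>l<length ws. D i (g x) (?us @ (?W x)[l := dw (ws ! l) h]))) + (A (dw w h) + 0))) (at x)"
    by (rule has_derivative_transform_within_open[OF sum open_ball _ eq]) (use d in auto)
  then show ?case
    by (simp add: A_def sum.lessThan_Suc_shift algebra_simps del: sum.lessThan_Suc)
qed

text \<open>Differentiation either raises \<open>i\<close> by one, with a derivative of
  \<open>g\<close> as new first argument, or replaces one argument by its derivative. After
  enlarging \<open>W\<close> by these derivatives the result is a sum of expressions of the same
  kind, and \<open>i + n \<le> N\<close> is preserved. The induction therefore runs over all
  \<open>i\<close> and \<open>W\<close> simultaneously.\<close>

lemma lip_class_jet_comp:
  fixes g :: "'x::real_normed_vector \<Rightarrow> 'a::real_normed_vector" and D :: "nat \<Rightarrow> 'a \<Rightarrow> 'a list \<Rightarrow> 'b::real_normed_vector"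
    and W :: "('x \<Rightarrow> 'a) set"
  assumes S: "open S" and J: "lip_jet s s' N T D" and s: "normed_scale s" "normed_scale s'"
    and gS: "\<And>x. x \<in> S \<Longrightarrow> g x \<in> T" and gc: "continuous_on S g"
    and g: "lip_class s0 s n S {g}"
  shows "lip_class s0 s n S W \<Longrightarrow> i + n \<le> N \<Longrightarrow>
    lip_class s0 s' n S {\<lambda>x. D i (g x) (map (\<lambda>w. w x) ws) | ws. set ws \<subseteq> W \<and> length ws = i}"
  using g
proof (induction n arbitrary: i W)
  interpret s': normed_scale s' by fact
  {
    fix i and W :: "('x \<Rightarrow> 'a) set" assume W: "loc_bdd S W" and i: "i \<le> N"
    have "loc_bdd S {\<lambda>x. D i (g x) (map (\<lambda>w. w x) ws) | ws. set ws \<subseteq> W \<and> length ws = i}"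
    proof (rule loc_bddI)
      fix x assume x: "x \<in> S"
      obtain \<delta> M where \<delta>: "\<delta> > 0" "M \<ge> 0"
        and M: "\<forall>j\<le>N. \<forall>y\<in>ball (g x) \<delta>. \<forall>vs. length vs = j \<longrightarrow> norm (D j y vs) \<le> M * prod_list (map norm vs)"
        using lip_jet_bounded[OF J gS[OF x]] by (elim exE conjE)
      obtain d where d: "d > 0" "\<And>y. y \<in> S \<Longrightarrow> dist y x < d \<Longrightarrow> dist (g y) (g x) < \<delta>"
        using gc x \<delta>(1) unfolding continuous_on_iff by metis
      obtain d' K where d': "d' > 0" "K \<ge> 0" and K: "\<forall>y\<in>S. dist x y < d' \<longrightarrow> (\<forall>f\<in>W. norm (f y) \<le> K)"
        using W x by (rule loc_bddE)
      have "norm (D i (g y) (map (\<lambda>w. w y) ws)) \<le> M * K ^ i"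
        if y: "y \<in> S" "dist x y < min d d'" and ws: "set ws \<subseteq> W" "length ws = i" for y ws
      proof -
        have "norm (D i (g y) (map (\<lambda>w. w y) ws)) \<le> M * prod_list (map norm (map (\<lambda>w. w y) ws))"
          using M[rule_format, of i "g y" "map (\<lambda>w. w y) ws"] d(2)[of y] y ws i by (simp add: dist_commute)
        moreover have "prod_list (map norm (map (\<lambda>w. w y) ws)) \<le> K ^ length ws"
          using ws(1)
        proof (induction ws)
          case (Cons w ws)
          have "norm (w y) \<le> K" using K y Cons.prems by simp
          then show ?case using Cons d' prod_list_norm_nonneg[of "map (\<lambda>w. w y) ws"] by (auto intro!: mult_mono)
        qed simp
        ultimately show ?thesis using \<delta>(2) ws(2) by (meson mult_left_mono order_trans)
      qed
      then show "\<exists>d>0. \<exists>M. \<forall>y\<in>S. dist x y < d \<longrightarrow>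
          (\<forall>f\<in>{\<lambda>x. D i (g x) (map (\<lambda>w. w x) ws) | ws. set ws \<subseteq> W \<and> length ws = i}. norm (f y) \<le> M)"
        using d(1) d'(1) by (intro exI[of _ "min d d'"] conjI exI[of _ "M * K ^ i"]) auto
    qed
  } note bdd = this
  let ?E = "\<lambda>i W. {\<lambda>x. D i (g x) (map (\<lambda>w. w x) ws) | ws. set ws \<subseteq> W \<and> length ws = i}"
  {
    case 0
    then show ?case by (simp add: bdd)
  next
    case (Suc n)
    define W' where "W' = (\<lambda>\<rho>. W \<union> dirs (W \<union> {g}) \<rho>)"
    have Wg: "lip_class s0 s (Suc n) S (W \<union> {g})"
      by (rule lip_class_Un[OF Suc.prems(1,3)])
    have W': "lip_class s0 s n S (W' \<rho>)" for \<rho>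
      unfolding W'_def by (intro lip_class_Un lip_class_SucD(3)[OF Wg] lip_class_lower[OF S Suc.prems(1)])
    have gn: "lip_class s0 s n S {g}" by (rule lip_class_lower[OF S Suc.prems(3)])
    let ?Q = "\<lambda>\<rho>. {\<lambda>x. (\<Sum>l<i. f l x) | f. \<forall>l<i. f l \<in> ?E i (W' \<rho>)}"
    show ?case
    proof (rule lip_class_SucI[OF S, where H="\<lambda>\<rho>. {\<lambda>x. f x + h x | f h. f \<in> ?E (Suc i) (W' \<rho>) \<and> h \<in> ?Q \<rho>}"])
      show "loc_bdd S (?E i W)" by (rule bdd[OF lip_class_loc_bdd[OF Suc.prems(1)]]) (use Suc.prems in simp)
      show "lip_class s0 s' n S {\<lambda>x. f x + h x | f h. f \<in> ?E (Suc i) (W' \<rho>) \<and> h \<in> ?Q \<rho>}" for \<rho>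
        by (intro lip_class_add[OF S s(2)] lip_class_sum[OF S s(2)] Suc.IH W' gn) (use Suc.prems in auto)
      fix f assume "f \<in> ?E i W"
      then obtain ws where f: "f = (\<lambda>x. D i (g x) (map (\<lambda>w. w x) ws))" and ws: "set ws \<subseteq> W" "length ws = i"
        by blast
      define fd where "fd = (\<lambda>(w :: 'x \<Rightarrow> 'a) x. frechet_derivative w (at x))"
      have fdw: "(w has_derivative fd w x) (at x)" "fd w x (s0 c v) = s c (fd w x v)"
        if "w \<in> W \<union> {g}" "x \<in> S" for w x c v
        unfolding fd_def by (rule lip_class_SucD(1)[OF Wg that] lip_class_SucD(2)[OF Wg that])+
      let ?d = "\<lambda>x v. D (Suc i) (g x) (fd g x v # map (\<lambda>w. w x) ws)
          + (\<Sum>l<i. D i (g x) ((map (\<lambda>w. w x) ws)[l := fd (ws ! l) x v]))"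
      show "\<exists>d. (\<forall>x\<in>S. (f has_derivative d x) (at x) \<and> (\<forall>c v. d x (s0 c v) = s' c (d x v))) \<and>
          (\<forall>\<rho> v. norm v \<le> \<rho> \<longrightarrow> (\<lambda>x. d x v) \<in> {\<lambda>x. f x + h x | f h. f \<in> ?E (Suc i) (W' \<rho>) \<and> h \<in> ?Q \<rho>})"
      proof (intro exI[of _ ?d] conjI ballI allI impI)
        fix x assume x: "x \<in> S"
        have "((\<lambda>y. D i (g y) ([] @ map (\<lambda>w. w y) ws)) has_derivative
           (\<lambda>h. D (Suc i) (g x) (fd g x h # [] @ map (\<lambda>w. w x) ws)
              + (\<Sum>l<length ws. D i (g x) ([] @ (map (\<lambda>w. w x) ws)[l := fd (ws ! l) x h])))) (at x)"
          by (rule jet_eval_deriv[where g=g and x=x and dw="\<lambda>w. fd w x", OF J s gS[OF x]]) (use Suc.prems(2) ws x in \<open>auto intro: fdw\<close>)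
        then show "(f has_derivative ?d x) (at x)" by (simp add: f ws(2))
        fix c v
        have m1: "multilin s s' (Suc i) (D (Suc i) (g x))" and m2: "multilin s s' i (D i (g x))"
          using lip_jet_multilin[OF J _ gS[OF x]] Suc.prems(2) by simp_all
        have "D (Suc i) (g x) (fd g x (s0 c v) # map (\<lambda>w. w x) ws) = s' c (D (Suc i) (g x) (fd g x v # map (\<lambda>w. w x) ws))"
          using multilin_scale[OF m1, of "[]" "map (\<lambda>w. w x) ws"] ws(2) x by (simp add: fdw)
        moreover have "D i (g x) ((map (\<lambda>w. w x) ws)[l := fd (ws ! l) x (s0 c v)])
            = s' c (D i (g x) ((map (\<lambda>w. w x) ws)[l := fd (ws ! l) x v]))" if "l < i" for l
        proof -
          have "ws ! l \<in> W" using ws that by auto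
          then show ?thesis using that ws x
            by (simp add: fdw upd_conv_take_nth_drop multilin_scale[OF m2])
        qed
        ultimately show "?d x (s0 c v) = s' c (?d x v)"
          by (simp add: s'.scale_right_distrib s'.scale_sum_right)
      next
        fix \<rho> and v :: 'x assume v: "norm v \<le> \<rho>"
        have fdW: "(\<lambda>x. fd w x v) \<in> W' \<rho>" if "w \<in> W \<union> {g}" for w
          unfolding W'_def fd_def by (rule UnI2, rule dirsI[OF that v])
        have WW: "W \<subseteq> W' \<rho>" by (simp add: W'_def)
        have "(\<lambda>x. D (Suc i) (g x) (map (\<lambda>w. w x) ((\<lambda>x. fd g x v) # ws))) \<in> ?E (Suc i) (W' \<rho>)"
          using ws WW fdW[of g] by (intro CollectI exI[of _ "(\<lambda>x. fd g x v) # ws"] conjI refl) auto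
        then have 1: "(\<lambda>x. D (Suc i) (g x) (fd g x v # map (\<lambda>w. w x) ws)) \<in> ?E (Suc i) (W' \<rho>)"
          by (simp only: list.map)
        have 2: "(\<lambda>x. D i (g x) ((map (\<lambda>w. w x) ws)[l := fd (ws ! l) x v])) \<in> ?E i (W' \<rho>)" if l: "l < i" for l
        proof -
          have "ws ! l \<in> W" using ws l by auto
          then have "set (ws[l := (\<lambda>x. fd (ws ! l) x v)]) \<subseteq> W' \<rho>"
            using fdW[of "ws ! l"] ws WW set_update_subset_insert[of ws l "\<lambda>x. fd (ws ! l) x v"] by blast
          moreover have "(\<lambda>x. D i (g x) ((map (\<lambda>w. w x) ws)[l := fd (ws ! l) x v]))
              = (\<lambda>x. D i (g x) (map (\<lambda>w. w x) (ws[l := (\<lambda>x. fd (ws ! l) x v)])))"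
            by (simp add: map_update)
          ultimately show ?thesis
            using ws by (intro CollectI exI[of _ "ws[l := (\<lambda>x. fd (ws ! l) x v)]"] conjI) auto
        qed
        have 3: "(\<lambda>x. \<Sum>l<i. D i (g x) ((map (\<lambda>w. w x) ws)[l := fd (ws ! l) x v])) \<in> ?Q \<rho>"
          by (rule CollectI, rule exI[of _ "\<lambda>l x. D i (g x) ((map (\<lambda>w. w x) ws)[l := fd (ws ! l) x v])"],
              rule conjI, rule refl, rule allI, rule impI, rule 2)
        show "(\<lambda>x. ?d x v) \<in> {\<lambda>x. f x + h x | f h. f \<in> ?E (Suc i) (W' \<rho>) \<and> h \<in> ?Q \<rho>}"
          by (rule plus_memI[OF 1 3])
      qed
    qed
  }
qed

lemma has_derivative_quadraticI:
  assumes L: "bounded_linear L" and d: "d > 0"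
    and q: "\<And>y. y \<in> ball x d \<Longrightarrow> norm (f y - f x - L (y - x)) \<le> C * (norm (y - x))\<^sup>2"
  shows "(f has_derivative L) (at x)"
proof -
  have E: "((\<lambda>y. f y - f x - L (y - x)) has_derivative (\<lambda>_. 0)) (at x)"
    by (rule has_derivative_zero_quadratic[OF d q])
  have "((\<lambda>y. (f x + L (y - x)) + (f y - f x - L (y - x))) has_derivative (\<lambda>h. (0 + L (h - 0)) + 0)) (at x)"
    by (intro has_derivative_add has_derivative_const E bounded_linear.has_derivative[OF L]
        has_derivative_diff has_derivative_ident)
  then show ?thesis by simp
qed

lemma prod_list_norm_mono:
  "(\<And>v. norm (f v) \<le> norm v) \<Longrightarrow> prod_list (map norm (map f vs)) \<le> prod_list (map norm vs)"
proof (induction vs)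
  case (Cons v vs)
  then show ?case using prod_list_norm_nonneg[of "map f vs"] by (auto intro!: mult_mono)
qed simp

lemma norm_diff_add: "norm (a - b + c) \<le> norm a + norm b + norm c"
  for a b c :: "'a::real_normed_vector"
  by norm

text \<open>The second difference \<open>\<Delta> t h v\<close> is symmetric in \<open>h\<close> and
  \<open>v\<close>. It equals the second derivative times \<open>t^2\<close> up to an error of order
  \<open>t^3\<close> controlled by third derivatives; dividing by \<open>t^2\<close> and letting
  \<open>t\<close> tend to 0 gives symmetry.\<close>

lemma jet_second_deriv_symmetric:
  assumes J: "lip_jet s s' n S D" and n: "3 \<le> n" and x: "x \<in> S"
  shows "D (Suc (Suc 0)) x [h, v] = D (Suc (Suc 0)) x [v, h]"
proof -
  obtain d M where d: "d > 0" "M \<ge> 0" "ball x d \<subseteq> S" and M0: "\<forall>j\<le>n. \<forall>y\<in>ball x d. \<forall>vs. length vs = j \<longrightarrow>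
      norm (D j y vs) \<le> M * prod_list (map norm vs)"
    using lip_jet_bounded[OF J x] by (elim exE conjE)
  have M: "norm (D j y vs) \<le> M * prod_list (map norm vs)" if "j \<le> n" "y \<in> ball x d" "length vs = j" for j y vs
    using M0 that by simp
  define G where "G = (\<lambda>y. D 0 y [])"
  define \<Delta> where "\<Delta> = (\<lambda>t h v. G (x + t *\<^sub>R h + t *\<^sub>R v) - G (x + t *\<^sub>R h) - (G (x + t *\<^sub>R v) - G x))"
  have dG: "(G has_derivative (\<lambda>k. D (Suc 0) y [k])) (at y)" if "y \<in> ball x d" for y
    using lip_jet_deriv[OF J, of 0 y "[]"] that d(3) n by (auto simp: G_def)
  \<comment> \<open>The factor 4 collects three errors \<open>M * (t * ?a)\<^sup>2\<close> in the
    linearization of \<phi> along \<open>h\<close> (two from \<open>quad\<close>, one from moving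
    the base point from \<open>z\<close> to \<open>x\<close>) and one more from replacing
    \<open>\<phi>' x\<close> by the second derivative at \<open>x\<close>.\<close>
  have main: "norm (\<Delta> t h v - t\<^sup>2 *\<^sub>R D (Suc (Suc 0)) x [v, h]) \<le> 4 * M * (norm h + norm v) ^ 3 * t ^ 3"
    if t: "0 < t" "t * (norm h + norm v) < d" for t h v
  proof -
    let ?a = "norm h + norm v"
    let ?L = "closed_segment x (x + t *\<^sub>R h)"
    have ml1: "multilin s s' (Suc j) (D (Suc j) y)" if "y \<in> ball x d" "j < n" for y j
      using lip_jet_multilin[OF J, of "Suc j" y] that d(3) by auto
    have inb: "z \<in> ball x d" "z + t *\<^sub>R v \<in> ball x d" "norm (z - x) \<le> t * norm h" if z: "z \<in> ?L" for z
    proof -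
      show 1: "norm (z - x) \<le> t * norm h" using segment_bound1[OF z] t by simp
      have "norm (z + t *\<^sub>R v - x) \<le> norm (z - x) + t * norm v"
        using norm_triangle_ineq[of "z - x" "t *\<^sub>R v"] t by (simp add: algebra_simps)
      moreover have "t * norm h + t * norm v < d" "0 \<le> t * norm v" using t by (simp_all add: algebra_simps)
      ultimately show "z \<in> ball x d" "z + t *\<^sub>R v \<in> ball x d" 
        using 1 by (simp_all add: dist_norm norm_minus_commute)
    qed
    have xL: "x \<in> ?L" by simp
    define \<phi> where "\<phi> = (\<lambda>y. G (y + t *\<^sub>R v) - G y)"
    define \<phi>' where "\<phi>' = (\<lambda>y k. D (Suc 0) (y + t *\<^sub>R v) [k] - D (Suc 0) y [k])"
    have quad: "norm (\<phi>' z k - t *\<^sub>R D (Suc (Suc 0)) z [v, k]) \<le> M * (t * ?a)\<^sup>2 * norm k" if z: "z \<in> ?L" for z k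
    proof -
      have "norm (D (Suc 0) (z + t *\<^sub>R v) [k] - D (Suc 0) z [k] - D (Suc (Suc 0)) z ((z + t *\<^sub>R v - z) # [k]))
          \<le> M * (norm (z + t *\<^sub>R v - z))\<^sup>2 * prod_list (map norm [k])"
        by (rule lip_jet_quadratic[OF J convex_ball d(3) M d(2)]) (use n inb[OF z] in auto)
      moreover have "D (Suc (Suc 0)) z ((z + t *\<^sub>R v - z) # [k]) = t *\<^sub>R D (Suc (Suc 0)) z [v, k]"
      proof -
        have "linear (\<lambda>u. D (Suc (Suc 0)) z (u # [k]))"
          using has_derivative_linear[OF lip_jet_deriv[OF J, of "Suc 0" z "[k]"]] n inb[OF z] d(3) by auto
        from linear_cmul[OF this, of t v] show ?thesis by simp
      qed
      moreover have "M * (norm (z + t *\<^sub>R v - z))\<^sup>2 * norm k \<le> M * (t * ?a)\<^sup>2 * norm k"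
        using t d(2) by (intro mult_right_mono mult_left_mono power_mono) auto
      ultimately show ?thesis by (simp add: \<phi>'_def)
    qed
    have lin: "norm (\<phi> (x + t *\<^sub>R h) - \<phi> x - \<phi>' x (x + t *\<^sub>R h - x)) \<le> norm (x + t *\<^sub>R h - x) * (3 * M * (t * ?a)\<^sup>2)"
    proof (rule differentiable_bound_linearization[where S="?L"])
      show "x + u *\<^sub>R (x + t *\<^sub>R h - x) \<in> ?L" if "u \<in> {0..1}" for u
        using that by (auto simp: in_segment algebra_simps intro!: exI[of _ u])
      fix z assume z: "z \<in> ?L"
      have "((\<lambda>y. G (y + t *\<^sub>R v)) has_derivative (\<lambda>k. D (Suc 0) (z + t *\<^sub>R v) [k])) (at z)"
        using diff_chain_at[of "\<lambda>y. y + t *\<^sub>R v" "\<lambda>k. k" z G, OF _ dG[OF inb(2)[OF z]]]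
        by (simp add: o_def has_derivative_add_const)
      then show "(\<phi> has_derivative \<phi>' z) (at z within ?L)"
        unfolding \<phi>_def \<phi>'_def using dG[OF inb(1)[OF z]]
        by (intro has_derivative_diff) (auto intro: has_derivative_at_withinI)
      show "onorm (\<phi>' z - \<phi>' x) \<le> 3 * M * (t * ?a)\<^sup>2"
      proof (rule onorm_bound)
        fix k
        have "norm (D (Suc (Suc 0)) z [v, k] - D (Suc (Suc 0)) x [v, k]) \<le> M * norm (z - x) * prod_list (map norm [v, k])"
        proof (rule lip_jet_lipschitz[OF J convex_ball d(3) _ d(2)])
          show "norm (D (Suc (Suc (Suc 0))) y vs) \<le> M * prod_list (map norm vs)" if "y \<in> ball x d" "length vs = Suc (Suc (Suc 0))" for y vs
            using M[of "Suc (Suc (Suc 0))" y vs] that n by simp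
        qed (use n inb[OF z] d in auto)
        also have "\<dots> \<le> M * (t * norm h) * (norm v * norm k)"
          using inb(3)[OF z] d(2) t by (auto intro!: mult_mono mult_nonneg_nonneg)
        finally have "t * norm (D (Suc (Suc 0)) z [v, k] - D (Suc (Suc 0)) x [v, k]) \<le> t * (M * (t * norm h) * (norm v * norm k))"
          using t by (intro mult_left_mono) auto
        also have "\<dots> = M * t\<^sup>2 * (norm h * norm v) * norm k" by (simp add: power2_eq_square)
        also have "\<dots> \<le> M * t\<^sup>2 * (?a * ?a) * norm k"
          using d(2) by (intro mult_right_mono mult_left_mono mult_mono) auto
        also have "\<dots> = M * (t * ?a)\<^sup>2 * norm k" by (simp add: power2_eq_square algebra_simps)
        finally have 3: "norm (t *\<^sub>R D (Suc (Suc 0)) z [v, k] - t *\<^sub>R D (Suc (Suc 0)) x [v, k]) \<le> M * (t * ?a)\<^sup>2 * norm k"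
          using t by (simp flip: scaleR_diff_right)
        have "(\<phi>' z - \<phi>' x) k = (\<phi>' z k - t *\<^sub>R D (Suc (Suc 0)) z [v, k]) - (\<phi>' x k - t *\<^sub>R D (Suc (Suc 0)) x [v, k])
            + (t *\<^sub>R D (Suc (Suc 0)) z [v, k] - t *\<^sub>R D (Suc (Suc 0)) x [v, k])" by simp
        also have "norm \<dots> \<le> norm (\<phi>' z k - t *\<^sub>R D (Suc (Suc 0)) z [v, k]) + norm (\<phi>' x k - t *\<^sub>R D (Suc (Suc 0)) x [v, k])
            + norm (t *\<^sub>R D (Suc (Suc 0)) z [v, k] - t *\<^sub>R D (Suc (Suc 0)) x [v, k])"
          by (rule norm_diff_add)
        also have "\<dots> \<le> 3 * M * (t * ?a)\<^sup>2 * norm k"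
          using quad[OF z, of k] quad[OF xL, of k] 3 by linarith
        finally show "norm ((\<phi>' z - \<phi>' x) k) \<le> 3 * M * (t * ?a)\<^sup>2 * norm k" .
      qed (use d(2) in simp)
    qed (rule xL)
    have "norm (x + t *\<^sub>R h - x) * (3 * M * (t * ?a)\<^sup>2) \<le> (t * ?a) * (3 * M * (t * ?a)\<^sup>2)"
      using t d(2) by (intro mult_right_mono) auto
    with lin have 1: "norm (\<Delta> t h v - \<phi>' x (t *\<^sub>R h)) \<le> 3 * M * (t * ?a) ^ 3"
      by (simp add: \<Delta>_def \<phi>_def power2_eq_square power3_eq_cube algebra_simps)
    have "norm (\<phi>' x (t *\<^sub>R h) - t *\<^sub>R D (Suc (Suc 0)) x [v, t *\<^sub>R h]) \<le> M * (t * ?a)\<^sup>2 * (t * norm h)"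
      using quad[OF xL, of "t *\<^sub>R h"] t by simp
    also have "\<dots> \<le> M * (t * ?a)\<^sup>2 * (t * ?a)"
      using t d(2) by (intro mult_left_mono) auto
    finally have 2: "norm (\<phi>' x (t *\<^sub>R h) - t *\<^sub>R D (Suc (Suc 0)) x [v, t *\<^sub>R h]) \<le> M * (t * ?a) ^ 3"
      by (simp add: power2_eq_square power3_eq_cube algebra_simps)
    have ev: "\<forall>w. ((\<lambda>y. D (Suc 0) y [w]) has_derivative (\<lambda>k. D (Suc (Suc 0)) x [k, w])) (at x)"
      using lip_jet_deriv[OF J _ x, of "Suc 0"] n by simp
    have "D (Suc (Suc 0)) x [v, t *\<^sub>R h] = t *\<^sub>R D (Suc (Suc 0)) x [v, h]"
    proof -
      have "linear (\<lambda>k. D (Suc 0) y [k])" if "y \<in> ball x d" for y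
        using has_derivative_linear[OF dG[OF that]] .
      then have lc: "\<forall>y\<in>ball x d. D (Suc 0) y [t *\<^sub>R h] = t *\<^sub>R D (Suc 0) y [h]"
        by (intro ballI) (rule linear_cmul)
      have "((\<lambda>y. t *\<^sub>R D (Suc 0) y [h]) has_derivative (\<lambda>k. D (Suc (Suc 0)) x [k, t *\<^sub>R h])) (at x)"
        by (rule has_derivative_transform_within_open[OF spec[OF ev] open_ball centre_in_ball[THEN iffD2, OF d(1)]])
           (use lc in simp)
      moreover have "((\<lambda>y. t *\<^sub>R D (Suc 0) y [h]) has_derivative (\<lambda>k. t *\<^sub>R D (Suc (Suc 0)) x [k, h])) (at x)"
        by (rule has_derivative_scaleR_right[OF spec[OF ev]])
      ultimately have "(\<lambda>k. D (Suc (Suc 0)) x [k, t *\<^sub>R h]) = (\<lambda>k. t *\<^sub>R D (Suc (Suc 0)) x [k, h])" by (rule has_derivative_unique)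
      then show ?thesis by (rule fun_cong)
    qed
    then have "t *\<^sub>R D (Suc (Suc 0)) x [v, t *\<^sub>R h] = t\<^sup>2 *\<^sub>R D (Suc (Suc 0)) x [v, h]" by (simp add: power2_eq_square)
    with 1 2 have "norm (\<Delta> t h v - t\<^sup>2 *\<^sub>R D (Suc (Suc 0)) x [v, h]) \<le> 4 * M * (t * ?a) ^ 3"
      using norm_triangle_ineq[of "\<Delta> t h v - \<phi>' x (t *\<^sub>R h)" "\<phi>' x (t *\<^sub>R h) - t *\<^sub>R D (Suc (Suc 0)) x [v, t *\<^sub>R h]"] by simp
    moreover have "4 * M * (t * ?a) ^ 3 = 4 * M * ?a ^ 3 * t ^ 3" unfolding power_mult_distrib by simp
    ultimately show ?thesis by simp
  qed
  let ?a = "norm h + norm v"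
  let ?K = "8 * M * ?a ^ 3"
  have small: "norm (D (Suc (Suc 0)) x [h, v] - D (Suc (Suc 0)) x [v, h]) \<le> ?K * t" if t: "0 < t" "t * ?a < d" for t
  proof -
    have "\<Delta> t h v = \<Delta> t v h" by (simp add: \<Delta>_def algebra_simps)
    then have "norm (t\<^sup>2 *\<^sub>R D (Suc (Suc 0)) x [h, v] - t\<^sup>2 *\<^sub>R D (Suc (Suc 0)) x [v, h]) \<le> ?K * t ^ 3"
      using main[OF t] main[of t v h] t
        norm_triangle_ineq4[of "\<Delta> t h v - t\<^sup>2 *\<^sub>R D (Suc (Suc 0)) x [v, h]" "\<Delta> t h v - t\<^sup>2 *\<^sub>R D (Suc (Suc 0)) x [h, v]"]
      by (simp add: add.commute)
    then have "t\<^sup>2 * norm (D (Suc (Suc 0)) x [h, v] - D (Suc (Suc 0)) x [v, h]) \<le> t\<^sup>2 * (?K * t)"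
      by (simp add: power2_eq_square power3_eq_cube algebra_simps flip: scaleR_diff_right)
    then show ?thesis using t(1) by simp
  qed
  have "((\<lambda>t. ?K * t) \<longlongrightarrow> ?K * 0) (at_right 0)" by (intro tendsto_intros)
  moreover have "eventually (\<lambda>t. norm (D (Suc (Suc 0)) x [h, v] - D (Suc (Suc 0)) x [v, h]) \<le> ?K * t) (at_right 0)"
  proof -
    have "eventually (\<lambda>t::real. t \<in> {0<..<d / (?a + 1)}) (at_right 0)"
      using d(1) by (intro eventually_at_right_real) (simp add: add_nonneg_pos)
    then show ?thesis
    proof eventually_elim
      case (elim t)
      then have "t * (?a + 1) < d" by (simp add: pos_less_divide_eq add_nonneg_pos)
      then show ?case using elim by (intro small) (auto simp: algebra_simps)
    qed
  qed
  ultimately have "norm (D (Suc (Suc 0)) x [h, v] - D (Suc (Suc 0)) x [v, h]) \<le> ?K * 0"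
    by (intro tendsto_lowerbound[of "\<lambda>t. ?K * t" _ "at_right 0"]) auto
  then show ?thesis by simp
qed

subsection \<open>Parameter integrals and implicit functions\<close>

text \<open>Finitely many balls of half size cover \<open>K\<close>, and the halving lets the
  smallest of their radii work at every point. This provides one radius and one bound along the
  whole path over which \<open>lip_jet_integral\<close> integrates.\<close>

lemma lip_jet_uniform_bound:
  fixes D :: "nat \<Rightarrow> 'a::real_normed_vector \<Rightarrow> 'a list \<Rightarrow> 'b::real_normed_vector"
  assumes J: "lip_jet s s' n S D" and K: "compact K" "K \<subseteq> S"
  shows "\<exists>d>0. \<exists>M\<ge>0. \<forall>x\<in>K. ball x d \<subseteq> S \<and> (\<forall>j\<le>n. \<forall>y\<in>ball x d. \<forall>vs. length vs = j \<longrightarrow>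
        norm (D j y vs) \<le> M * prod_list (map norm vs))"
proof -
  let ?P = "\<lambda>x d M. ball x d \<subseteq> S \<and> (\<forall>j\<le>n. \<forall>y\<in>ball x d. \<forall>vs. length vs = j \<longrightarrow>
        norm (D j y vs) \<le> M * prod_list (map norm vs))"
  have "\<forall>x\<in>K. \<exists>d. d > 0 \<and> (\<exists>M\<ge>0. ?P x d M)"
    using lip_jet_bounded[OF J] K(2) by (simp add: subset_iff)
  from bchoice[OF this] obtain d where d: "\<forall>x\<in>K. d x > 0 \<and> (\<exists>M\<ge>0. ?P x (d x) M)"
    by (elim exE)
  then have "\<forall>x\<in>K. \<exists>M. M \<ge> 0 \<and> ?P x (d x) M" by simp
  from bchoice[OF this] obtain M where M: "\<forall>x\<in>K. M x \<ge> 0 \<and> ?P x (d x) (M x)"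
    by (elim exE)
  have dp: "d x > 0" if "x \<in> K" for x using d that by simp
  have "K \<subseteq> (\<Union>x\<in>K. ball x (d x / 2))" using dp by fastforce
  then obtain C where C: "C \<subseteq> K" "finite C" "K \<subseteq> (\<Union>x\<in>C. ball x (d x / 2))"
    using compactE_image[OF K(1), of K "\<lambda>x. ball x (d x / 2)"] by (metis open_ball)
  define e where "e = Min (insert 1 ((\<lambda>x. d x / 2) ` C))"
  define B where "B = Max (insert 0 (M ` C))"
  have e: "e > 0" unfolding e_def using C dp by (subst Min_gr_iff) auto
  have B: "B \<ge> 0" unfolding B_def using C by (intro Max_ge) auto
  have "?P x e B" if x: "x \<in> K" for x
  proof -
    obtain c where c: "c \<in> C" "x \<in> ball c (d c / 2)" using C x by blast
    have cK: "c \<in> K" using c C by blast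
    have "e \<le> d c / 2" unfolding e_def using C c by (intro Min_le) auto
    have sub: "ball x e \<subseteq> ball c (d c)"
    proof
      fix y assume "y \<in> ball x e"
      then have "dist x y < d c / 2" using \<open>e \<le> d c / 2\<close> by simp
      then show "y \<in> ball c (d c)" using c(2) dist_triangle[of c y x] by simp
    qed
    have Mc: "M c \<le> B" unfolding B_def using C c by (intro Max_ge) auto
    from M cK have *: "?P c (d c) (M c)" by simp
    have "norm (D j y vs) \<le> B * prod_list (map norm vs)" if "j \<le> n" "y \<in> ball x e" "length vs = j" for j y vs
    proof -
      have "norm (D j y vs) \<le> M c * prod_list (map norm vs)"
        using * that sub by (simp add: subset_iff)
      also have "\<dots> \<le> B * prod_list (map norm vs)" by (intro mult_right_mono Mc prod_list_norm_nonneg)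
      finally show ?thesis .
    qed
    then show ?thesis using * sub by (intro conjI) (auto simp: subset_iff)
  qed
  then show ?thesis using e B by (intro exI[of _ e] conjI exI[of _ B] ballI) simp_all
qed

text \<open>Differentiation under the integral sign. The first-order Taylor error of the integrand
  is quadratic in \<open>y - x\<close> uniformly in \<open>t\<close>, hence so is its integral; this
  uses order j + 2, whence the loss of one order. As \<open>\<Lambda> t\<close> does not increase
  norms for \<open>t\<close> in the unit interval, it maps a ball around \<open>x\<close> into the
  ball of the same radius around \<open>\<Lambda> t x\<close>.\<close>

lemma lip_jet_integral:
  fixes D :: "nat \<Rightarrow> 'a::real_normed_vector \<Rightarrow> 'a list \<Rightarrow> 'b::banach" and \<Lambda> :: "real \<Rightarrow> 'a \<Rightarrow> 'a"
  assumes J: "lip_jet s s' (Suc n) S D" and s: "normed_scale s" "normed_scale s'"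
    and lin: "\<And>t. linear (\<Lambda> t)" and le: "\<And>t x. t \<in> {0..1} \<Longrightarrow> norm (\<Lambda> t x) \<le> norm x"
    and diff: "\<And>t x. ((\<lambda>t. \<Lambda> t x) has_derivative d\<Lambda> x) (at t)"
    and hom: "\<And>t c x. \<Lambda> t (s c x) = s c (\<Lambda> t x)"
    and star: "\<And>t x. t \<in> {0..1} \<Longrightarrow> x \<in> S \<Longrightarrow> \<Lambda> t x \<in> S"
    and c: "continuous_on {0..1} (c :: real \<Rightarrow> real)"
  shows "lip_jet s s' n S (\<lambda>j x vs. integral {0..1} (\<lambda>t. c t *\<^sub>R D j (\<Lambda> t x) (map (\<Lambda> t) vs)))"
proof -
  interpret s': normed_scale s' by fact
  define f where "f = (\<lambda>j x vs t. c t *\<^sub>R D j (\<Lambda> t x) (map (\<Lambda> t) vs))"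
  define I where "I = (\<lambda>j x vs. integral {0..1} (f j x vs))"
  have cont: "continuous_on {0..1} (f j x vs)" if j: "j \<le> n" "x \<in> S" "length vs = j" for j x vs
    unfolding f_def
  proof (intro continuous_on_scaleR c continuous_at_imp_continuous_on ballI)
    fix t :: real assume t: "t \<in> {0..1}"
    \<comment> \<open>Continuity in \<open>t\<close> is read off from differentiability along the
      curve \<open>\<Lambda> t x\<close>, with the arguments moving as well.\<close>
    have "((\<lambda>t. D j (\<Lambda> t x) ([] @ map (\<lambda>w. w t) (map (\<lambda>v t. \<Lambda> t v) vs))) has_derivative
       (\<lambda>h. D (Suc j) (\<Lambda> t x) (d\<Lambda> x h # [] @ map (\<lambda>w. w t) (map (\<lambda>v t. \<Lambda> t v) vs))
        + (\<Sum>l<length (map (\<lambda>v t. \<Lambda> t v) vs). D j (\<Lambda> t x) ([] @ (map (\<lambda>w. w t) (map (\<lambda>v t. \<Lambda> t v) vs))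
            [l := frechet_derivative ((map (\<lambda>v t. \<Lambda> t v) vs) ! l) (at t) h])))) (at t)"
    proof (rule jet_eval_deriv[where g="\<lambda>t. \<Lambda> t x" and dw="\<lambda>w. frechet_derivative w (at t)", OF J s star[OF t j(2)]])
      show "(w has_derivative frechet_derivative w (at t)) (at t)" if wm: "w \<in> set (map (\<lambda>v t. \<Lambda> t v) vs)" for w
      proof -
        obtain v where "w = (\<lambda>t. \<Lambda> t v)" using wm by auto
        then show ?thesis using diff[of v t] by (metis frechet_derivative_at)
      qed
    qed (use j diff in auto)
    then show "isCont (\<lambda>t. D j (\<Lambda> t x) (map (\<Lambda> t) vs)) t"
      by (auto dest!: has_derivative_continuous simp: o_def)
  qed
  note int = integrable_continuous_real[OF cont]
  have mlI: "multilin s s' j (I j x)" if j: "j \<le> n" and x: "x \<in> S" for j x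
    unfolding multilin_def
  proof (intro allI impI conjI)
    fix us vs :: "'a list" and a b cc assume l: "length us + 1 + length vs = j"
    have ml: "multilin s s' j (D j (\<Lambda> t x))" if "t \<in> {0..1}" for t
      using lip_jet_multilin[OF J _ star[OF that x]] j by simp
    have "I j x (us @ (a + b) # vs) = integral {0..1} (\<lambda>t. f j x (us @ a # vs) t + f j x (us @ b # vs) t)"
      unfolding I_def
      by (rule integral_cong) (use l in \<open>simp add: f_def linear_add[OF lin] multilin_add[OF ml] scaleR_add_right\<close>)
    also have "\<dots> = I j x (us @ a # vs) + I j x (us @ b # vs)"
      unfolding I_def by (intro integral_add int) (use j x l in auto)
    finally show "I j x (us @ (a + b) # vs) = I j x (us @ a # vs) + I j x (us @ b # vs)" .
    have "I j x (us @ s cc a # vs) = integral {0..1} (s' cc \<circ> f j x (us @ a # vs))"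
      unfolding I_def
      by (rule integral_cong) (use l in \<open>simp add: f_def hom multilin_scale[OF ml] s'.scale_scaleR\<close>)
    also have "\<dots> = s' cc (I j x (us @ a # vs))"
      unfolding I_def by (rule integral_linear[OF int s'.bounded_linear_scale]) (use j x l in auto)
    finally show "I j x (us @ s cc a # vs) = s' cc (I j x (us @ a # vs))" .
  qed
  obtain C where "\<forall>u\<in>c ` {0..1}. norm u \<le> C"
    using compact_imp_bounded[OF compact_continuous_image[OF c compact_Icc]] unfolding bounded_iff by (elim exE)
  then have C: "norm (c t) \<le> C" if "t \<in> {0..1}" for t using that by blast
  have C0: "C \<ge> 0" using order_trans[OF norm_ge_zero C[of 0]] by simp
  have \<Lambda>P: "prod_list (map norm (map (\<Lambda> t) vs)) \<le> prod_list (map norm vs)" if t: "t \<in> {0..1}" for t vs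
    by (rule prod_list_norm_mono) (rule le[OF t])
  have loc: "\<exists>d>0. \<exists>M\<ge>0. ball x d \<subseteq> S \<and> (\<forall>t\<in>{0..1}. ball (\<Lambda> t x) d \<subseteq> S \<and> (\<forall>j\<le>Suc n. \<forall>y\<in>ball (\<Lambda> t x) d. \<forall>vs.
      length vs = j \<longrightarrow> norm (D j y vs) \<le> M * prod_list (map norm vs)))" if x: "x \<in> S" for x
  proof -
    have "continuous_on {0..1} (\<lambda>t. \<Lambda> t x)"
      by (intro continuous_at_imp_continuous_on ballI has_derivative_continuous[OF diff])
    then have K: "compact ((\<lambda>t. \<Lambda> t x) ` {0..1})" by (rule compact_continuous_image[OF _ compact_Icc])
    have KS: "(\<lambda>t. \<Lambda> t x) ` {0..1} \<subseteq> S" using star x by auto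
    obtain d0 where d0: "d0 > 0" "ball x d0 \<subseteq> S" using lip_jet_open[OF J] x open_contains_ball by blast
    from lip_jet_uniform_bound[OF J K KS] obtain d M where d: "d > 0" "M \<ge> 0" and
      M: "\<forall>p\<in>(\<lambda>t. \<Lambda> t x) ` {0..1}. ball p d \<subseteq> S \<and> (\<forall>j\<le>Suc n. \<forall>y\<in>ball p d. \<forall>vs.
        length vs = j \<longrightarrow> norm (D j y vs) \<le> M * prod_list (map norm vs))" by (elim exE conjE)
    have sub: "ball p (min d d0) \<subseteq> ball p d" for p by auto
    show ?thesis
    proof (rule exI[of _ "min d d0"], intro conjI exI[of _ M] ballI)
      show "ball x (min d d0) \<subseteq> S" using d0 by auto
      fix t :: real assume "t \<in> {0..1}"
      then have *: "ball (\<Lambda> t x) d \<subseteq> S \<and> (\<forall>j\<le>Suc n. \<forall>y\<in>ball (\<Lambda> t x) d. \<forall>vs.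
        length vs = j \<longrightarrow> norm (D j y vs) \<le> M * prod_list (map norm vs))" using M by simp
      then show "ball (\<Lambda> t x) (min d d0) \<subseteq> S" using sub by blast
      show "\<forall>j\<le>Suc n. \<forall>y\<in>ball (\<Lambda> t x) (min d d0). \<forall>vs.
        length vs = j \<longrightarrow> norm (D j y vs) \<le> M * prod_list (map norm vs)"
        using * by simp
    qed (use d d0 in auto)
  qed
  have near: "\<Lambda> t y \<in> ball (\<Lambda> t x) d" if "y \<in> ball x d" "t \<in> {0..1}" for t x y d
    using le[OF that(2), of "x - y"] that(1) by (simp add: dist_norm linear_diff[OF lin])
  have bndI: "norm (I j y vs) \<le> C * M * prod_list (map norm vs)"
    if M: "\<forall>t\<in>{0..1}. ball (\<Lambda> t x) d \<subseteq> S \<and> (\<forall>j\<le>Suc n. \<forall>y\<in>ball (\<Lambda> t x) d. \<forall>vs.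
      length vs = j \<longrightarrow> norm (D j y vs) \<le> M * prod_list (map norm vs))"
      and j: "j \<le> n" and y: "y \<in> S" "y \<in> ball x d" and l: "length vs = j" and M0: "M \<ge> 0" for M d x j y vs
  proof -
    have "norm (integral {0..1} (f j y vs)) \<le> (C * M * prod_list (map norm vs)) * (1 - 0)"
    proof (rule integral_bound)
      fix t :: real assume t: "t \<in> {0..1}"
      have "norm (D j (\<Lambda> t y) (map (\<Lambda> t) vs)) \<le> M * prod_list (map norm (map (\<Lambda> t) vs))"
        using M t near[OF y(2) t] j l by (simp del: map_map)
      also have "\<dots> \<le> M * prod_list (map norm vs)" by (intro mult_left_mono \<Lambda>P t M0)
      finally show "norm (f j y vs t) \<le> C * M * prod_list (map norm vs)"
        unfolding f_def norm_scaleR mult.assoc using C[OF t] C0 by (intro mult_mono) auto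
    qed (use cont[OF j y(1) l] in auto)
    then show ?thesis by (simp add: I_def)
  qed
  have "lip_jet s s' n S I"
    unfolding lip_jet_def
  proof (intro conjI allI impI ballI)
    show "open S" by (rule lip_jet_open[OF J])
    show "multilin s s' j (I j x)" if "j \<le> n" "x \<in> S" for j x by (rule mlI[OF that])
    show "\<exists>d>0. \<exists>M. \<forall>y\<in>S \<inter> ball x d. \<forall>vs. length vs = j \<longrightarrow> norm (I j y vs) \<le> M * prod_list (map norm vs)"
      if j: "j \<le> n" and x: "x \<in> S" for j x
    proof -
      from loc[OF x] obtain d M where d: "d > 0" "M \<ge> 0" "ball x d \<subseteq> S" and
        M: "\<forall>t\<in>{0..1}. ball (\<Lambda> t x) d \<subseteq> S \<and> (\<forall>j\<le>Suc n. \<forall>y\<in>ball (\<Lambda> t x) d. \<forall>vs.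
          length vs = j \<longrightarrow> norm (D j y vs) \<le> M * prod_list (map norm vs))" by (elim exE conjE)
      show ?thesis
        using bndI[OF M j _ _ _ d(2)] d(1) by (intro exI[of _ d] conjI exI[of _ "C * M"]) simp_all
    qed
    show "((\<lambda>x. I j x vs) has_derivative (\<lambda>h. I (Suc j) x (h # vs))) (at x)"
      if j: "j < n" and x: "x \<in> S" and l: "length vs = j" for j x vs
    proof -
      from loc[OF x] obtain d M where d: "d > 0" "M \<ge> 0" "ball x d \<subseteq> S" and
        M: "\<forall>t\<in>{0..1}. ball (\<Lambda> t x) d \<subseteq> S \<and> (\<forall>j\<le>Suc n. \<forall>y\<in>ball (\<Lambda> t x) d. \<forall>vs.
          length vs = j \<longrightarrow> norm (D j y vs) \<le> M * prod_list (map norm vs))" by (elim exE conjE)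
      have sj: "Suc j \<le> n" using j by simp
      show ?thesis
      proof (rule has_derivative_quadraticI[OF _ d(1)])
        show "bounded_linear (\<lambda>h. I (Suc j) x (h # vs))"
        proof (rule bounded_linear_intro[where K="C * M * prod_list (map norm vs)"])
          show "I (Suc j) x ((a + b) # vs) = I (Suc j) x (a # vs) + I (Suc j) x (b # vs)" for a b
            using multilin_add[OF mlI[OF sj x], of "[]" vs] l by simp
          show "I (Suc j) x ((r *\<^sub>R a) # vs) = r *\<^sub>R I (Suc j) x (a # vs)" for r a
            using multilin_scaleR[OF mlI[OF sj x] s, of "[]" vs] l by simp
          show "norm (I (Suc j) x (a # vs)) \<le> norm a * (C * M * prod_list (map norm vs))" for a
            using bndI[OF M sj x _ _ d(2), of "a # vs"] l d(1) by (simp add: algebra_simps)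
        qed
        fix y assume y: "y \<in> ball x d"
        then have yS: "y \<in> S" using d(3) by blast
        have "I j y vs - I j x vs - I (Suc j) x ((y - x) # vs)
            = integral {0..1} (\<lambda>t. f j y vs t - f j x vs t - f (Suc j) x ((y - x) # vs) t)"
          unfolding I_def using int[of j y vs] int[of j x vs] int[of "Suc j" x "(y - x) # vs"] j l x yS
          by (simp add: integral_diff integrable_diff)
        also have "norm \<dots> \<le> (C * (M * (norm (y - x))\<^sup>2 * prod_list (map norm vs))) * (1 - 0)"
        proof (rule integral_bound)
          show "continuous_on {0..1} (\<lambda>t. f j y vs t - f j x vs t - f (Suc j) x ((y - x) # vs) t)"
            by (intro continuous_on_diff cont) (use j x yS l in auto)
          fix t :: real assume t: "t \<in> {0..1}"
          have b: "ball (\<Lambda> t x) d \<subseteq> S" using M t by simp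
          have "norm (D j (\<Lambda> t y) (map (\<Lambda> t) vs) - D j (\<Lambda> t x) (map (\<Lambda> t) vs)
                - D (Suc j) (\<Lambda> t x) ((\<Lambda> t y - \<Lambda> t x) # map (\<Lambda> t) vs))
              \<le> M * (norm (\<Lambda> t y - \<Lambda> t x))\<^sup>2 * prod_list (map norm (map (\<Lambda> t) vs))"
          proof (rule lip_jet_quadratic[OF J convex_ball b _ d(2)])
            show "norm (D (Suc (Suc j)) z us) \<le> M * prod_list (map norm us)"
              if "z \<in> ball (\<Lambda> t x) d" "length us = Suc (Suc j)" for z us
              using M t that j by simp
          qed (use j l near[OF y t] d in auto)
          also have "\<dots> \<le> M * (norm (y - x))\<^sup>2 * prod_list (map norm vs)"
          proof (intro mult_mono \<Lambda>P[OF t] power_mono)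
            show "norm (\<Lambda> t y - \<Lambda> t x) \<le> norm (y - x)" using le[OF t, of "y - x"] by (simp add: linear_diff[OF lin])
            show "0 \<le> prod_list (map norm (map (\<Lambda> t) vs))" by (rule prod_list_norm_nonneg)
          qed (use d(2) in auto)
          finally have "norm (D j (\<Lambda> t y) (map (\<Lambda> t) vs) - D j (\<Lambda> t x) (map (\<Lambda> t) vs)
                - D (Suc j) (\<Lambda> t x) (map (\<Lambda> t) ((y - x) # vs)))
              \<le> M * (norm (y - x))\<^sup>2 * prod_list (map norm vs)"
            by (simp add: linear_diff[OF lin])
          then have "norm (c t) * norm (D j (\<Lambda> t y) (map (\<Lambda> t) vs) - D j (\<Lambda> t x) (map (\<Lambda> t) vs)
                - D (Suc j) (\<Lambda> t x) (map (\<Lambda> t) ((y - x) # vs)))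
              \<le> C * (M * (norm (y - x))\<^sup>2 * prod_list (map norm vs))"
            using C[OF t] C0 by (intro mult_mono) auto
          then show "norm (f j y vs t - f j x vs t - f (Suc j) x ((y - x) # vs) t)
              \<le> C * (M * (norm (y - x))\<^sup>2 * prod_list (map norm vs))"
            unfolding f_def scaleR_diff_right[symmetric] norm_scaleR by simp
        qed simp
        finally show "norm (I j y vs - I j x vs - I (Suc j) x ((y - x) # vs))
            \<le> (C * M * prod_list (map norm vs)) * (norm (y - x))\<^sup>2"
          by (simp add: algebra_simps)
      qed
    qed
  qed
  then show ?thesis by (simp add: I_def f_def)
qed

text \<open>The vector obtained by applying the inverse of \<open>I - A\<close> to \<open>w\<close>.
  It is defined as a fixed point for plain functions \<open>A\<close>, so that \<open>A\<close> may
  depend on a parameter through a jet; existence and uniqueness come from contraction in the context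
  that follows.\<close>

definition resolvent :: "('b::banach \<Rightarrow> 'b) \<Rightarrow> 'b \<Rightarrow> 'b" where
  "resolvent A w = (THE v. v = w + A v)"

context
  fixes A :: "'b::banach \<Rightarrow> 'b"
  assumes lin: "linear A" and half: "\<And>v. norm (A v) \<le> norm v / 2"
begin

lemma resolvent_ex1: "\<exists>!v. v = w + A v"
proof -
  have "\<exists>!v. w + A v = v"
  proof (rule banach_fix_type)
    show "\<forall>x y. dist (w + A x) (w + A y) \<le> 1/2 * dist x y"
      using half by (simp add: dist_norm linear_diff[OF lin, symmetric])
  qed auto
  then show ?thesis by metis
qed

lemma resolvent_eq: "resolvent A w = w + A (resolvent A w)"
  unfolding resolvent_def by (rule theI'[OF resolvent_ex1])

lemma resolvent_unique: "v = w + A v \<Longrightarrow> resolvent A w = v"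
  using resolvent_ex1 resolvent_eq by blast

lemma norm_resolvent: "norm (resolvent A w) \<le> 2 * norm w"
  using half[of "resolvent A w"] norm_triangle_ineq[of w "A (resolvent A w)"] resolvent_eq[of w] by simp

lemma bounded_linear_resolvent: "bounded_linear (resolvent A)"
proof (rule bounded_linear_intro[where K=2])
  show "resolvent A (x + y) = resolvent A x + resolvent A y" for x y
    using resolvent_eq[of x] resolvent_eq[of y]
    by (intro resolvent_unique) (simp add: linear_add[OF lin], metis add.assoc add.left_commute)
  show "resolvent A (r *\<^sub>R x) = r *\<^sub>R resolvent A x" for r x
    using resolvent_eq[of x] by (intro resolvent_unique) (metis linear_cmul[OF lin] scaleR_add_right)
  show "norm (resolvent A x) \<le> norm x * 2" for x using norm_resolvent[of x] by simp
qed

lemma resolvent_scale: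
  assumes "normed_scale s" "\<And>c v. A (s c v) = s c (A v)"
  shows "resolvent A (s c w) = s c (resolvent A w)"
proof -
  interpret normed_scale s by fact
  show ?thesis
    using resolvent_eq[of w] by (intro resolvent_unique) (metis assms(2) scale_right_distrib)
qed

end

text \<open>The contraction in the second variable first gives a Lipschitz bound for
  \<open>y\<close> at \<open>p\<close>, which makes the linearization error of \<Theta> small
  relative to \<open>norm (q - p)\<close>. The candidate \<open>J\<close> solves the linearized
  equation, and the smallness of the partial derivative then bounds the deviation of
  \<open>y\<close> from it.\<close>

lemma implicit_derivative:
  fixes y :: "'p::real_normed_vector \<Rightarrow> 'b::banach" and \<Theta> :: "'p \<times> 'b \<Rightarrow> 'b"
  assumes \<Theta>: "(\<Theta> has_derivative \<Theta>') (at (p, y p))"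
    and d: "d > 0" "\<And>q. q \<in> ball p d \<Longrightarrow> y q = \<Theta> (q, y q)"
      "\<And>q. q \<in> ball p d \<Longrightarrow> norm (\<Theta> (q, y q) - \<Theta> (q, y p)) \<le> norm (y q - y p) / 2"
    and J: "bounded_linear J" "\<And>h. J h = \<Theta>' (h, J h)"
    and A: "\<And>v. norm (\<Theta>' (0, v)) \<le> norm v / 2"
  shows "(y has_derivative J) (at p)"
proof -
  have bl: "bounded_linear \<Theta>'" by (rule has_derivative_bounded_linear[OF \<Theta>])
  obtain \<delta> C where \<delta>: "\<delta> > 0" "C \<ge> 0" and C: "\<forall>z\<in>ball (p, y p) \<delta>. norm (\<Theta> z - \<Theta> (p, y p)) \<le> C * norm (z - (p, y p))"
    by (rule has_derivative_lipschitz_at[OF \<Theta>])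
  have yp: "y p = \<Theta> (p, y p)" using d by simp
  have lip: "norm (y q - y p) \<le> 2 * C * norm (q - p)" if q: "q \<in> ball p (min d \<delta>)" for q
  proof -
    have "norm (\<Theta> (q, y p) - \<Theta> (p, y p)) \<le> C * norm ((q, y p) - (p, y p))"
      using q by (intro C[rule_format]) (simp add: dist_Pair_Pair)
    then have 1: "norm (\<Theta> (q, y p) - y p) \<le> C * norm (q - p)" using yp by (simp add: norm_Pair)
    have "y q - y p = (\<Theta> (q, y q) - \<Theta> (q, y p)) + (\<Theta> (q, y p) - y p)"
      using d(2)[of q] q by simp
    then have "norm (y q - y p) \<le> norm (\<Theta> (q, y q) - \<Theta> (q, y p)) + norm (\<Theta> (q, y p) - y p)"
      by (metis norm_triangle_ineq)
    then show ?thesis using 1 d(3)[of q] q by simp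
  qed
  show ?thesis
    unfolding has_derivative_at_alt
  proof (intro conjI J(1) allI impI)
    fix e :: real assume e: "e > 0"
    \<comment> \<open>\<open>2 + 2 * C\<close> dominates the factor \<open>1 + 2 * C\<close> between
      the distance of the graph points and \<open>norm (q - p)\<close>. The further factor 2 pays
      for the half of \<open>norm v\<close> that is absorbed at the end.\<close>
    define e' where "e' = e / (2 * (2 + 2 * C))"
    have e': "e' > 0" using e \<delta>(2) by (simp add: e'_def)
    have "\<forall>e>0. \<exists>d>0. \<forall>z. norm (z - (p, y p)) < d \<longrightarrow>
        norm (\<Theta> z - \<Theta> (p, y p) - \<Theta>' (z - (p, y p))) \<le> e * norm (z - (p, y p))"
      using \<Theta> unfolding has_derivative_at_alt by (rule conjunct2)
    from this[rule_format, OF e'] obtain r where r: "r > 0" "\<forall>z. norm (z - (p, y p)) < r \<longrightarrow>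
        norm (\<Theta> z - \<Theta> (p, y p) - \<Theta>' (z - (p, y p))) \<le> e' * norm (z - (p, y p))" by (elim exE conjE)
    define r' where "r' = min (min d \<delta>) (r / (2 + 2 * C))"
    have r': "r' > 0" using r d \<delta> by (simp add: r'_def)
    have "norm (y q - y p - J (q - p)) \<le> e * norm (q - p)" if q: "norm (q - p) < r'" for q
    proof -
      have qb: "q \<in> ball p (min d \<delta>)" using q by (simp add: r'_def dist_norm norm_minus_commute)
      have "norm ((q, y q) - (p, y p)) \<le> norm (q - p) + norm (y q - y p)"
        by (simp add: norm_Pair sqrt_sum_squares_le_sum)
      also have "\<dots> \<le> (1 + 2 * C) * norm (q - p)" using lip[OF qb] by (simp add: algebra_simps)
      finally have 1: "norm ((q, y q) - (p, y p)) \<le> (1 + 2 * C) * norm (q - p)" .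
      also have "\<dots> \<le> (2 + 2 * C) * norm (q - p)" by (intro mult_right_mono) auto
      also have "\<dots> < r" using q \<delta>(2) by (simp add: r'_def pos_less_divide_eq mult.commute)
      finally have "norm (\<Theta> (q, y q) - \<Theta> (p, y p) - \<Theta>' ((q, y q) - (p, y p))) \<le> e' * norm ((q, y q) - (p, y p))"
        using r(2) by simp
      also have "\<dots> \<le> e' * ((1 + 2 * C) * norm (q - p))" using 1 e' by (intro mult_left_mono) auto
      also have "\<dots> \<le> e' * ((2 + 2 * C) * norm (q - p))" using e' by (intro mult_left_mono mult_right_mono) auto
      also have "\<dots> = e * norm (q - p) / 2" using \<delta>(2) by (simp add: e'_def field_simps)
      finally have 2: "norm (y q - y p - \<Theta>' (q - p, y q - y p)) \<le> e * norm (q - p) / 2"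
        using d(2)[of q] qb yp by simp
      define v where "v = y q - y p - J (q - p)"
      have "\<Theta>' (q - p, y q - y p) - \<Theta>' (q - p, J (q - p)) = \<Theta>' (0, v)"
        by (simp add: v_def linear_diff[OF bounded_linear.linear[OF bl], symmetric])
      then have "v = (y q - y p - \<Theta>' (q - p, y q - y p)) + \<Theta>' (0, v)"
        using J(2)[of "q - p"] by (simp add: v_def algebra_simps)
      then have "norm v \<le> norm (y q - y p - \<Theta>' (q - p, y q - y p)) + norm (\<Theta>' (0, v))"
        by (metis norm_triangle_ineq)
      then show ?thesis using 2 A[of v] by (simp add: v_def)
    qed
    then show "\<exists>d>0. \<forall>q. norm (q - p) < d \<longrightarrow> norm (y q - y p - J (q - p)) \<le> e * norm (q - p)"
      using r' by (intro exI[of _ r'] conjI) simp_all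
  qed
qed

lemma lip_class_Pair:
  fixes s :: "'k::real_normed_field \<Rightarrow> 'a::real_normed_vector \<Rightarrow> 'a"
  assumes S: "open S" and s: "normed_scale s1" "normed_scale s2"
    and f: "lip_class s s1 n S {f}" and g: "lip_class s s2 n S {g}"
  shows "lip_class s (prod_scale s1 s2) n S {\<lambda>x. (f x, g x)}"
proof -
  interpret s1: normed_scale s1 by fact
  interpret s2: normed_scale s2 by fact
  have 1: "lip_class s (prod_scale s1 s2) n S {\<lambda>x. (h x, 0) | h. h \<in> {f}}"
    by (rule lip_class_linear_comp[OF S _ _ f]) (auto simp: prod_scale_def bounded_linear_Pair)
  have 2: "lip_class s (prod_scale s1 s2) n S {\<lambda>x. (0, h x) | h. h \<in> {g}}"
    by (rule lip_class_linear_comp[OF S _ _ g]) (auto simp: prod_scale_def bounded_linear_Pair)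
  show ?thesis
    by (rule lip_class_mono[OF S lip_class_add[OF S normed_scale_prod[OF s] 1 2]]) fastforce
qed

lemma lip_class_ident:
  assumes "open S" "normed_scale s"
  shows "lip_class s s n S {\<lambda>x. x}"
  by (rule lip_class_linear[OF assms bounded_linear_ident]) simp

lemma lip_jet_bounded_linear:
  assumes "lip_jet s s' N T D" "x \<in> T" "length vs < N"
  shows "bounded_linear (\<lambda>h. D (Suc (length vs)) x (h # vs))"
  using has_derivative_bounded_linear[OF lip_jet_deriv[OF assms(1,3,2) refl]] .

section \<open>Smooth dependence of fixed points on a parameter\<close>

context
  fixes sp :: "'k::real_normed_field \<Rightarrow> 'p::real_normed_vector \<Rightarrow> 'p" and sb :: "'k \<Rightarrow> 'b::banach \<Rightarrow> 'b"
    and D :: "nat \<Rightarrow> 'p \<times> 'b \<Rightarrow> ('p \<times> 'b) list \<Rightarrow> 'b" and y :: "'p \<Rightarrow> 'b" and S T N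
  assumes S: "open S" and J: "lip_jet (prod_scale sp sb) sb N T D" and s: "normed_scale sp" "normed_scale sb"
    and yc: "continuous_on S y" and yT: "\<And>p. p \<in> S \<Longrightarrow> (p, y p) \<in> T"
    and half: "\<And>p v. p \<in> S \<Longrightarrow> norm (D (Suc 0) (p, y p) [(0, v)]) \<le> norm v / 2"
    and N: "N > 0"
begin

lemma partial_linear: "p \<in> S \<Longrightarrow> bounded_linear (\<lambda>v. D (Suc 0) (p, y p) [(0, v)])"
proof -
  assume p: "p \<in> S"
  have "bounded_linear (\<lambda>h. D (Suc 0) (p, y p) [h])"
    using lip_jet_bounded_linear[OF J yT[OF p], of "[]"] N by simp
  from bounded_linear_compose[OF this bounded_linear_Pair[OF bounded_linear_zero bounded_linear_ident]]
  show ?thesis .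
qed

lemma partial_scale:
  assumes p: "p \<in> S"
  shows "D (Suc 0) (p, y p) [(0, sb c v)] = sb c (D (Suc 0) (p, y p) [(0, v)])"
proof -
  interpret sp: normed_scale sp by (rule s)
  have m: "multilin (prod_scale sp sb) sb (Suc 0) (D (Suc 0) (p, y p))"
    using lip_jet_multilin[OF J _ yT[OF p]] N by simp
  show ?thesis using multilin_scale[OF m, of "[]" "[]" c "(0, v)"] by (simp add: prod_scale_def)
qed

abbreviation "Rs p \<equiv> resolvent (\<lambda>v. D (Suc 0) (p, y p) [(0, v)])"

lemma Rs_eq:
  assumes p: "p \<in> S"
  shows "Rs p w = w + D (Suc 0) (p, y p) [(0, Rs p w)]"
  by (rule resolvent_eq[OF bounded_linear.linear[OF partial_linear[OF p]] half[OF p]])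

lemma Rs_bounded_linear:
  assumes p: "p \<in> S"
  shows "bounded_linear (Rs p)"
  by (rule bounded_linear_resolvent[OF bounded_linear.linear[OF partial_linear[OF p]] half[OF p]])

lemma Rs_norm:
  assumes p: "p \<in> S"
  shows "norm (Rs p w) \<le> 2 * norm w"
  by (rule norm_resolvent[OF bounded_linear.linear[OF partial_linear[OF p]] half[OF p]])

lemma Rs_scale:
  assumes p: "p \<in> S"
  shows "Rs p (sb c w) = sb c (Rs p w)"
  by (rule resolvent_scale[OF bounded_linear.linear[OF partial_linear[OF p]] half[OF p] s(2) partial_scale[OF p]])

lemma graph_continuous: "continuous_on S (\<lambda>p. (p, y p))"
  by (intro continuous_on_Pair continuous_on_id yc)

lemma graph_class: "lip_class sp sb n S {y} \<Longrightarrow> lip_class sp (prod_scale sp sb) n S {\<lambda>p. (p, y p)}"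
  by (rule lip_class_Pair[OF S s lip_class_ident[OF S s(1)]])

text \<open>\<open>Rs p (w p)\<close> is itself a fixed point, of the map sending \<open>v\<close>
  to \<open>w p + D (Suc 0) (p, y p) [(0, v)]\<close>. Implicit differentiation shows that its
  derivative is \<open>Rs p\<close> applied to the derivative of \<open>w\<close> plus a second
  derivative term containing \<open>Rs p (w p)\<close> again. The induction hypothesis covers both
  this inner occurrence and the outer resolvent.\<close>

lemma lip_class_resolvent:
  "n + 1 \<le> N \<Longrightarrow> lip_class sp sb n S {y} \<Longrightarrow> lip_class sp sb n S W \<Longrightarrow>
    lip_class sp sb n S {\<lambda>p. Rs p (w p) | w. w \<in> W}"
proof (induction n arbitrary: W)
  interpret sb: normed_scale sb by (rule s)
  interpret sp: normed_scale sp by (rule s)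
  let ?X = "prod_scale sp sb"
  have sX: "normed_scale ?X" by (rule normed_scale_prod[OF s])
  have bdd: "loc_bdd S {\<lambda>p. Rs p (w p) | w. w \<in> W}" if "loc_bdd S W" for W
  proof (rule loc_bddI)
    fix x assume "x \<in> S"
    with that obtain d M where 1: "d > 0" "M \<ge> 0" "\<forall>y\<in>S. dist x y < d \<longrightarrow> (\<forall>f\<in>W. norm (f y) \<le> M)"
      by (rule loc_bddE)
    have "norm (Rs p (w p)) \<le> 2 * M" if "p \<in> S" "dist x p < d" "w \<in> W" for p w
      using 1(3) that Rs_norm[OF that(1), of "w p"] by fastforce
    then show "\<exists>d>0. \<exists>M. \<forall>p\<in>S. dist x p < d \<longrightarrow> (\<forall>f\<in>{\<lambda>p. Rs p (w p) | w. w \<in> W}. norm (f p) \<le> M)"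
      using 1(1) by (intro exI[of _ d] conjI exI[of _ "2 * M"]) auto
  qed
  {
    case 0
    then show ?case by (simp add: bdd)
  next
    case (Suc n)
    note yn = lip_class_lower[OF S Suc.prems(2)]
    let ?\<xi> = "\<lambda>p. (p, y p)"
    define E0 where "E0 = {\<lambda>p. Rs p (w p) | w. w \<in> W}"
    \<comment> \<open>Arguments of the second derivative term: derivatives of the graph map, and
      pairs of 0 with some \<open>Rs p (w p)\<close>, whose class at order \<open>n\<close> is
      already known.\<close>
    define W2 where "W2 = (\<lambda>\<rho>. dirs {?\<xi>} \<rho> \<union> {\<lambda>p. (0, e p) | e. e \<in> E0})"
    let ?E = "\<lambda>\<rho>. {\<lambda>p. D (Suc (Suc 0)) (?\<xi> p) (map (\<lambda>w. w p) ws) | ws. set ws \<subseteq> W2 \<rho> \<and> length ws = Suc (Suc 0)}"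
    let ?V = "\<lambda>\<rho>. {\<lambda>p. f p + g p | f g. f \<in> dirs W \<rho> \<and> g \<in> ?E \<rho>}"
    note \<xi>S = graph_class[OF Suc.prems(2)]
    note \<xi>n = graph_class[OF yn]
    have E0: "lip_class sp sb n S E0"
      unfolding E0_def by (rule Suc.IH[OF _ yn lip_class_lower[OF S Suc.prems(3)]]) (use Suc.prems in simp)
    have "lip_class sp ?X n S {\<lambda>p. (0, e p) | e. e \<in> E0}"
      by (rule lip_class_linear_comp[OF S _ _ E0]) (auto simp: prod_scale_def bounded_linear_Pair)
    then have W2: "lip_class sp ?X n S (W2 \<rho>)" for \<rho>
      unfolding W2_def by (intro lip_class_Un lip_class_SucD(3)[OF \<xi>S])
    have E: "lip_class sp sb n S (?E \<rho>)" for \<rho>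
      by (rule lip_class_jet_comp[OF S J sX s(2) yT graph_continuous \<xi>n W2]) (use Suc.prems in auto)
    have V: "lip_class sp sb n S (?V \<rho>)" for \<rho>
      by (rule lip_class_add[OF S s(2) lip_class_SucD(3)[OF Suc.prems(3)] E])
    show ?case
    proof (rule lip_class_SucI[OF S, where H="\<lambda>\<rho>. {\<lambda>p. Rs p (w p) | w. w \<in> ?V \<rho>}"])
      show "loc_bdd S {\<lambda>p. Rs p (w p) | w. w \<in> W}" by (rule bdd[OF lip_class_loc_bdd[OF Suc.prems(3)]])
      show "lip_class sp sb n S {\<lambda>p. Rs p (w p) | w. w \<in> ?V \<rho>}" for \<rho>
        by (rule Suc.IH[OF _ yn V]) (use Suc.prems in simp)
      fix i assume "i \<in> {\<lambda>p. Rs p (w p) | w. w \<in> W}"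
      then obtain w where i: "i = (\<lambda>p. Rs p (w p))" and w: "w \<in> W" by blast
      define w' where "w' = (\<lambda>p. frechet_derivative w (at p))"
      define \<xi>' where "\<xi>' = (\<lambda>p. frechet_derivative ?\<xi> (at p))"
      have dw: "(w has_derivative w' p) (at p)" "w' p (sp c v) = sb c (w' p v)" if "p \<in> S" for p c v
        unfolding w'_def by (rule lip_class_SucD(1)[OF Suc.prems(3) w that] lip_class_SucD(2)[OF Suc.prems(3) w that])+
      have d\<xi>: "(?\<xi> has_derivative \<xi>' p) (at p)" "\<xi>' p (sp c v) = ?X c (\<xi>' p v)" if "p \<in> S" for p c v
        unfolding \<xi>'_def by (rule lip_class_SucD(1)[OF \<xi>S _ that] lip_class_SucD(2)[OF \<xi>S _ that], simp)+
      define u where "u = (\<lambda>p h. w' p h + D (Suc (Suc 0)) (?\<xi> p) [\<xi>' p h, (0, i p)])"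
      have N2: "Suc 0 < N" using Suc.prems by simp
      have bl2: "bounded_linear (\<lambda>h. D (Suc (Suc 0)) (?\<xi> p) [h, (0, i p)])" if "p \<in> S" for p
        using lip_jet_bounded_linear[OF J yT[OF that], of "[(0, i p)]"] N2 by simp
      show "\<exists>d. (\<forall>x\<in>S. (i has_derivative d x) (at x) \<and> (\<forall>c v. d x (sp c v) = sb c (d x v))) \<and>
          (\<forall>\<rho> v. norm v \<le> \<rho> \<longrightarrow> (\<lambda>x. d x v) \<in> {\<lambda>p. Rs p (w p) | w. w \<in> ?V \<rho>})"
      proof (intro exI[of _ "\<lambda>p h. Rs p (u p h)"] conjI ballI allI impI)
        fix p assume p: "p \<in> S"
        obtain d where d: "d > 0" "ball p d \<subseteq> S" using S p open_contains_ball by blast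
        \<comment> \<open>Affine in the second variable, so the hypothesis \<open>half\<close> is
          exactly the contraction required by \<open>implicit_derivative\<close>.\<close>
        define \<Theta> where "\<Theta> = (\<lambda>z. w (fst z) + D (Suc 0) (?\<xi> (fst z)) [(0, snd z)])"
        define \<Theta>' where "\<Theta>' = (\<lambda>h. w' p (fst h) + (D (Suc (Suc 0)) (?\<xi> p) [\<xi>' p (fst h), (0, i p)]
            + D (Suc 0) (?\<xi> p) [(0, snd h)]))"
        have fst': "(fst has_derivative fst) (at z)" and snd': "(snd has_derivative snd) (at z)" for z :: "'p \<times> 'b"
          by (intro bounded_linear_imp_has_derivative bounded_linear_fst bounded_linear_snd)+
        have g': "((\<lambda>z. ?\<xi> (fst z)) has_derivative (\<lambda>h. \<xi>' p (fst h))) (at (p, i p))"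
          using diff_chain_at[OF fst', of ?\<xi> "\<xi>' p" "(p, i p)"] d\<xi>(1)[OF p] by (simp add: o_def)
        have pT: "?\<xi> (fst (p, i p)) \<in> T" using yT[OF p] by simp
        have "((\<lambda>z. D (Suc 0) (?\<xi> (fst z)) ([] @ map (\<lambda>w. w z) [\<lambda>z. (0, snd z)])) has_derivative
            (\<lambda>h. D (Suc (Suc 0)) (?\<xi> (fst (p, i p))) (\<xi>' p (fst h) # [] @ map (\<lambda>w. w (p, i p)) [\<lambda>z. (0, snd z)])
              + (\<Sum>l<length [\<lambda>z::'p \<times> 'b. (0::'p, snd z)]. D (Suc 0) (?\<xi> (fst (p, i p)))
                  ([] @ (map (\<lambda>w. w (p, i p)) [\<lambda>z. (0, snd z)])[l := (0, snd h)])))) (at (p, i p))"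
          by (rule jet_eval_deriv[where g="\<lambda>z. ?\<xi> (fst z)" and dw="\<lambda>w h. (0, snd h)", OF J sX s(2) pT N2 g'])
             (auto intro!: has_derivative_Pair snd')
        then have "((\<lambda>z. D (Suc 0) (?\<xi> (fst z)) [(0, snd z)]) has_derivative
            (\<lambda>h. D (Suc (Suc 0)) (?\<xi> p) [\<xi>' p (fst h), (0, i p)] + D (Suc 0) (?\<xi> p) [(0, snd h)])) (at (p, i p))"
          by simp
        moreover have "((\<lambda>z. w (fst z)) has_derivative (\<lambda>h. w' p (fst h))) (at (p, i p))"
          using diff_chain_at[OF fst', of w "w' p" "(p, i p)"] dw(1)[OF p] by (simp add: o_def)
        ultimately have D\<Theta>: "(\<Theta> has_derivative \<Theta>') (at (p, i p))"
          unfolding \<Theta>_def \<Theta>'_def by (intro has_derivative_add)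
        show "(i has_derivative (\<lambda>h. Rs p (u p h))) (at p)"
        proof (rule implicit_derivative[where y=i, OF D\<Theta> d(1)])
          fix q assume q: "q \<in> ball p d"
          then have qS: "q \<in> S" using d by blast
          show "i q = \<Theta> (q, i q)" unfolding i \<Theta>_def fst_conv snd_conv by (rule Rs_eq[OF qS])
          have "\<Theta> (q, i q) - \<Theta> (q, i p) = D (Suc 0) (?\<xi> q) [(0, i q - i p)]"
            by (simp add: \<Theta>_def linear_diff[OF bounded_linear.linear[OF partial_linear[OF qS]]])
          then show "norm (\<Theta> (q, i q) - \<Theta> (q, i p)) \<le> norm (i q - i p) / 2"
            using half[OF qS] by simp
        next
          have "bounded_linear (u p)"
            unfolding u_def
            by (intro bounded_linear_add has_derivative_bounded_linear[OF dw(1)[OF p]]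
                bounded_linear_compose[OF bl2[OF p] has_derivative_bounded_linear[OF d\<xi>(1)[OF p]]])
          from bounded_linear_compose[OF Rs_bounded_linear[OF p] this]
          show "bounded_linear (\<lambda>h. Rs p (u p h))" .
          show "Rs p (u p h) = \<Theta>' (h, Rs p (u p h))" for h
          proof (rule trans[OF Rs_eq[OF p]])
            show "u p h + D (Suc 0) (?\<xi> p) [(0, Rs p (u p h))] = \<Theta>' (h, Rs p (u p h))"
              unfolding \<Theta>'_def fst_conv snd_conv by (simp only: u_def add.assoc)
          qed
          have "w' p 0 = 0" "\<xi>' p 0 = 0"
            by (intro linear_0 has_derivative_linear[OF dw(1)[OF p]] has_derivative_linear[OF d\<xi>(1)[OF p]])+
          moreover have "D (Suc (Suc 0)) (?\<xi> p) [0, (0, i p)] = 0"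
            using linear_0[OF bounded_linear.linear[OF bl2[OF p]]] .
          ultimately show "norm (\<Theta>' (0, v)) \<le> norm v / 2" for v
            using half[OF p, of v] by (simp add: \<Theta>'_def)
        qed
        fix c v
        have "multilin ?X sb (Suc (Suc 0)) (D (Suc (Suc 0)) (?\<xi> p))"
          using lip_jet_multilin[OF J _ yT[OF p]] N2 by simp
        from multilin_scale[OF this, of "[]" "[(0, i p)]"]
        have "u p (sp c v) = sb c (u p v)"
          by (simp add: u_def dw(2)[OF p] d\<xi>(2)[OF p] sb.scale_right_distrib)
        then show "Rs p (u p (sp c v)) = sb c (Rs p (u p v))" by (simp add: Rs_scale[OF p])
      next
        fix \<rho> and v :: 'p assume v: "norm v \<le> \<rho>"
        have i0: "(\<lambda>p. (0, i p)) \<in> W2 \<rho>"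
          unfolding W2_def by (rule UnI2) (use i w in \<open>auto simp: E0_def\<close>)
        have "(\<lambda>p. \<xi>' p v) \<in> W2 \<rho>"
          unfolding W2_def \<xi>'_def by (rule UnI1, rule dirsI[OF _ v]) simp
        then have "(\<lambda>p. D (Suc (Suc 0)) (?\<xi> p) (map (\<lambda>w. w p) [\<lambda>p. \<xi>' p v, \<lambda>p. (0, i p)])) \<in> ?E \<rho>"
          using i0 by (intro CollectI exI[of _ "[\<lambda>p. \<xi>' p v, \<lambda>p. (0, i p)]"] conjI refl) auto
        then have "(\<lambda>p. D (Suc (Suc 0)) (?\<xi> p) [\<xi>' p v, (0, i p)]) \<in> ?E \<rho>" by (simp only: list.map)
        moreover have "(\<lambda>p. w' p v) \<in> dirs W \<rho>" unfolding w'_def by (rule dirsI[OF w v])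
        ultimately have m: "(\<lambda>p. u p v) \<in> ?V \<rho>" unfolding u_def by (intro plus_memI)
        show "(\<lambda>p. Rs p (u p v)) \<in> {\<lambda>p. Rs p (w p) | w. w \<in> ?V \<rho>}"
          by (rule CollectI, rule exI[of _ "\<lambda>p. u p v"], rule conjI, rule refl, rule m)
      qed
    qed
  }
qed

text \<open>Bootstrapping: the derivative of \<open>y\<close> is \<open>Rs p\<close> applied to the
  partial derivative in the parameter, an expression in \<open>p\<close> and \<open>y p\<close>
  only. If \<open>y\<close> has order \<open>n\<close>, so has this derivative, and hence
  \<open>y\<close> has order \<open>n + 1\<close>. Continuity of \<open>y\<close> starts the
  induction.\<close>

theorem lip_class_implicit:
  assumes fp: "\<And>p. p \<in> S \<Longrightarrow> y p = D 0 (p, y p) []"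
    and contr: "\<And>p q. p \<in> S \<Longrightarrow> q \<in> S \<Longrightarrow> norm (D 0 (q, y q) [] - D 0 (q, y p) []) \<le> norm (y q - y p) / 2"
  shows "n \<le> N \<Longrightarrow> lip_class sp sb n S {y}"
proof (induction n)
  case 0
  show ?case using loc_bdd_singleton[OF yc] by simp
next
  case (Suc n)
  let ?X = "prod_scale sp sb" and ?\<xi> = "\<lambda>p. (p, y p)"
  interpret sb: normed_scale sb by (rule s)
  have sX: "normed_scale ?X" by (rule normed_scale_prod[OF s])
  have yn: "lip_class sp sb n S {y}" using Suc by simp
  let ?W = "\<lambda>\<rho>. {\<lambda>_::'p. v | v. norm v \<le> \<rho>} :: ('p \<Rightarrow> 'p \<times> 'b) set"
  let ?E = "\<lambda>\<rho>. {\<lambda>p. D (Suc 0) (?\<xi> p) (map (\<lambda>w. w p) ws) | ws. set ws \<subseteq> ?W \<rho> \<and> length ws = Suc 0}"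
  have E: "lip_class sp sb n S (?E \<rho>)" for \<rho>
  proof (rule lip_class_jet_comp[where g="?\<xi>" and i="Suc 0" and W="?W \<rho>", OF S J sX s(2) yT graph_continuous graph_class[OF yn]])
    show "lip_class sp ?X n S (?W \<rho>)" by (rule lip_class_const[OF S sX])
    show "Suc 0 + n \<le> N" using Suc.prems by simp
  qed
  show ?case
  proof (rule lip_class_SucI[OF S loc_bdd_singleton[OF yc]])
    show "lip_class sp sb n S {\<lambda>p. Rs p (w p) | w. w \<in> ?E \<rho>}" for \<rho>
      by (rule lip_class_resolvent[OF _ yn E]) (use Suc.prems in simp)
    fix f assume "f \<in> {y}"
    then have f: "f = y" by simp
    show "\<exists>d. (\<forall>x\<in>S. (f has_derivative d x) (at x) \<and> (\<forall>c v. d x (sp c v) = sb c (d x v))) \<and>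
          (\<forall>\<rho> v. norm v \<le> \<rho> \<longrightarrow> (\<lambda>x. d x v) \<in> {\<lambda>p. Rs p (w p) | w. w \<in> ?E \<rho>})"
      unfolding f
    proof (intro exI[of _ "\<lambda>p h. Rs p (D (Suc 0) (?\<xi> p) [(h, 0)])"] conjI ballI allI impI)
      fix p assume p: "p \<in> S"
      obtain d where d: "d > 0" "ball p d \<subseteq> S" using S p open_contains_ball by blast
      have bl: "bounded_linear (\<lambda>h. D (Suc 0) (?\<xi> p) [h])"
        using lip_jet_bounded_linear[OF J yT[OF p], of "[]"] N by simp
      show "(y has_derivative (\<lambda>h. Rs p (D (Suc 0) (?\<xi> p) [(h, 0)]))) (at p)"
      proof (rule implicit_derivative[where \<Theta>="\<lambda>z. D 0 z []" and \<Theta>'="\<lambda>h. D (Suc 0) (?\<xi> p) [h]", OF _ d(1)])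
        show "((\<lambda>z. D 0 z []) has_derivative (\<lambda>h. D (Suc 0) (?\<xi> p) [h])) (at (p, y p))"
          using lip_jet_deriv[OF J N yT[OF p], of "[]"] by simp
        show "y q = D 0 (q, y q) []" if "q \<in> ball p d" for q using fp d that by blast
        show "norm (D 0 (q, y q) [] - D 0 (q, y p) []) \<le> norm (y q - y p) / 2" if "q \<in> ball p d" for q
          using contr p d that by blast
        have "bounded_linear (\<lambda>h. D (Suc 0) (?\<xi> p) [(h, 0)])"
          by (rule bounded_linear_compose[OF bl bounded_linear_Pair[OF bounded_linear_ident bounded_linear_zero]])
        from bounded_linear_compose[OF Rs_bounded_linear[OF p] this]
        show "bounded_linear (\<lambda>h. Rs p (D (Suc 0) (?\<xi> p) [(h, 0)]))" .
        show "Rs p (D (Suc 0) (?\<xi> p) [(h, 0)]) = D (Suc 0) (?\<xi> p) [(h, Rs p (D (Suc 0) (?\<xi> p) [(h, 0)]))]" for h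
        proof (rule trans[OF Rs_eq[OF p]])
          show "D (Suc 0) (?\<xi> p) [(h, 0)] + D (Suc 0) (?\<xi> p) [(0, w)] = D (Suc 0) (?\<xi> p) [(h, w)]" for w
            using linear_add[OF bounded_linear.linear[OF bl], of "(h, 0)" "(0, w)"] by simp
        qed
        show "norm (D (Suc 0) (?\<xi> p) [(0, v)]) \<le> norm v / 2" for v by (rule half[OF p])
      qed
      fix c v
      interpret sp: normed_scale sp by (rule s)
      have "multilin ?X sb (Suc 0) (D (Suc 0) (?\<xi> p))" using lip_jet_multilin[OF J _ yT[OF p]] N by simp
      from multilin_scale[OF this, of "[]" "[]" c "(v, 0)"]
      have "D (Suc 0) (?\<xi> p) [(sp c v, 0)] = sb c (D (Suc 0) (?\<xi> p) [(v, 0)])" by (simp add: prod_scale_def)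
      then show "Rs p (D (Suc 0) (?\<xi> p) [(sp c v, 0)]) = sb c (Rs p (D (Suc 0) (?\<xi> p) [(v, 0)]))"
        by (simp add: Rs_scale[OF p])
    next
      fix \<rho> and v :: 'p assume v: "norm v \<le> \<rho>"
      have "(\<lambda>_. (v, 0)) \<in> ?W \<rho>" using v by (intro CollectI exI[of _ "(v, 0)"]) (simp add: norm_Pair)
      then have "(\<lambda>p. D (Suc 0) (?\<xi> p) (map (\<lambda>w. w p) [\<lambda>_. (v, 0)])) \<in> ?E \<rho>"
        by (intro CollectI exI[of _ "[\<lambda>_. (v, 0)]"] conjI refl) simp_all
      then have m: "(\<lambda>p. D (Suc 0) (?\<xi> p) [(v, 0)]) \<in> ?E \<rho>" by (simp only: list.map)
      show "(\<lambda>p. Rs p (D (Suc 0) (?\<xi> p) [(v, 0)])) \<in> {\<lambda>p. Rs p (w p) | w. w \<in> ?E \<rho>}"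
        by (rule CollectI, rule exI[of _ "\<lambda>p. D (Suc 0) (?\<xi> p) [(v, 0)]"], rule conjI, rule refl, rule m)
    qed
  qed
qed

end

subsection \<open>Bounded projections of direct sums\<close>

lemma direct_sum_component:
  fixes s :: "'k::field \<Rightarrow> 'a::ab_group_add \<Rightarrow> 'a" and x :: 'a
  assumes ds: "direct_sum s I M"
  shows component_eqI: "\<And>f. (\<And>i. i \<in> I \<Longrightarrow> f i \<in> M i) \<Longrightarrow> x = (\<Sum>i\<in>I. f i) \<Longrightarrow> i \<in> I \<Longrightarrow> component I M i x = f i"
    and component_mem: "i \<in> I \<Longrightarrow> component I M i x \<in> M i"
    and sum_component: "(\<Sum>i\<in>I. component I M i x) = x"
proof -
  have ex1: "\<exists>!f. f \<in> (\<Pi>\<^sub>E i\<in>I. M i) \<and> x = (\<Sum>i\<in>I. f i)" for x :: 'a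
    using ds unfolding direct_sum_def by blast
  note th = theI'[OF ex1]
  show "component I M i x = f i" if f: "\<And>i. i \<in> I \<Longrightarrow> f i \<in> M i" "x = (\<Sum>i\<in>I. f i)" and i: "i \<in> I" for f i
  proof -
    have "restrict f I \<in> (\<Pi>\<^sub>E i\<in>I. M i) \<and> x = (\<Sum>i\<in>I. restrict f I i)"
      using f by auto
    then have "(THE f. f \<in> (\<Pi>\<^sub>E i\<in>I. M i) \<and> x = (\<Sum>i\<in>I. f i)) = restrict f I"
      using ex1[of x] th[of x] by blast
    then show ?thesis unfolding component_def using i by simp
  qed
  show "component I M i x \<in> M i" if "i \<in> I"
    unfolding component_def using th[of x] that by blast
  show "(\<Sum>i\<in>I. component I M i x) = x"
    unfolding component_def using th[of x] by simp
qed

lemma component_linear: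
  fixes s :: "'k::field \<Rightarrow> 'a::ab_group_add \<Rightarrow> 'a"
  assumes ds: "direct_sum s I M" and vs: "vector_space s" and i: "i \<in> I"
  shows component_add: "component I M i (x + y) = component I M i x + component I M i y"
    and component_scale: "component I M i (s c x) = s c (component I M i x)"
    and component_same: "finite I \<Longrightarrow> x \<in> M i \<Longrightarrow> component I M i x = x"
proof -
  interpret vector_space s by fact
  have sub: "subspace (M i)" if "i \<in> I" for i using ds that unfolding direct_sum_def by blast
  show "component I M i (x + y) = component I M i x + component I M i y"
    by (rule component_eqI[OF ds _ _ i])
       (auto intro: subspace_add[OF sub] component_mem[OF ds] simp: sum.distrib sum_component[OF ds])
  show "component I M i (s c x) = s c (component I M i x)"
    by (rule component_eqI[OF ds _ _ i])
       (auto intro: subspace_scale[OF sub] component_mem[OF ds] simp: sum_component[OF ds] simp flip: scale_sum_right)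
  have *: "component I M j x = (if j = i then x else 0)" if "finite I" "x \<in> M i" "j \<in> I" for j
    by (rule component_eqI[OF ds _ _ that(3)]) (use that i in \<open>auto intro: subspace_0[OF sub]\<close>)
  show "component I M i x = x" if "finite I" "x \<in> M i" using *[OF that i] by simp
qed

text \<open>The open mapping argument for the addition map of the summands: by Baire's theorem the
  vectors that are approximated by sums of summands of bounded norm fill a ball, and the
  approximation errors are then removed by iteration.\<close>

lemma direct_sum_bounded:
  fixes s :: "'k::real_normed_field \<Rightarrow> 'a::banach \<Rightarrow> 'a"
  assumes s: "normed_scale s" and I: "finite I" and ds: "direct_sum s I M"
    and cl: "\<And>i. i \<in> I \<Longrightarrow> closed (M i)"
  shows "\<exists>K. \<forall>x. \<forall>i\<in>I. norm (component I M i x) \<le> K * norm x"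
proof -
  interpret normed_scale s by fact
  have sub: "subspace (M i)" if "i \<in> I" for i using ds that unfolding direct_sum_def by blast
  have subR: "r *\<^sub>R v \<in> M i" if "i \<in> I" "v \<in> M i" for i v r
    using subspace_scale[OF sub[OF that(1)] that(2), of "of_real r"] by (simp add: scale_of_real)
  define A where "A = (\<lambda>m::nat. {\<Sum>i\<in>I. f i | f. \<forall>i\<in>I. f i \<in> M i \<and> norm (f i) \<le> real m})"
  have "\<exists>m. interior (closure (A m)) \<noteq> {}"
  proof (rule ccontr)
    assume "\<nexists>m. interior (closure (A m)) \<noteq> {}"
    then have "euclidean interior_of \<Union>(range (\<lambda>m. closure (A m))) = {}"
      by (intro Baire_category_alt) (auto simp: completely_metrizable_space_euclidean)
    moreover have "x \<in> \<Union>(range (\<lambda>m. closure (A m)))" for x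
    proof -
      obtain m :: nat where m: "(\<Sum>i\<in>I. norm (component I M i x)) \<le> real m"
        using real_arch_simple by blast
      have "norm (component I M i x) \<le> real m" if "i \<in> I" for i
        using m member_le_sum[of i I "\<lambda>i. norm (component I M i x)"] that I by simp
      then have "x \<in> A m"
        unfolding A_def
        by (intro CollectI exI[of _ "\<lambda>i. component I M i x"])
           (simp add: sum_component[OF ds] component_mem[OF ds])
      then show ?thesis using closure_subset by blast
    qed
    then have "\<Union>(range (\<lambda>m. closure (A m))) = UNIV" by blast
    ultimately show False by (simp add: euclidean_interior_of)
  qed
  then obtain m x0 r where r: "r > 0" and b: "ball x0 r \<subseteq> closure (A m)"
    by (metis ex_in_conv mem_interior)
  \<comment> \<open>The components of a difference of two members of \<open>A m\<close> are at most
    \<open>2 * real m\<close>; dividing by the scaling factor \<open>t = r / (2 * norm y)\<close>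
    below gives \<open>4 * real m / r\<close> per unit of \<open>norm y\<close>.\<close>
  define K where "K = 4 * real m / r"
  have K0: "K \<ge> 0" using r by (simp add: K_def)
  have approx: "\<exists>f. (\<forall>i\<in>I. f i \<in> M i \<and> norm (f i) \<le> K * norm y) \<and> norm (y - (\<Sum>i\<in>I. f i)) < e"
    if e: "e > 0" for y e
  proof (cases "y = 0")
    case True
    then show ?thesis using e by (intro exI[of _ "\<lambda>_. 0"]) (simp add: subspace_0[OF sub])
  next
    case False
    \<comment> \<open>Scales \<open>y\<close> to length \<open>r / 2\<close>, so that adding it to
      \<open>x0\<close> stays within the ball. Subtracting an approximation of the centre
      \<open>x0\<close> removes the centre again.\<close>
    define t where "t = r / (2 * norm y)"
    have t: "t > 0" using r False by (simp add: t_def)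
    have near: "\<exists>a\<in>A m. dist a z < t * e / 2" if "z \<in> ball x0 r" for z
    proof -
      have "z \<in> closure (A m)" "t * e / 2 > 0" using b that t e by auto
      then show ?thesis unfolding closure_approachable by blast
    qed
    have "x0 + t *\<^sub>R y \<in> ball x0 r" using r False by (simp add: dist_norm t_def)
    with near obtain a where a: "a \<in> A m" "dist a (x0 + t *\<^sub>R y) < t * e / 2" by blast
    obtain a' where a': "a' \<in> A m" "dist a' x0 < t * e / 2" using near[of x0] r by auto
    obtain f where f: "a = (\<Sum>i\<in>I. f i)" "\<forall>i\<in>I. f i \<in> M i \<and> norm (f i) \<le> real m"
      using a(1) unfolding A_def by blast
    obtain f' where f': "a' = (\<Sum>i\<in>I. f' i)" "\<forall>i\<in>I. f' i \<in> M i \<and> norm (f' i) \<le> real m"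
      using a'(1) unfolding A_def by blast
    define h where "h = (\<lambda>i. (1 / t) *\<^sub>R (f i - f' i))"
    have "h i \<in> M i \<and> norm (h i) \<le> K * norm y" if i: "i \<in> I" for i
    proof
      show "h i \<in> M i" unfolding h_def using f f' i by (intro subR subspace_diff[OF sub]) auto
      have "norm (f i - f' i) \<le> 2 * real m"
        using norm_triangle_ineq4[of "f i" "f' i"] f f' i by fastforce
      then have "norm (h i) \<le> (1 / t) * (2 * real m)"
        using t by (simp add: h_def divide_right_mono)
      also have "\<dots> = K * norm y" using r False by (simp add: t_def K_def field_simps)
      finally show "norm (h i) \<le> K * norm y" .
    qed
    moreover have "norm (y - (\<Sum>i\<in>I. h i)) < e"
    proof -
      have "(\<Sum>i\<in>I. h i) = (1 / t) *\<^sub>R (a - a')"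
        by (simp add: h_def f f' sum_subtractf flip: scaleR_sum_right)
      then have "y - (\<Sum>i\<in>I. h i) = (1 / t) *\<^sub>R ((x0 + t *\<^sub>R y - a) - (x0 - a'))"
        using t by (simp add: algebra_simps)
      moreover have "norm ((x0 + t *\<^sub>R y - a) - (x0 - a')) < t * e"
        using norm_triangle_ineq4[of "x0 + t *\<^sub>R y - a" "x0 - a'"] a(2) a'(2)
        by (simp add: dist_norm norm_minus_commute)
      ultimately show ?thesis using t by (simp add: pos_divide_less_eq mult.commute)
    qed
    ultimately show ?thesis by blast
  qed
  have "\<forall>p. \<exists>f. snd p > 0 \<longrightarrow> (\<forall>i\<in>I. f i \<in> M i \<and> norm (f i) \<le> K * norm (fst p)) \<and> norm (fst p - (\<Sum>i\<in>I. f i)) < snd p"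
    using approx by blast
  from choice[OF this] obtain F where F: "\<And>y e. e > 0 \<Longrightarrow>
      (\<forall>i\<in>I. F (y, e) i \<in> M i \<and> norm (F (y, e) i) \<le> K * norm y) \<and> norm (y - (\<Sum>i\<in>I. F (y, e) i)) < e"
    by auto
  have "norm (component I M i x) \<le> 2 * K * norm x" if i: "i \<in> I" for i x
  proof (cases "x = 0")
    case True
    have "component I M i 0 = 0"
      by (rule component_eqI[OF ds _ _ i]) (auto intro: subspace_0[OF sub])
    with True show ?thesis by simp
  next
    case False
    define e where "e = (\<lambda>n::nat. norm x / 2 ^ Suc n)"
    have e: "e n > 0" for n using False by (simp add: e_def)
    \<comment> \<open>Residuals after successive corrections. As the errors \<open>e n\<close>
      halve, the corrections are dominated by a geometric series, whose sum turns \<open>K\<close>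
      into \<open>2 * K\<close>.\<close>
    define Y where "Y = rec_nat x (\<lambda>n y. y - (\<Sum>i\<in>I. F (y, e n) i))"
    have Y0: "Y 0 = x" and YS: "Y (Suc n) = Y n - (\<Sum>i\<in>I. F (Y n, e n) i)" for n
      by (simp_all add: Y_def)
    have Yn: "norm (Y n) \<le> norm x / 2 ^ n" for n
    proof (cases n)
      case (Suc k)
      then show ?thesis using F[OF e[of k], of "Y k"] by (simp add: YS e_def less_imp_le)
    qed (simp add: Y0)
    define g where "g = (\<lambda>n i. F (Y n, e n) i)"
    have gM: "g n i \<in> M i" if "i \<in> I" for n i using F[OF e[of n], of "Y n"] that by (simp add: g_def)
    have gn: "norm (g n i) \<le> K * norm x * (1 / 2) ^ n" if "i \<in> I" for n i
    proof -
      have "norm (g n i) \<le> K * norm (Y n)" using F[OF e[of n], of "Y n"] that by (simp add: g_def)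
      also have "\<dots> \<le> K * (norm x / 2 ^ n)" by (intro mult_left_mono Yn K0)
      finally show ?thesis by (simp add: power_one_over divide_simps)
    qed
    have geo: "summable (\<lambda>n. K * norm x * (1 / 2 :: real) ^ n)"
      by (intro summable_mult summable_geometric) simp
    have summ: "summable (\<lambda>n. g n i)" if "i \<in> I" for i
      by (rule summable_comparison_test'[OF geo]) (rule gn[OF that])
    have part: "(\<Sum>n<N. \<Sum>i\<in>I. g n i) = x - Y N" for N
      by (induction N) (simp_all add: Y0 YS g_def)
    have "(\<lambda>N. x - Y N) \<longlonglongrightarrow> (\<Sum>i\<in>I. \<Sum>n. g n i)"
    proof -
      have "(\<lambda>N. \<Sum>i\<in>I. \<Sum>n<N. g n i) \<longlonglongrightarrow> (\<Sum>i\<in>I. \<Sum>n. g n i)"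
        by (intro tendsto_sum summable_LIMSEQ summ)
      moreover have "(\<Sum>i\<in>I. \<Sum>n<N. g n i) = x - Y N" for N
        using part[of N] by (simp add: sum.swap[of _ I])
      ultimately show ?thesis by simp
    qed
    moreover have "(\<lambda>N. x - Y N) \<longlonglongrightarrow> x - 0"
    proof (intro tendsto_diff tendsto_const Lim_null_comparison[of Y "\<lambda>N. norm x * (1 / 2) ^ N"])
      show "\<forall>\<^sub>F n in sequentially. norm (Y n) \<le> norm x * (1 / 2) ^ n"
        using Yn by (simp add: power_one_over divide_simps)
      show "(\<lambda>N. norm x * (1 / 2) ^ N) \<longlonglongrightarrow> 0"
        by (intro tendsto_mult_right_zero LIMSEQ_power_zero) simp
    qed
    ultimately have xs: "x = (\<Sum>i\<in>I. \<Sum>n. g n i)" using LIMSEQ_unique by fastforce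
    \<comment> \<open>Here closedness of the summands enters: the corrections are summed within each
      summand separately.\<close>
    have mem: "(\<Sum>n. g n i) \<in> M i" if "i \<in> I" for i
    proof (rule closed_sequentially[OF cl[OF that] _ summable_LIMSEQ[OF summ[OF that]]])
      show "(\<Sum>n<N. g n i) \<in> M i" for N
        by (intro subspace_sum[OF sub[OF that]] gM that)
    qed
    have "component I M i x = (\<Sum>n. g n i)"
      by (rule component_eqI[OF ds mem xs i])
    also have "norm \<dots> \<le> (\<Sum>n. K * norm x * (1 / 2) ^ n)"
      by (rule norm_suminf_le[OF gn[OF i] geo])
    also have "\<dots> = 2 * K * norm x"
      using suminf_mult[OF summable_geometric[of "1/2::real"], of "K * norm x"] suminf_geometric[of "1/2::real"] by simp
    finally show ?thesis .
  qed
  then show ?thesis by (intro exI[of _ "2 * K"]) simp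
qed

lemma component_bounded_linear:
  fixes s :: "'k::real_normed_field \<Rightarrow> 'a::banach \<Rightarrow> 'a"
  assumes s: "normed_scale s" and I: "finite I" and ds: "direct_sum s I M"
    and cl: "\<And>i. i \<in> I \<Longrightarrow> closed (M i)" and i: "i \<in> I"
  shows "bounded_linear (component I M i)"
proof -
  interpret normed_scale s by fact
  have vs: "vector_space s" by unfold_locales
  obtain K where K: "\<forall>x. \<forall>i\<in>I. norm (component I M i x) \<le> K * norm x"
    using direct_sum_bounded[OF s I ds cl] by blast
  show ?thesis
  proof (rule bounded_linear_intro[where K=K])
    show "component I M i (x + y) = component I M i x + component I M i y" for x y
      by (rule component_add[OF ds vs i])
    show "component I M i (r *\<^sub>R x) = r *\<^sub>R component I M i x" for r x
      using component_scale[OF ds vs i, of "of_real r" x] by (simp add: scale_of_real)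
    show "norm (component I M i x) \<le> norm x * K" for x using K i by (simp add: mult.commute)
  qed
qed

section \<open>Rules for single functions, and auxiliary facts about jets, polynomials and
  inverses\<close>

lemma lip_class_add1:
  assumes "open S" "normed_scale s'" "lip_class s s' n S {f}" "lip_class s s' n S {g}"
  shows "lip_class s s' n S {\<lambda>x. f x + g x}"
  by (rule lip_class_mono[OF assms(1) lip_class_add[OF assms]]) fastforce

lemma lip_class_linear_comp1:
  fixes s :: "'k::real_normed_field \<Rightarrow> 'a::real_normed_vector \<Rightarrow> 'a" and s' :: "'k \<Rightarrow> 'b::real_normed_vector \<Rightarrow> 'b"
    and s1 :: "'k \<Rightarrow> 'c::real_normed_vector \<Rightarrow> 'c"
  assumes "open S" "bounded_linear A" "\<And>c v. A (s1 c v) = s' c (A v)" "lip_class s s1 n S {f}"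
  shows "lip_class s s' n S {\<lambda>x. A (f x)}"
  by (rule lip_class_mono[OF assms(1) lip_class_linear_comp[OF assms]]) fastforce

lemma lip_class_scale1:
  assumes "open S" "normed_scale s'" "lip_class s (*) n S {f}" "lip_class s s' n S {g}"
  shows "lip_class s s' n S {\<lambda>x. s' (f x) (g x)}"
  by (rule lip_class_mono[OF assms(1) lip_class_scale[OF assms]]) fastforce

lemma lip_class_const1:
  assumes "open S" "normed_scale s'"
  shows "lip_class s s' n S {\<lambda>_. v}"
  by (rule lip_class_mono[OF assms(1) lip_class_const[OF assms, of s n "norm v"]]) fastforce

lemma lip_class_sum1:
  assumes "open S" "normed_scale s'" "finite I" "\<And>i. i \<in> I \<Longrightarrow> lip_class s s' n S {f i}"
  shows "lip_class s s' n S {\<lambda>x. \<Sum>i\<in>I. f i x}"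
  using assms(3,4)
proof (induction I rule: finite_induct)
  case empty
  show ?case using lip_class_const1[OF assms(1,2), of s n 0] by simp
next
  case (insert i I)
  have "lip_class s s' n S {\<lambda>x. f i x + (\<Sum>i\<in>I. f i x)}"
    by (rule lip_class_add1[OF assms(1,2)]) (use insert in simp_all)
  then show ?case using insert by simp
qed

lemma lip_class_power:
  fixes s :: "'k::real_normed_field \<Rightarrow> 'a::real_normed_vector \<Rightarrow> 'a"
  assumes S: "open S" and f: "lip_class s (*) n S {f}"
  shows "lip_class s (*) n S {\<lambda>x. f x ^ j}"
proof (induction j)
  case 0
  show ?case using lip_class_const1[OF S normed_scale_mult, of s n 1] by simp
next
  case (Suc j)
  show ?case using lip_class_scale1[OF S normed_scale_mult f Suc] by simp
qed

lemma lip_class_imp_continuous_on: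
  assumes "lip_class s s' (Suc n) S {f}"
  shows "continuous_on S f"
  using lip_class_SucD(1)[OF assms] has_derivative_continuous
  by (intro continuous_at_imp_continuous_on ballI) blast

lemma lip_class_jet_comp0:
  fixes D :: "nat \<Rightarrow> 'a::real_normed_vector \<Rightarrow> 'a list \<Rightarrow> 'b::real_normed_vector"
  assumes S: "open S" and J: "lip_jet s s' N T D" and s: "normed_scale s" "normed_scale s'"
    and gS: "\<And>x. x \<in> S \<Longrightarrow> g x \<in> T" and gc: "continuous_on S g"
    and g: "lip_class s0 s n S {g}" and n: "n \<le> N"
  shows "lip_class s0 s' n S {\<lambda>x. D 0 (g x) []}"
proof (rule lip_class_mono[OF S lip_class_jet_comp[OF S J s gS gc g g, of 0]])
  show "0 + n \<le> N" using n by simp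
qed auto

text \<open>Freezing the trailing arguments \<open>es\<close> yields the jet of the derivative in
  these directions; they trail because the directions differentiated first stand last in the list.
  With 2k copies of the \<epsilon>-direction as \<open>es\<close> this enters the Taylor
  remainder.\<close>

lemma lip_jet_shift:
  fixes s :: "'k::real_normed_field \<Rightarrow> 'a::real_normed_vector \<Rightarrow> 'a" and s' :: "'k \<Rightarrow> 'b::real_normed_vector \<Rightarrow> 'b"
  assumes J: "lip_jet s s' N S D" and n: "n + length es \<le> N"
  shows "lip_jet s s' n S (\<lambda>j x vs. D (j + length es) x (vs @ es))"
  unfolding lip_jet_def
proof (intro conjI allI impI ballI)
  show "open S" by (rule lip_jet_open[OF J])
  show "multilin s s' j (\<lambda>vs. D (j + length es) x (vs @ es))" if "j \<le> n" "x \<in> S" for j x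
    unfolding multilin_def
  proof (intro allI impI conjI)
    fix us vs :: "'a list" and a b c assume l: "length us + 1 + length vs = j"
    have m: "multilin s s' (j + length es) (D (j + length es) x)"
      using lip_jet_multilin[OF J _ that(2)] n that(1) by simp
    show "D (j + length es) x ((us @ (a + b) # vs) @ es)
        = D (j + length es) x ((us @ a # vs) @ es) + D (j + length es) x ((us @ b # vs) @ es)"
      using multilin_add[OF m, of us "vs @ es" a b] l by simp
    show "D (j + length es) x ((us @ s c a # vs) @ es) = s' c (D (j + length es) x ((us @ a # vs) @ es))"
      using multilin_scale[OF m, of us "vs @ es" c a] l by simp
  qed
  show "\<exists>d>0. \<exists>M. \<forall>y\<in>S \<inter> ball x d. \<forall>vs. length vs = j \<longrightarrow>
      norm (D (j + length es) y (vs @ es)) \<le> M * prod_list (map norm vs)" if j: "j \<le> n" and x: "x \<in> S" for j x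
  proof -
    obtain d M where d: "d > 0" and M: "\<forall>j\<le>N. \<forall>y\<in>ball x d. \<forall>vs. length vs = j \<longrightarrow>
        norm (D j y vs) \<le> M * prod_list (map norm vs)"
      using lip_jet_bounded[OF J x] by (elim exE conjE)
    have "norm (D (j + length es) y (vs @ es)) \<le> (M * prod_list (map norm es)) * prod_list (map norm vs)"
      if "y \<in> ball x d" "length vs = j" for y vs
      using M[rule_format, of "j + length es" y "vs @ es"] that n j by (simp add: mult_ac)
    then show ?thesis using d by (intro exI[of _ d] conjI exI[of _ "M * prod_list (map norm es)"]) simp_all
  qed
  show "((\<lambda>x. D (j + length es) x (vs @ es)) has_derivative (\<lambda>h. D (Suc j + length es) x ((h # vs) @ es))) (at x)"
    if "j < n" "x \<in> S" "length vs = j" for j x vs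
    using lip_jet_deriv[OF J _ that(2), of "j + length es" "vs @ es"] that n by simp
qed

lemma multilin_replicate:
  assumes m: "multilin s s' j T" and s': "normed_scale s'"
  shows "length us + i = j \<Longrightarrow> T (us @ replicate i (s c v)) = s' (c ^ i) (T (us @ replicate i v))"
proof (induction i arbitrary: us)
  interpret normed_scale s' by fact
  {
    case 0
    then show ?case by simp
  next
    case (Suc i)
    have "T (us @ replicate (Suc i) (s c v)) = s' c (T (us @ v # replicate i (s c v)))"
      using Suc.prems by (simp add: multilin_scale[OF m])
    also have "T (us @ v # replicate i (s c v)) = s' (c ^ i) (T (us @ v # replicate i v))"
      using Suc.IH[of "us @ [v]"] Suc.prems by simp
    finally show ?case by simp
  }
qed

text \<open>Multiplying the quotient by \<open>t ^ m\<close> shows that the constant coefficient is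
  0; a factor \<open>t\<close> then cancels and the degree drops. The value \<open>L\<close> is
  arbitrary, so the mere existence of a limit annihilates every coefficient.\<close>

lemma poly_coeff_zero:
  fixes a :: "nat \<Rightarrow> 'b::real_normed_vector"
  assumes "((\<lambda>t. (1 / t ^ m) *\<^sub>R (\<Sum>i<m. t ^ i *\<^sub>R a i)) \<longlongrightarrow> L) (at_right (0::real))"
  shows "\<forall>i<m. a i = 0"
  using assms
proof (induction m arbitrary: a)
  case (Suc m)
  let ?q = "\<lambda>t. \<Sum>i<m. t ^ i *\<^sub>R a (Suc i)"
  have pos: "eventually (\<lambda>t::real. t > 0) (at_right 0)" by (rule eventually_at_right_less)
  have split: "(\<Sum>i<Suc m. t ^ i *\<^sub>R a i) = a 0 + t *\<^sub>R ?q t" for t :: real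
    by (simp add: sum.lessThan_Suc_shift scaleR_sum_right del: sum.lessThan_Suc)
  have idt: "((\<lambda>t::real. t) \<longlongrightarrow> 0) (at_right 0)" by (rule tendsto_ident_at)
  have "((\<lambda>t. t ^ Suc m *\<^sub>R ((1 / t ^ Suc m) *\<^sub>R (\<Sum>i<Suc m. t ^ i *\<^sub>R a i))) \<longlongrightarrow> 0 ^ Suc m *\<^sub>R L) (at_right 0)"
    by (intro tendsto_scaleR tendsto_power idt Suc.prems)
  then have "((\<lambda>t. a 0 + t *\<^sub>R ?q t) \<longlongrightarrow> 0 ^ Suc m *\<^sub>R L) (at_right 0)"
  proof (rule Lim_transform_eventually[OF _ eventually_mono[OF pos]])
    fix t :: real assume "t > 0"
    then show "t ^ Suc m *\<^sub>R ((1 / t ^ Suc m) *\<^sub>R (\<Sum>i<Suc m. t ^ i *\<^sub>R a i)) = a 0 + t *\<^sub>R ?q t"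
      unfolding split by simp
  qed
  then have 1: "((\<lambda>t. a 0 + t *\<^sub>R ?q t) \<longlongrightarrow> 0) (at_right 0)" by simp
  have "((\<lambda>t. a 0 + t *\<^sub>R ?q t) \<longlongrightarrow> a 0 + 0 *\<^sub>R (\<Sum>i<m. 0 ^ i *\<^sub>R a (Suc i))) (at_right 0)"
    by (intro tendsto_intros idt)
  with 1 have a0: "a 0 = 0" using tendsto_unique[OF trivial_limit_at_right_real] by fastforce
  have "((\<lambda>t. (1 / t ^ m) *\<^sub>R ?q t) \<longlongrightarrow> L) (at_right 0)"
  proof (rule Lim_transform_eventually[OF Suc.prems eventually_mono[OF pos]])
    fix t :: real assume "t > 0"
    then show "(1 / t ^ Suc m) *\<^sub>R (\<Sum>i<Suc m. t ^ i *\<^sub>R a i) = (1 / t ^ m) *\<^sub>R ?q t"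
      unfolding split by (simp add: a0)
  qed
  from Suc.IH[OF this] show ?case using a0 by (auto simp: less_Suc_eq_0_disj)
qed simp

text \<open>The solution is constructed on an open set of the full space, whereas smoothness of the
  family is stated for pairs with second component in \<open>N\<close> and for directions in that
  subspace. The restriction keeps the same \<open>D\<close>.\<close>

lemma C_on_subspace:
  fixes s :: "'k::real_normed_field \<Rightarrow> 'a::real_normed_vector \<Rightarrow> 'a" and s' :: "'k \<Rightarrow> 'b::real_normed_vector \<Rightarrow> 'b"
  assumes "C_on s s' q UNIV W f"
  shows "C_on s s' q E (W \<inter> E) f"
proof -
  have W: "open W" using assms by (simp add: C_on_def)
  from assms obtain D where "(\<forall>x\<in>W. D 0 x [] = f x) \<and>
        (\<forall>j\<le>q. \<forall>x\<in>W. bounded_multilinear_on s s' UNIV j (D j x)) \<and>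
        (\<forall>j. j < q \<longrightarrow> (\<forall>x\<in>W. \<forall>e>0. \<exists>d>0. \<forall>h\<in>UNIV. norm h < d \<and> x + h \<in> W \<longrightarrow>
           (\<forall>vs\<in>lists UNIV. length vs = j \<longrightarrow>
              norm (D j (x + h) vs - D j x vs - D (Suc j) x (h # vs))
                \<le> e * norm h * prod_list (map norm vs)))) \<and>
        (\<forall>x\<in>W. \<forall>e>0. \<exists>d>0. \<forall>y\<in>W. dist y x < d \<longrightarrow>
           (\<forall>vs\<in>lists UNIV. length vs = q \<longrightarrow>
              norm (D q y vs - D q x vs) \<le> e * prod_list (map norm vs)))"
    (is "?A \<and> ?B \<and> ?C \<and> ?E")
    using assms(1)[unfolded C_on_def, THEN conjunct2] by (elim exE)
  then have A: ?A and B: ?B and C: ?C and E: ?E by simp_all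
  show ?thesis
    unfolding C_on_def
  proof (intro conjI exI[of _ D] allI impI ballI)
    show "openin (top_of_set E) (W \<inter> E)" using W by (auto simp: openin_open)
    show "D 0 x [] = f x" if "x \<in> W \<inter> E" for x using A that by simp
    show "bounded_multilinear_on s s' E j (D j x)" if jx: "j \<le> q" "x \<in> W \<inter> E" for j x
    proof -
      have b: "bounded_multilinear_on s s' UNIV j (D j x)" using B jx by blast
      show ?thesis
        unfolding bounded_multilinear_on_def
      proof (intro conjI ballI impI allI)
        fix us vs :: "'a list" and u v c assume "length us + 1 + length vs = j"
        then show "D j x (us @ (u + v) # vs) = D j x (us @ u # vs) + D j x (us @ v # vs)"
          "D j x (us @ s c u # vs) = s' c (D j x (us @ u # vs))"
          using b[unfolded bounded_multilinear_on_def, THEN conjunct1] by simp_all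
      next
        obtain M where "\<forall>vs\<in>lists UNIV. length vs = j \<longrightarrow> norm (D j x vs) \<le> M * prod_list (map norm vs)"
          using b[unfolded bounded_multilinear_on_def, THEN conjunct2] by (elim exE)
        then show "\<exists>M. \<forall>vs\<in>lists E. length vs = j \<longrightarrow> norm (D j x vs) \<le> M * prod_list (map norm vs)"
          by (intro exI[of _ M]) simp
      qed
    qed
    show "\<exists>d>0. \<forall>h\<in>E. norm h < d \<and> x + h \<in> W \<inter> E \<longrightarrow> (\<forall>vs\<in>lists E. length vs = j \<longrightarrow>
        norm (D j (x + h) vs - D j x vs - D (Suc j) x (h # vs)) \<le> e * norm h * prod_list (map norm vs))"
      if jx: "j < q" "x \<in> W \<inter> E" "0 < e" for j x e
    proof -
      have "x \<in> W" using jx(2) by simp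
      from bspec[OF C[THEN spec, THEN mp, OF jx(1)] this, THEN spec, THEN mp, OF jx(3)]
      obtain d where "d > 0" "\<forall>h\<in>UNIV. norm h < d \<and> x + h \<in> W \<longrightarrow> (\<forall>vs\<in>lists UNIV. length vs = j \<longrightarrow>
        norm (D j (x + h) vs - D j x vs - D (Suc j) x (h # vs)) \<le> e * norm h * prod_list (map norm vs))"
        by (elim exE conjE)
      then show ?thesis by (intro exI[of _ d] conjI) simp_all
    qed
    show "\<exists>d>0. \<forall>y\<in>W \<inter> E. dist y x < d \<longrightarrow> (\<forall>vs\<in>lists E. length vs = q \<longrightarrow>
        norm (D q y vs - D q x vs) \<le> e * prod_list (map norm vs))"
      if jx: "x \<in> W \<inter> E" "0 < e" for x e
    proof -
      have "x \<in> W" using jx(1) by simp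
      from bspec[OF E this, THEN spec, THEN mp, OF jx(2)]
      obtain d where "d > 0" "\<forall>y\<in>W. dist y x < d \<longrightarrow> (\<forall>vs\<in>lists UNIV. length vs = q \<longrightarrow>
        norm (D q y vs - D q x vs) \<le> e * prod_list (map norm vs))"
        by (elim exE conjE)
      then show ?thesis by (intro exI[of _ d] conjI) simp_all
    qed
  qed
qed

text \<open>A second-order expansion whose base point \<open>a\<close> moves while the quadratic
  term stays fixed at \<open>x\<close>; the price is the summand \<open>norm (a - x)\<close> in the
  error. In the application \<open>a\<close> is z(t), which tends to 0, and the quadratic term is
  \<open>B0 h h\<close>.\<close>

lemma jet_taylor2:
  fixes D :: "nat \<Rightarrow> 'a::real_normed_vector \<Rightarrow> 'a list \<Rightarrow> 'b::real_normed_vector"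
  assumes J: "lip_jet s s' n S D" and s: "normed_scale s" "normed_scale s'" and n: "3 \<le> n" and x: "x \<in> S"
  shows "\<exists>d>0. \<exists>M\<ge>0. \<forall>a h. norm (a - x) < d \<longrightarrow> norm (a + h - x) < d \<longrightarrow>
    norm (D 0 (a + h) [] - D 0 a [] - D (Suc 0) a [h] - (1/2) *\<^sub>R D (Suc (Suc 0)) x [h, h])
      \<le> M * (norm h)\<^sup>2 * (norm h + norm (a - x))"
proof -
  obtain d M where d: "d > 0" "M \<ge> 0" "ball x d \<subseteq> S" and M0: "\<forall>j\<le>n. \<forall>y\<in>ball x d. \<forall>vs. length vs = j \<longrightarrow>
      norm (D j y vs) \<le> M * prod_list (map norm vs)"
    using lip_jet_bounded[OF J x] by (elim exE conjE)
  have M: "norm (D j y vs) \<le> M * prod_list (map norm vs)" if "j \<le> n" "y \<in> ball x d" "length vs = j" for j y vs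
    using M0 that by simp
  have ml: "multilin s s' j (D j y)" if "j \<le> n" "y \<in> ball x d" for j y
    using lip_jet_multilin[OF J that(1)] that(2) d(3) by blast
  let ?B = "\<lambda>u v. D (Suc (Suc 0)) x [u, v]"
  have xb: "x \<in> ball x d" using d by simp
  have m2: "multilin s s' (Suc (Suc 0)) (D (Suc (Suc 0)) x)" using ml[OF _ xb] n by simp
  have bil: "bounded_bilinear ?B"
  proof (rule bounded_bilinear.intro)
    show "?B (a + a') b = ?B a b + ?B a' b" "?B (r *\<^sub>R a) b = r *\<^sub>R ?B a b" for a a' b r
      using multilin_add[OF m2, of "[]" "[b]"] multilin_scaleR[OF m2 s, of "[]" "[b]"] by simp_all
    show "?B a (b + b') = ?B a b + ?B a b'" "?B a (r *\<^sub>R b) = r *\<^sub>R ?B a b" for a b b' r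
      using multilin_add[OF m2, of "[a]" "[]"] multilin_scaleR[OF m2 s, of "[a]" "[]"] by simp_all
    have "norm (?B a b) \<le> norm a * norm b * M" for a b
      using M[OF _ xb, of "Suc (Suc 0)" "[a, b]"] n by (simp add: mult_ac)
    then show "\<exists>K. \<forall>a b. norm (?B a b) \<le> norm a * norm b * K" by blast
  qed
  interpret B: bounded_bilinear ?B by (rule bil)
  have sym: "?B u v = ?B v u" for u v by (rule jet_second_deriv_symmetric[OF J n x])
  have main: "norm (D 0 (a + h) [] - D 0 a [] - D (Suc 0) a [h] - (1/2) *\<^sub>R ?B h h)
      \<le> M * (norm h)\<^sup>2 * (norm h + norm (a - x))" if ah: "norm (a - x) < d" "norm (a + h - x) < d" for a h
  proof -
    let ?L = "closed_segment a (a + h)"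
    have ab: "a \<in> ball x d" "a + h \<in> ball x d" using ah by (simp_all add: dist_norm norm_minus_commute)
    have L: "?L \<subseteq> ball x d" using ab by (simp add: closed_segment_subset)
    \<comment> \<open>Subtracting the quadratic term reduces the claim to a linearization on the
      segment. Symmetry of the second derivative turns the derivative of this term at
      \<open>z\<close> into \<open>?B (z - a)\<close>.\<close>
    define \<Phi> where "\<Phi> = (\<lambda>y. D 0 y [] - (1/2) *\<^sub>R ?B (y - a) (y - a))"
    define \<Phi>' where "\<Phi>' = (\<lambda>y k. D (Suc 0) y [k] - ?B (y - a) k)"
    have A: "norm (\<Phi> (a + h) - \<Phi> a - \<Phi>' a (a + h - a)) \<le> norm (a + h - a) * (M * norm h * (norm h + norm (a - x)))"
    proof (rule differentiable_bound_linearization[where S="?L"])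
      show "a + t *\<^sub>R (a + h - a) \<in> ?L" if "t \<in> {0..1}" for t
        using that by (auto simp: in_segment algebra_simps intro!: exI[of _ t])
      show "a \<in> ?L" by simp
      fix z assume z: "z \<in> ?L"
      then have zb: "z \<in> ball x d" using L by blast
      have "((\<lambda>y. D 0 y []) has_derivative (\<lambda>k. D (Suc 0) z [k])) (at z within ?L)"
      proof -
        have "z \<in> S" using zb d(3) by blast
        then show ?thesis
          using lip_jet_deriv[OF J, of 0 z "[]"] n has_derivative_at_withinI by fastforce
      qed
      moreover have "((\<lambda>y. (1/2) *\<^sub>R ?B (y - a) (y - a)) has_derivative (\<lambda>k. ?B (z - a) k)) (at z within ?L)"
      proof -
        have id: "((\<lambda>y. y - a) has_derivative (\<lambda>k. k)) (at z within ?L)"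
          by (auto intro!: derivative_eq_intros)
        have "((\<lambda>y. (1/2) *\<^sub>R ?B (y - a) (y - a)) has_derivative (\<lambda>k. (1/2) *\<^sub>R (?B (z - a) k + ?B k (z - a)))) (at z within ?L)"
          by (intro has_derivative_scaleR_right B.FDERIV id)
        then show ?thesis by (simp add: sym[of _ "z - a"] flip: scaleR_2)
      qed
      ultimately show "(\<Phi> has_derivative \<Phi>' z) (at z within ?L)"
        unfolding \<Phi>_def \<Phi>'_def by (intro has_derivative_diff)
      show "onorm (\<Phi>' z - \<Phi>' a) \<le> M * norm h * (norm h + norm (a - x))"
      proof (rule onorm_bound)
        show "0 \<le> M * norm h * (norm h + norm (a - x))" using d by simp
        fix k
        have zh: "norm (z - a) \<le> norm h" using segment_bound1[OF z] by simp
        have "norm (D (Suc 0) z [k] - D (Suc 0) a [k] - D (Suc (Suc 0)) a ((z - a) # [k]))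
            \<le> M * (norm (z - a))\<^sup>2 * prod_list (map norm [k])"
          by (rule lip_jet_quadratic[OF J convex_ball d(3) M d(2)]) (use n zb ab in auto)
        also have "\<dots> \<le> M * (norm h * norm h) * norm k"
          using zh d(2) by (auto simp: power2_eq_square intro!: mult_right_mono mult_left_mono mult_mono)
        finally have 1: "norm (D (Suc 0) z [k] - D (Suc 0) a [k] - D (Suc (Suc 0)) a [z - a, k]) \<le> M * (norm h * norm h) * norm k" .
        have "norm (D (Suc (Suc 0)) a [z - a, k] - D (Suc (Suc 0)) x [z - a, k]) \<le> M * norm (a - x) * prod_list (map norm [z - a, k])"
        proof (rule lip_jet_lipschitz[OF J convex_ball d(3) _ d(2)])
          show "norm (D (Suc (Suc (Suc 0))) y vs) \<le> M * prod_list (map norm vs)"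
            if "y \<in> ball x d" "length vs = Suc (Suc (Suc 0))" for y vs
            using M[of "Suc (Suc (Suc 0))" y vs] that n by simp
        qed (use n ab xb in auto)
        also have "\<dots> \<le> M * norm (a - x) * (norm h * norm k)"
          using zh d(2) by (auto intro!: mult_left_mono mult_right_mono)
        finally have 2: "norm (D (Suc (Suc 0)) a [z - a, k] - ?B (z - a) k) \<le> M * norm (a - x) * (norm h * norm k)" .
        have "(\<Phi>' z - \<Phi>' a) k = (D (Suc 0) z [k] - D (Suc 0) a [k] - D (Suc (Suc 0)) a [z - a, k])
            + (D (Suc (Suc 0)) a [z - a, k] - ?B (z - a) k)"
          by (simp add: \<Phi>'_def B.zero_left)
        then have "norm ((\<Phi>' z - \<Phi>' a) k) \<le> norm (D (Suc 0) z [k] - D (Suc 0) a [k] - D (Suc (Suc 0)) a [z - a, k])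
            + norm (D (Suc (Suc 0)) a [z - a, k] - ?B (z - a) k)"
          by (metis norm_triangle_ineq)
        also have "\<dots> \<le> M * (norm h * norm h) * norm k + M * norm (a - x) * (norm h * norm k)"
          using 1 2 by (rule add_mono)
        also have "\<dots> = M * norm h * (norm h + norm (a - x)) * norm k" by (simp add: algebra_simps)
        finally show "norm ((\<Phi>' z - \<Phi>' a) k) \<le> M * norm h * (norm h + norm (a - x)) * norm k" .
      qed
    qed
    have B: "\<Phi> (a + h) - \<Phi> a - \<Phi>' a (a + h - a) = D 0 (a + h) [] - D 0 a [] - D (Suc 0) a [h] - (1/2) *\<^sub>R ?B h h"
      by (simp add: \<Phi>_def \<Phi>'_def B.zero_left)
    have C: "norm (a + h - a) * (M * norm h * (norm h + norm (a - x))) = M * (norm h)\<^sup>2 * (norm h + norm (a - x))"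
      by (simp add: power2_eq_square algebra_simps)
    show ?thesis using A unfolding B C .
  qed
  show ?thesis
    by (rule exI[of _ d], intro conjI exI[of _ M] d(1,2) allI impI main)
qed

text \<open>\<open>inv_into X A\<close> is meaningful only on \<open>Y\<close>. Composed with a
  bounded linear map \<open>P\<close> into \<open>Y\<close> it becomes a bounded linear operator on
  the whole space, to which the rules for \<open>lip_class\<close> apply.\<close>

lemma GL_on_inverse:
  assumes GL: "GL_on s s' X Y A" and s: "normed_scale s" "normed_scale s'"
    and X: "module.subspace s X" and Y: "module.subspace s' Y"
    and P: "bounded_linear P" "\<And>c x. P (s' c x) = s' c (P x)" "\<And>x. P x \<in> Y"
  shows "bounded_linear (\<lambda>y. inv_into X A (P y))"
    and "inv_into X A (P (s' c y)) = s c (inv_into X A (P y))"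
    and "inv_into X A (P y) \<in> X" and "A (inv_into X A (P y)) = P y"
proof -
  interpret s: normed_scale s by fact
  interpret s': normed_scale s' by fact
  have add: "\<And>x y. x \<in> X \<Longrightarrow> y \<in> X \<Longrightarrow> A (x + y) = A x + A y"
    and sc: "\<And>c x. x \<in> X \<Longrightarrow> A (s c x) = s' c (A x)" and bij: "bij_betw A X Y"
    using GL unfolding GL_on_def by blast+
  obtain M where M: "\<And>y. y \<in> Y \<Longrightarrow> norm (inv_into X A y) \<le> M * norm y"
    using GL unfolding GL_on_def by blast
  have mem: "inv_into X A y \<in> X" and Ainv: "A (inv_into X A y) = y" if "y \<in> Y" for y
    using bij that by (simp_all add: bij_betw_def inv_into_into f_inv_into_f)
  have inv: "inv_into X A (A x) = x" if "x \<in> X" for x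
    using bij that by (simp add: bij_betw_def)
  show "inv_into X A (P y) \<in> X" "A (inv_into X A (P y)) = P y"
    using mem Ainv P(3) by auto
  have hom: "inv_into X A (P (s' c y)) = s c (inv_into X A (P y))" for c y
    using inv[of "s c (inv_into X A (P y))"] mem[OF P(3)] Ainv[OF P(3)] s.subspace_scale[OF X]
    by (simp add: sc P(2))
  then show "inv_into X A (P (s' c y)) = s c (inv_into X A (P y))" .
  obtain K where K: "\<And>x. norm (P x) \<le> norm x * K" "K > 0" using bounded_linear.pos_bounded[OF P(1)] by blast
  show "bounded_linear (\<lambda>y. inv_into X A (P y))"
  proof (rule bounded_linear_intro[where K="max M 0 * K"])
    show "inv_into X A (P (x + y)) = inv_into X A (P x) + inv_into X A (P y)" for x y
      using inv[of "inv_into X A (P x) + inv_into X A (P y)"] mem[OF P(3)] Ainv[OF P(3)] s.subspace_add[OF X]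
      by (simp add: add linear_add[OF bounded_linear.linear[OF P(1)]])
    show "inv_into X A (P (r *\<^sub>R x)) = r *\<^sub>R inv_into X A (P x)" for r x
      using hom[of "of_real r" x] by (simp add: s.scale_of_real s'.scale_of_real)
    show "norm (inv_into X A (P x)) \<le> norm x * (max M 0 * K)" for x
    proof -
      have "norm (inv_into X A (P x)) \<le> max M 0 * norm (P x)"
        using M[OF P(3)] by (rule order_trans) (simp add: mult_right_mono)
      also have "\<dots> \<le> max M 0 * (norm x * K)" by (intro mult_left_mono K) simp
      finally show ?thesis by (simp add: mult_ac)
    qed
  qed
qed

subsection \<open>The equation divided by its order of vanishing\<close>

lemma bilinear_of_jet:
  fixes D :: "nat \<Rightarrow> 'a::real_normed_vector \<Rightarrow> 'a list \<Rightarrow> 'b::real_normed_vector"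
  assumes J: "lip_jet s s' n S D" and s: "normed_scale s" "normed_scale s'" and n: "2 \<le> n" and x: "x \<in> S"
  shows "bounded_bilinear (\<lambda>u v. D (Suc (Suc 0)) x [u, v])"
proof (rule bounded_bilinear.intro)
  have m2: "multilin s s' (Suc (Suc 0)) (D (Suc (Suc 0)) x)" using lip_jet_multilin[OF J _ x] n by simp
  show "D (Suc (Suc 0)) x [a + a', b] = D (Suc (Suc 0)) x [a, b] + D (Suc (Suc 0)) x [a', b]"
    "D (Suc (Suc 0)) x [r *\<^sub>R a, b] = r *\<^sub>R D (Suc (Suc 0)) x [a, b]" for a a' b r
    using multilin_add[OF m2, of "[]" "[b]"] multilin_scaleR[OF m2 s, of "[]" "[b]"] by simp_all
  show "D (Suc (Suc 0)) x [a, b + b'] = D (Suc (Suc 0)) x [a, b] + D (Suc (Suc 0)) x [a, b']"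
    "D (Suc (Suc 0)) x [a, r *\<^sub>R b] = r *\<^sub>R D (Suc (Suc 0)) x [a, b]" for a b b' r
    using multilin_add[OF m2, of "[a]" "[]"] multilin_scaleR[OF m2 s, of "[a]" "[]"] by simp_all
  obtain d M where d: "d > 0" and M: "\<forall>j\<le>n. \<forall>y\<in>ball x d. \<forall>vs. length vs = j \<longrightarrow>
      norm (D j y vs) \<le> M * prod_list (map norm vs)"
    using lip_jet_bounded[OF J x] by (elim exE conjE)
  have "norm (D (Suc (Suc 0)) x [a, b]) \<le> norm a * norm b * M" for a b
    using M[rule_format, of "Suc (Suc 0)" x "[a, b]"] n d by (simp add: mult_ac)
  then show "\<exists>K. \<forall>a b. norm (D (Suc (Suc 0)) x [a, b]) \<le> norm a * norm b * K" by blast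
qed

text \<open>Links \<open>half_second_derivative\<close>, which differentiates a map with values in
  \<open>blinfun\<close>, to the jet. Differentiability in the norm of \<open>blinfun\<close> rests
  on the quadratic estimate, uniform in the last argument, and hence on third derivatives.\<close>

lemma second_derivative_of_jet:
  fixes D :: "nat \<Rightarrow> 'a::real_normed_vector \<Rightarrow> 'a list \<Rightarrow> 'b::real_normed_vector"
  assumes J: "lip_jet s s' n UNIV D" and s: "normed_scale s" "normed_scale s'" and n: "3 \<le> n"
    and G: "\<And>x. D 0 x [] = G x"
  shows "frechet_derivative G (at x) = (\<lambda>h. D (Suc 0) x [h])"
    and "half_second_derivative G x v w = (1/2) *\<^sub>R D (Suc (Suc 0)) x [v, w]"
proof -
  have dG: "(G has_derivative (\<lambda>h. D (Suc 0) x [h])) (at x)" for x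
    using lip_jet_deriv[OF J _ UNIV_I, of 0 "[]"] n by (simp add: G)
  show fd: "frechet_derivative G (at x) = (\<lambda>h. D (Suc 0) x [h])" for x
    by (rule frechet_derivative_at[OF dG, symmetric])
  interpret B: bounded_bilinear "\<lambda>u v. D (Suc (Suc 0)) x [u, v]"
    by (rule bilinear_of_jet[OF J s _ UNIV_I]) (use n in simp)
  define f where "f = (\<lambda>y. Blinfun (\<lambda>h. D (Suc 0) y [h]))"
  define L where "L = (\<lambda>v. Blinfun (\<lambda>w. D (Suc (Suc 0)) x [v, w]))"
  have f: "blinfun_apply (f y) h = D (Suc 0) y [h]" for y h
    unfolding f_def by (simp add: bounded_linear_Blinfun_apply[OF has_derivative_bounded_linear[OF dG]])
  have L: "blinfun_apply (L v) w = D (Suc (Suc 0)) x [v, w]" for v w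
    unfolding L_def by (simp add: bounded_linear_Blinfun_apply[OF B.bounded_linear_right])
  obtain d M where d: "d > 0" "M \<ge> 0" "ball x d \<subseteq> UNIV" and M: "\<forall>j\<le>n. \<forall>y\<in>ball x d. \<forall>vs. length vs = j \<longrightarrow>
      norm (D j y vs) \<le> M * prod_list (map norm vs)"
    using lip_jet_bounded[OF J UNIV_I, of x] by (elim exE conjE)
  have "(f has_derivative L) (at x)"
  proof (rule has_derivative_quadraticI[OF _ d(1)])
    show "bounded_linear L"
    proof (rule bounded_linear_intro[where K=M])
      show "L (a + b) = L a + L b" "L (r *\<^sub>R a) = r *\<^sub>R L a" for a b r
        by (rule blinfun_eqI, simp add: L blinfun.add_left blinfun.scaleR_left B.add_left B.scaleR_left)+
      show "norm (L a) \<le> norm a * M" for a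
      proof (rule norm_blinfun_bound)
        show "norm (blinfun_apply (L a) w) \<le> norm a * M * norm w" for w
          using M[rule_format, of "Suc (Suc 0)" x "[a, w]"] n d by (simp add: L mult_ac)
      qed (use d in simp)
    qed
    fix y assume y: "y \<in> ball x d"
    show "norm (f y - f x - L (y - x)) \<le> M * (norm (y - x))\<^sup>2"
    proof (rule norm_blinfun_bound)
      fix k
      have "norm (D (Suc 0) y [k] - D (Suc 0) x [k] - D (Suc (Suc 0)) x ((y - x) # [k]))
          \<le> M * (norm (y - x))\<^sup>2 * prod_list (map norm [k])"
      proof (rule lip_jet_quadratic[OF J convex_ball d(3) _ d(2)])
        show "norm (D (Suc (Suc (Suc 0))) z vs) \<le> M * prod_list (map norm vs)"
          if "z \<in> ball x d" "length vs = Suc (Suc (Suc 0))" for z vs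
          using M[rule_format, of "Suc (Suc (Suc 0))" z vs] that n by simp
      qed (use y d n in auto)
      then show "norm (blinfun_apply (f y - f x - L (y - x)) k) \<le> M * (norm (y - x))\<^sup>2 * norm k"
        by (simp add: f L blinfun.diff_left)
    qed (use d in simp)
  qed
  then have fL: "frechet_derivative f (at x) = L" by (rule frechet_derivative_at[symmetric])
  show "half_second_derivative G x v w = (1/2) *\<^sub>R D (Suc (Suc 0)) x [v, w]"
    unfolding half_second_derivative_def fd f_def[symmetric] fL by (simp add: L)
qed

section \<open>Projections, the inverses of the \<open>S i\<close>, and the ansatz\<close>

context approximate_solution
begin

lemma nsB: "normed_scale sB"
  by (rule banach_over_imp_normed_scale[OF B.banach_over_axioms])

lemma nsC: "normed_scale sC"
  by (rule banach_over_imp_normed_scale[OF C.banach_over_axioms])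

definition projR :: "nat \<Rightarrow> 'b \<Rightarrow> 'b" where
  "projR i = component {1..k+1} R i"

text \<open>\<open>N\<close> is the summand of index k + 2. The projection lets the parameter
  \<open>n\<close> range over the whole space, so that domains are open; on \<open>N\<close> it is
  the identity.\<close>

definition projN :: "'a \<Rightarrow> 'a" where
  "projN = component {1..k+2} (Nc(k+2 := N)) (k+2)"

definition T :: "nat \<Rightarrow> 'b \<Rightarrow> 'a" where
  "T i y = inv_into (Nc i) (S i) (projR i y)"

lemma sums: "direct_sum sB {1..k+2} (Nc(k+2 := N))" "direct_sum sC {1..k+1} R"
  using assoc unfolding associated_sums_def by blast+

lemma S_op: "i \<in> {1..k+1} \<Longrightarrow> bounded_operator sB sC (S i) \<and> GL_on sB sC (Nc i) (R i) (S i)"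
  using assoc unfolding associated_sums_def by blast

lemma phi_op: "i \<in> {1..k} \<Longrightarrow> bounded_operator sB sB (\<phi> i)"
  using assoc unfolding associated_sums_def by blast

lemma phi_bounded_linear: "i \<in> {1..k} \<Longrightarrow> bounded_linear (\<phi> i)"
  using phi_op unfolding bounded_operator_def by blast

lemma phi_scale: "i \<in> {1..k} \<Longrightarrow> \<phi> i (sB c v) = sB c (\<phi> i v)"
  using phi_op unfolding bounded_operator_def by (meson Vector_Spaces.linear.axioms(3) Vector_Spaces.linear_def module_hom.scale)

lemma projR_bounded_linear: "i \<in> {1..k+1} \<Longrightarrow> bounded_linear (projR i)"
  unfolding projR_def by (rule component_bounded_linear[OF nsC _ sums(2) closed_R]) auto

lemma projR_scale: "i \<in> {1..k+1} \<Longrightarrow> projR i (sC c x) = sC c (projR i x)"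
  unfolding projR_def by (rule component_scale[OF sums(2) C.vector_space_axioms])

lemma projR_mem: "i \<in> {1..k+1} \<Longrightarrow> projR i x \<in> R i"
  unfolding projR_def by (rule component_mem[OF sums(2)])

lemma projR_same: "i \<in> {1..k+1} \<Longrightarrow> x \<in> R i \<Longrightarrow> projR i x = x"
  unfolding projR_def by (rule component_same[OF sums(2) C.vector_space_axioms]) auto

lemma sum_projR: "(\<Sum>i\<in>{1..k+1}. projR i x) = x"
  unfolding projR_def by (rule sum_component[OF sums(2)])

lemma projN_bounded_linear: "bounded_linear projN"
  unfolding projN_def
proof (rule component_bounded_linear[OF nsB _ sums(1)])
  show "closed ((Nc(k + 2 := N)) i)" if "i \<in> {1..k+2}" for i
    using that closed_Nc[of i] closed_N by (cases "i = k + 2") auto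
qed auto

lemma projN_scale: "projN (sB c x) = sB c (projN x)"
  unfolding projN_def by (rule component_scale[OF sums(1) B.vector_space_axioms]) simp

lemma projN_mem: "projN x \<in> N"
  using component_mem[OF sums(1), of "k+2" x] by (simp add: projN_def)

lemma projN_same: "n \<in> N \<Longrightarrow> projN n = n"
  unfolding projN_def by (rule component_same[OF sums(1) B.vector_space_axioms]) auto

lemma subspace_Nc: "i \<in> {1..k+1} \<Longrightarrow> B.subspace (Nc i)"
proof -
  assume i: "i \<in> {1..k+1}"
  have "\<forall>i\<in>{1..k+2}. B.subspace ((Nc(k + 2 := N)) i)"
    using sums(1) unfolding direct_sum_def by (rule conjunct1)
  from bspec[OF this, of i] show ?thesis using i by simp
qed

lemma subspace_R: "i \<in> {1..k+1} \<Longrightarrow> C.subspace (R i)"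
  using sums(2) unfolding direct_sum_def by blast

lemma T_facts:
  assumes i: "i \<in> {1..k+1}"
  shows T_bounded_linear: "bounded_linear (T i)"
    and T_scale: "T i (sC c y) = sB c (T i y)"
    and T_mem: "T i y \<in> Nc i" and S_T: "S i (T i y) = projR i y"
proof -
  have GL: "GL_on sB sC (Nc i) (R i) (S i)" using S_op[OF i] by blast
  note * = GL_on_inverse[OF GL nsB nsC subspace_Nc[OF i] subspace_R[OF i] projR_bounded_linear[OF i] projR_scale[OF i] projR_mem[OF i]]
  show "bounded_linear (T i)" using *(1) unfolding T_def[abs_def] .
  show "T i (sC c y) = sB c (T i y)" "T i y \<in> Nc i" "S i (T i y) = projR i y"
    unfolding T_def by (rule *)+
qed

definition jetG :: "nat \<Rightarrow> 'a \<Rightarrow> 'a list \<Rightarrow> 'b" where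
  "jetG = (SOME D. lip_jet sB sC r UNIV D \<and> (\<forall>x\<in>UNIV. D 0 x [] = G x))"

lemma jetG: "lip_jet sB sC r UNIV jetG" and jetG0: "jetG 0 x [] = G x"
  using someI_ex[OF C_on_imp_lip_jet[OF G_smooth nsB nsC]] unfolding jetG_def by blast+

lemma r5: "5 \<le> r" using r_large k_pos q_pos by simp

lemma fd_G: "frechet_derivative G (at x) = (\<lambda>h. jetG (Suc 0) x [h])"
  by (rule second_derivative_of_jet(1)[OF jetG nsB nsC _ jetG0]) (use r5 in simp)

abbreviation "B0 \<equiv> half_second_derivative G 0"

lemma B0_eq: "B0 v w = (1/2) *\<^sub>R jetG (Suc (Suc 0)) 0 [v, w]"
  by (rule second_derivative_of_jet(2)[OF jetG nsB nsC _ jetG0]) (use r5 in simp)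

lemma B0_bilinear: "bounded_bilinear B0"
proof -
  have "bounded_bilinear (\<lambda>u v. jetG (Suc (Suc 0)) 0 [u, v])"
    by (rule bilinear_of_jet[OF jetG nsB nsC _ UNIV_I]) (use r5 in simp)
  then interpret D: bounded_bilinear "\<lambda>u v. jetG (Suc (Suc 0)) 0 [u, v]" .
  have "bounded_bilinear (\<lambda>u v. jetG (Suc (Suc 0)) 0 [(1/2) *\<^sub>R u, v])"
    by (rule D.comp1[OF bounded_linear_scaleR_right])
  then show ?thesis by (simp add: B0_eq[abs_def] D.scaleR_left)
qed

lemma B0_sym: "B0 v w = B0 w v"
  using jet_second_deriv_symmetric[OF jetG _ UNIV_I, of 0 v w] r5 by (simp add: B0_eq)

text \<open>This is \<open>hat_map\<close> with \<open>T i y\<close> as the component of index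
  \<open>i\<close>: one vector \<open>y\<close> encodes all k + 1 components at once.\<close>

definition graded_sum :: "'k \<Rightarrow> 'b \<Rightarrow> 'a" where
  "graded_sum \<epsilon> y = (\<Sum>i\<in>{1..k+1}. sB (\<epsilon> ^ (k + 1 - i)) (T i y))"

definition W :: "'k \<Rightarrow> 'a \<Rightarrow> 'b \<Rightarrow> 'a" where
  "W \<epsilon> n y = p_family sB k \<phi> \<epsilon> (graded_sum \<epsilon> y + projN n)"

text \<open>The parameters \<epsilon> and \<open>n\<close> are paired first and the unknown
  \<open>y\<close> comes last, the shape expected by \<open>lip_class_implicit\<close>.\<close>

definition ansatz :: "('k \<times> 'a) \<times> 'b \<Rightarrow> 'a" where
  "ansatz x = z (fst (fst x)) + sB (fst (fst x) ^ k) (W (fst (fst x)) (snd (fst x)) (snd x))"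

abbreviation "sP \<equiv> prod_scale (*) sB"
abbreviation "sX \<equiv> prod_scale sP sC"

lemma nsP: "normed_scale sP" by (rule normed_scale_prod[OF normed_scale_mult nsB])
lemma nsX: "normed_scale sX" by (rule normed_scale_prod[OF nsP nsC])

text \<open>Only \<epsilon> is confined to a ball, since smoothness of \<open>z\<close> is known on
  \<open>U\<close> only. The ball is star-shaped, as Taylor's formula in \<epsilon>
  requires.\<close>

abbreviation dom :: "real \<Rightarrow> (('k \<times> 'a) \<times> 'b) set" where
  "dom \<delta> \<equiv> (ball 0 \<delta> \<times> UNIV) \<times> UNIV"

lemma open_dom: "open (dom \<delta>)" by (intro open_Times open_ball open_UNIV)

lemma ansatz_class:
  assumes \<delta>: "ball 0 \<delta> \<subseteq> U"
  shows "lip_class sX sB r (dom \<delta>) {ansatz}"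
proof -
  note o = open_dom[of \<delta>]
  have e: "lip_class sX (*) r (dom \<delta>) {\<lambda>x. fst (fst x)}"
    by (rule lip_class_linear[OF o normed_scale_mult])
       (auto simp: prod_scale_def intro: bounded_linear_compose bounded_linear_fst)
  have ep: "lip_class sX (*) r (dom \<delta>) {\<lambda>x. fst (fst x) ^ j}" for j
    by (rule lip_class_power[OF o e])
  obtain Dz where Dz: "lip_jet (*) sB r U Dz" "\<forall>x\<in>U. Dz 0 x [] = z x"
    using C_on_imp_lip_jet[OF z_smooth normed_scale_mult nsB] by blast
  have "lip_class sX sB r (dom \<delta>) {\<lambda>x. Dz 0 (fst (fst x)) []}"
    by (rule lip_class_jet_comp0[OF o Dz(1) normed_scale_mult nsB _ _ e])
       (use \<delta> in \<open>auto intro!: continuous_intros\<close>)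
  then have zc: "lip_class sX sB r (dom \<delta>) {\<lambda>x. z (fst (fst x))}"
    by (rule lip_class_mono[OF o]) (use Dz(2) \<delta> in auto)
  have Tc: "lip_class sX sB r (dom \<delta>) {\<lambda>x. T i (snd x)}" if "i \<in> {1..k+1}" for i
    by (rule lip_class_linear[OF o nsB])
       (auto simp: prod_scale_def T_scale[OF that] intro: bounded_linear_compose[OF T_bounded_linear[OF that]] bounded_linear_snd)
  have Nc: "lip_class sX sB r (dom \<delta>) {\<lambda>x. projN (snd (fst x))}"
    by (rule lip_class_linear[OF o nsB])
       (auto simp: prod_scale_def projN_scale intro!: bounded_linear_compose[OF projN_bounded_linear]
         bounded_linear_compose[OF bounded_linear_snd] bounded_linear_fst)
  have hc: "lip_class sX sB r (dom \<delta>) {\<lambda>x. graded_sum (fst (fst x)) (snd x) + projN (snd (fst x))}"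
    unfolding graded_sum_def
  proof (intro lip_class_add1[OF o nsB _ Nc] lip_class_sum1[OF o nsB] finite_atLeastAtMost)
    fix i assume "i \<in> {1..k+1}"
    from lip_class_scale1[OF o nsB ep Tc[OF this]]
    show "lip_class sX sB r (dom \<delta>) {\<lambda>x. sB (fst (fst x) ^ (k + 1 - i)) (T i (snd x))}" .
  qed
  have "lip_class sX sB r (dom \<delta>) {\<lambda>x. W (fst (fst x)) (snd (fst x)) (snd x)}"
    unfolding W_def p_family_def
  proof (intro lip_class_add1[OF o nsB hc] lip_class_sum1[OF o nsB] finite_atLeastAtMost)
    fix i assume i: "i \<in> {1..k}"
    show "lip_class sX sB r (dom \<delta>) {\<lambda>x. sB (fst (fst x) ^ i) (\<phi> i (graded_sum (fst (fst x)) (snd x) + projN (snd (fst x))))}"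
      by (rule lip_class_scale1[OF o nsB ep lip_class_linear_comp1[OF o phi_bounded_linear[OF i] phi_scale[OF i] hc]])
  qed
  from lip_class_add1[OF o nsB zc lip_class_scale1[OF o nsB ep this]]
  show ?thesis by (simp add: ansatz_def[abs_def])
qed

lemma G_ansatz_class:
  assumes \<delta>: "ball 0 \<delta> \<subseteq> U"
  shows "lip_class sX sC r (dom \<delta>) {\<lambda>x. G (ansatz x)}"
proof -
  have "lip_class sX sB (Suc 0) (dom \<delta>) {ansatz}"
    by (rule lip_class_le[OF open_dom ansatz_class[OF \<delta>]]) (use r5 in simp)
  then have "continuous_on (dom \<delta>) ansatz" by (rule lip_class_imp_continuous_on)
  from lip_class_jet_comp0[OF open_dom jetG nsB nsC UNIV_I this ansatz_class[OF \<delta>] order_refl]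
  show ?thesis by (simp add: jetG0)
qed

end

section \<open>Limits as the parameter tends to 0 through positive reals\<close>

context approximate_solution
begin

interpretation B0: bounded_bilinear B0 by (rule B0_bilinear)

lemma k_le: "i \<in> {1..k+1} \<Longrightarrow> \<exists>j\<le>k. i = j + 1"
  by (intro exI[of _ "i - 1"]) auto

lemma sB_power: "sB (of_real t ^ j) v = t ^ j *\<^sub>R v"
  using normed_scale.scale_of_real[OF nsB, of "t ^ j" v] by simp

lemma sC_power: "sC (of_real t ^ j) v = t ^ j *\<^sub>R v"
  using normed_scale.scale_of_real[OF nsC, of "t ^ j" v] by simp

text \<open>For complex scalars, too, only the positive real direction is tested; it determines all
  Taylor coefficients in \<epsilon>.\<close>

lemma of_real_at_right: "filterlim (of_real :: real \<Rightarrow> 'k) (at 0) (at_right 0)"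
proof -
  have "((of_real :: real \<Rightarrow> 'k) \<longlongrightarrow> of_real 0) (at_right 0)"
    by (intro tendsto_of_real tendsto_ident_at)
  moreover have "eventually (\<lambda>t::real. (of_real t :: 'k) \<noteq> 0) (at_right 0)"
    by (rule eventually_mono[OF eventually_at_right_less]) simp
  ultimately show ?thesis by (simp add: filterlim_at)
qed

lemma C_on_tendsto_0:
  fixes s' :: "'k \<Rightarrow> 'c::real_normed_vector \<Rightarrow> 'c"
  assumes f: "C_on (*) s' n UNIV U f" and n: "1 \<le> n" and s': "normed_scale s'"
  shows "((\<lambda>t. f (of_real t)) \<longlongrightarrow> f 0) (at_right 0)"
proof -
  obtain D where D: "lip_jet (*) s' n U D" "\<forall>x\<in>U. D 0 x [] = f x"
    using C_on_imp_lip_jet[OF f normed_scale_mult s'] by blast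
  have "((\<lambda>x. D 0 x []) has_derivative (\<lambda>h. D (Suc 0) 0 (h # []))) (at 0)"
    by (rule lip_jet_deriv[OF D(1) _ U_zero]) (use n in simp_all)
  then have "(f has_derivative (\<lambda>h. D (Suc 0) 0 (h # []))) (at 0)"
    by (rule has_derivative_transform_within_open[OF _ U_open U_zero]) (use D(2) in simp)
  then have "(f \<longlongrightarrow> f 0) (at 0)"
    using has_derivative_continuous isCont_def by blast
  from filterlim_compose[OF this of_real_at_right] show ?thesis .
qed

lemma z_limit: "((\<lambda>t. z (of_real t)) \<longlongrightarrow> 0) (at_right 0)"
  using C_on_tendsto_0[OF z_smooth _ nsB] r5 z_zero by simp

text \<open>In the limit the graded sum keeps only the summand of index k + 1, where the exponent is
  0, and every correction by \<open>\<phi> i\<close> carries a positive power of t.\<close>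

lemma W_limit: "((\<lambda>t. W (of_real t) n y) \<longlongrightarrow> T (k+1) y + projN n) (at_right 0)"
proof -
  have idt: "((\<lambda>t::real. t) \<longlongrightarrow> 0) (at_right 0)" by (rule tendsto_ident_at)
  have "((\<lambda>t. \<Sum>i\<in>{1..k+1}. t ^ (k + 1 - i) *\<^sub>R T i y) \<longlongrightarrow> (\<Sum>i\<in>{1..k+1}. 0 ^ (k + 1 - i) *\<^sub>R T i y)) (at_right 0)"
    by (intro tendsto_sum tendsto_scaleR tendsto_power idt tendsto_const)
  moreover have "(\<Sum>i\<in>{1..k+1}. (0::real) ^ (k + 1 - i) *\<^sub>R T i y) = (\<Sum>i\<in>{1..k+1}. if i = k + 1 then T i y else 0)"
    by (intro sum.cong refl) auto
  ultimately have h: "((\<lambda>t. graded_sum (of_real t) y) \<longlongrightarrow> T (k+1) y) (at_right 0)"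
    by (simp add: graded_sum_def sB_power)
  have h': "((\<lambda>t. graded_sum (of_real t) y + projN n) \<longlongrightarrow> T (k+1) y + projN n) (at_right 0)"
    by (intro tendsto_add h tendsto_const)
  have "((\<lambda>t. graded_sum (of_real t) y + projN n + (\<Sum>i\<in>{1..k}. t ^ i *\<^sub>R \<phi> i (graded_sum (of_real t) y + projN n)))
      \<longlongrightarrow> T (k+1) y + projN n + (\<Sum>i\<in>{1..k}. 0 ^ i *\<^sub>R \<phi> i (T (k+1) y + projN n))) (at_right 0)"
    by (intro tendsto_add[OF h'] tendsto_sum tendsto_scaleR tendsto_power idt
        bounded_linear.tendsto[OF phi_bounded_linear h'])
  moreover have "(\<Sum>i\<in>{1..k}. (0::real) ^ i *\<^sub>R \<phi> i (T (k+1) y + projN n)) = 0"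
    by (intro sum.neutral) auto
  ultimately show ?thesis by (simp add: W_def p_family_def sB_power)
qed

text \<open>The vector L(t) p_k(t) v for a real parameter t, with L expressed through the jet of
  \<open>G\<close>.\<close>

definition lin_part :: "real \<Rightarrow> 'a \<Rightarrow> 'b" where
  "lin_part t v = jetG (Suc 0) (z (of_real t)) [p_family sB k \<phi> (of_real t) v]"

lemma jetG_linear: "linear (\<lambda>h. jetG (Suc 0) x [h])"
  using lip_jet_bounded_linear[OF jetG UNIV_I, of "[]" x] r5 bounded_linear.linear by auto

lemma lin_part_linear: "linear (lin_part t)"
proof -
  have p: "linear (p_family sB k \<phi> (of_real t))"
    by (rule linearI)
       (simp_all add: p_family_def sB_power linear_add[OF bounded_linear.linear[OF phi_bounded_linear]]
         linear_cmul[OF bounded_linear.linear[OF phi_bounded_linear]] sum.distrib scaleR_add_right scaleR_sum_right mult.commute)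
  show ?thesis
    using linear_compose[OF p jetG_linear] unfolding lin_part_def[abs_def] o_def .
qed

text \<open>The order is \<open>i - 1\<close> because \<open>associated_sums\<close> pairs
  \<open>Nc (i+1)\<close> with the power \<epsilon>^i. The constant of that estimate may depend on
  \<open>v\<close>, so the result is a pointwise limit.\<close>

lemma lin_part_Nc:
  assumes i: "i \<in> {1..k+1}" and v: "v \<in> Nc i"
  shows "((\<lambda>t. (1 / t ^ (i - 1)) *\<^sub>R lin_part t v) \<longlongrightarrow> S i v) (at_right 0)"
proof -
  obtain j where j: "j \<le> k" "i = j + 1" using k_le[OF i] by blast
  have "\<forall>i\<le>k. \<forall>n\<in>Nc (i+1).
        (\<lambda>\<epsilon>. norm (frechet_derivative G (at (z \<epsilon>)) (p_family sB k \<phi> \<epsilon> n) - sC (\<epsilon> ^ i) (S (i+1) n)))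
          \<in> O[at 0](\<lambda>\<epsilon>. norm \<epsilon> ^ (i+1))"
    using assoc unfolding associated_sums_def by (elim conjE)
  then have "(\<lambda>\<epsilon>. norm (frechet_derivative G (at (z \<epsilon>)) (p_family sB k \<phi> \<epsilon> v) - sC (\<epsilon> ^ j) (S i v)))
          \<in> O[at 0](\<lambda>\<epsilon>. norm \<epsilon> ^ i)"
    using j v by simp
  then obtain c where "c > 0" and c: "eventually (\<lambda>\<epsilon>. norm (norm (frechet_derivative G (at (z \<epsilon>)) (p_family sB k \<phi> \<epsilon> v)
      - sC (\<epsilon> ^ j) (S i v))) \<le> c * norm (norm \<epsilon> ^ i)) (at 0)"
    by (rule landau_o.bigE)
  from c of_real_at_right have ev: "eventually (\<lambda>t. norm (lin_part t v - t ^ j *\<^sub>R S i v) \<le> c * \<bar>t\<bar> ^ i) (at_right 0)"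
    by (rule eventually_compose_filterlim[THEN eventually_mono]) (simp add: lin_part_def fd_G sC_power power_abs)
  have "((\<lambda>t. (1 / t ^ j) *\<^sub>R lin_part t v - S i v) \<longlongrightarrow> 0) (at_right 0)"
  proof (rule Lim_null_comparison[where g="\<lambda>t. c * t"])
    show "((\<lambda>t. c * t) \<longlongrightarrow> 0) (at_right 0)"
    proof -
      have "((\<lambda>t. c * t) \<longlongrightarrow> c * 0) (at_right (0::real))"
        by (intro tendsto_mult tendsto_const tendsto_ident_at)
      then show ?thesis by simp
    qed
    show "eventually (\<lambda>t. norm ((1 / t ^ j) *\<^sub>R lin_part t v - S i v) \<le> c * t) (at_right 0)"
      using ev eventually_at_right_less[of 0]
    proof eventually_elim
      case (elim t)
      have "(1 / t ^ j) *\<^sub>R lin_part t v - S i v = (1 / t ^ j) *\<^sub>R (lin_part t v - t ^ j *\<^sub>R S i v)"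
        using elim(2) by (simp add: scaleR_diff_right)
      then have "norm ((1 / t ^ j) *\<^sub>R lin_part t v - S i v) = norm (lin_part t v - t ^ j *\<^sub>R S i v) / t ^ j"
        using elim(2) by simp
      also have "\<dots> \<le> c * t ^ i / t ^ j" using elim by (intro divide_right_mono) auto
      also have "\<dots> = c * t" using elim(2) by (simp add: j(2))
      finally show ?case .
    qed
  qed
  then show ?thesis using j(2) by (simp add: LIM_zero_iff)
qed

lemma lin_part_N:
  assumes v: "v \<in> N"
  shows "((\<lambda>t. (1 / t ^ k) *\<^sub>R lin_part t v) \<longlongrightarrow> 0) (at_right 0)"
proof -
  have "\<forall>n\<in>N. (\<lambda>\<epsilon>. norm (frechet_derivative G (at (z \<epsilon>)) (p_family sB k \<phi> \<epsilon> n))) \<in> O[at 0](\<lambda>\<epsilon>. norm \<epsilon> ^ (k+1))"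
    using assoc unfolding associated_sums_def by (elim conjE)
  then have "(\<lambda>\<epsilon>. norm (frechet_derivative G (at (z \<epsilon>)) (p_family sB k \<phi> \<epsilon> v))) \<in> O[at 0](\<lambda>\<epsilon>. norm \<epsilon> ^ (k+1))"
    using v by (rule bspec)
  then obtain c where "c > 0" and c: "eventually (\<lambda>\<epsilon>. norm (norm (frechet_derivative G (at (z \<epsilon>)) (p_family sB k \<phi> \<epsilon> v)))
      \<le> c * norm (norm \<epsilon> ^ (k+1))) (at 0)"
    by (rule landau_o.bigE)
  from c of_real_at_right have ev: "eventually (\<lambda>t. norm (lin_part t v) \<le> c * \<bar>t\<bar> ^ (k+1)) (at_right 0)"
    by (rule eventually_compose_filterlim[THEN eventually_mono]) (simp add: lin_part_def fd_G power_abs abs_mult)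
  show ?thesis
  proof (rule Lim_null_comparison[where g="\<lambda>t. c * t"])
    show "((\<lambda>t. c * t) \<longlongrightarrow> 0) (at_right 0)"
    proof -
      have "((\<lambda>t. c * t) \<longlongrightarrow> c * 0) (at_right (0::real))"
        by (intro tendsto_mult tendsto_const tendsto_ident_at)
      then show ?thesis by simp
    qed
    show "eventually (\<lambda>t. norm ((1 / t ^ k) *\<^sub>R lin_part t v) \<le> c * t) (at_right 0)"
      using ev eventually_at_right_less[of 0]
    proof eventually_elim
      case (elim t)
      have "norm ((1 / t ^ k) *\<^sub>R lin_part t v) = norm (lin_part t v) / t ^ k"
        using elim(2) by simp
      also have "\<dots> \<le> c * t ^ (k+1) / t ^ k" using elim by (intro divide_right_mono) auto
      also have "\<dots> = c * t" using elim(2) by simp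
      finally show ?case .
    qed
  qed
qed

text \<open>The weights of the graded sum compensate the orders of L(t) p_k(t): the summand of index
  \<open>i\<close> has weight \<open>t ^ (k + 1 - i)\<close> and order \<open>i - 1\<close>,
  together \<open>t ^ k\<close>. After division the limits are \<open>S i (T i y)\<close>, whose sum
  is \<open>y\<close>; the part in \<open>N\<close> is of order k + 1 and disappears.\<close>

lemma linear_part_limit:
  "((\<lambda>t. (1 / t ^ k) *\<^sub>R jetG (Suc 0) (z (of_real t)) [W (of_real t) n y]) \<longlongrightarrow> y) (at_right 0)"
proof -
  have "((\<lambda>t. (\<Sum>i\<in>{1..k+1}. (1 / t ^ (i - 1)) *\<^sub>R lin_part t (T i y)) + (1 / t ^ k) *\<^sub>R lin_part t (projN n))
      \<longlongrightarrow> (\<Sum>i\<in>{1..k+1}. S i (T i y)) + 0) (at_right 0)"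
    by (intro tendsto_add tendsto_sum lin_part_Nc lin_part_N T_mem projN_mem)
  moreover have "(\<Sum>i\<in>{1..k+1}. S i (T i y)) = y"
    using sum_projR[of y] S_T by (metis (no_types, lifting) sum.cong)
  ultimately have "((\<lambda>t. (\<Sum>i\<in>{1..k+1}. (1 / t ^ (i - 1)) *\<^sub>R lin_part t (T i y)) + (1 / t ^ k) *\<^sub>R lin_part t (projN n)) \<longlongrightarrow> y) (at_right 0)"
    by simp
  then show ?thesis
  proof (rule Lim_transform_eventually[OF _ eventually_mono[OF eventually_at_right_less]])
    fix t :: real assume t: "0 < t"
    have "jetG (Suc 0) (z (of_real t)) [W (of_real t) n y] = lin_part t (graded_sum (of_real t) y + projN n)"
      by (simp add: lin_part_def W_def)
    also have "\<dots> = (\<Sum>i\<in>{1..k+1}. t ^ (k + 1 - i) *\<^sub>R lin_part t (T i y)) + lin_part t (projN n)"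
      by (simp add: linear_add[OF lin_part_linear] graded_sum_def sB_power linear_sum[OF lin_part_linear] linear_cmul[OF lin_part_linear] del: sum.cl_ivl_Suc)
    finally have eq: "(1 / t ^ k) *\<^sub>R jetG (Suc 0) (z (of_real t)) [W (of_real t) n y]
        = (\<Sum>i\<in>{1..k+1}. (1 / t ^ k) *\<^sub>R t ^ (k + 1 - i) *\<^sub>R lin_part t (T i y)) + (1 / t ^ k) *\<^sub>R lin_part t (projN n)"
      by (simp only: scaleR_add_right scaleR_sum_right)
    have "(1 / t ^ k) *\<^sub>R t ^ (k + 1 - i) *\<^sub>R v = (1 / t ^ (i - 1)) *\<^sub>R v" if "i \<in> {1..k+1}" for i and v :: 'b
    proof -
      have "t ^ k = t ^ (k + 1 - i) * t ^ (i - 1)" using that by (simp flip: power_add)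
      then show ?thesis using t by simp
    qed
    then show "(\<Sum>i\<in>{1..k+1}. (1 / t ^ (i - 1)) *\<^sub>R lin_part t (T i y)) + (1 / t ^ k) *\<^sub>R lin_part t (projN n)
        = (1 / t ^ k) *\<^sub>R jetG (Suc 0) (z (of_real t)) [W (of_real t) n y]"
      unfolding eq by (metis (no_types, lifting) sum.cong)
  qed
qed

lemma ansatz_real: "ansatz ((of_real t, n), y) = z (of_real t) + t ^ k *\<^sub>R W (of_real t) n y"
  by (simp add: ansatz_def sB_power)

text \<open>With \<open>w\<close> for the value of \<open>W\<close>, the terms of G(z + t^k w) =
  G(z) + t^k L w + t^(2k) B0(w, w) + remainder are divided by t^(2k). The first is of this order by
  the approximation hypothesis, the second because L w is of order k. The remainder is t^(2k) times
  a quantity tending to 0.\<close>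

lemma G_ansatz_limit:
  "((\<lambda>t. (1 / t ^ (2 * k)) *\<^sub>R G (ansatz ((of_real t, n), y)))
    \<longlongrightarrow> y + bbar 0 + B0 (T (k+1) y + projN n) (T (k+1) y + projN n)) (at_right 0)"
proof -
  let ?w = "\<lambda>t. W (of_real t) n y" and ?z = "\<lambda>t. z (of_real t)"
  let ?rem = "\<lambda>t. G (?z t + t ^ k *\<^sub>R ?w t) - G (?z t) - jetG (Suc 0) (?z t) [t ^ k *\<^sub>R ?w t] - B0 (t ^ k *\<^sub>R ?w t) (t ^ k *\<^sub>R ?w t)"
  have r3: "3 \<le> r" using r5 by simp
  have idt: "((\<lambda>t::real. t) \<longlongrightarrow> 0) (at_right 0)" by (rule tendsto_ident_at)
  have tk: "((\<lambda>t::real. t ^ k) \<longlongrightarrow> 0) (at_right 0)"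
    using tendsto_power[OF idt, of k] k_pos by simp
  have hk: "((\<lambda>t. t ^ k *\<^sub>R ?w t) \<longlongrightarrow> 0) (at_right 0)"
    using tendsto_scaleR[OF tk W_limit] by simp
  obtain d M where d: "d > 0" "M \<ge> 0" and M: "\<forall>a h. norm (a - 0) < d \<longrightarrow> norm (a + h - 0) < d \<longrightarrow>
    norm (jetG 0 (a + h) [] - jetG 0 a [] - jetG (Suc 0) a [h] - (1/2) *\<^sub>R jetG (Suc (Suc 0)) 0 [h, h])
      \<le> M * (norm h)\<^sup>2 * (norm h + norm (a - 0))"
    using jet_taylor2[OF jetG nsB nsC r3 UNIV_I, of 0] by (elim exE conjE)
  have ev1: "eventually (\<lambda>t. norm (?z t) < d) (at_right 0)"
    using order_tendstoD(2)[OF tendsto_norm[OF z_limit], of d] d(1) by simp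
  have ev2: "eventually (\<lambda>t. norm (?z t + t ^ k *\<^sub>R ?w t) < d) (at_right 0)"
    using order_tendstoD(2)[OF tendsto_norm[OF tendsto_add[OF z_limit hk]], of d] d(1) by simp
  have rem: "((\<lambda>t. (1 / t ^ (2 * k)) *\<^sub>R ?rem t) \<longlongrightarrow> 0) (at_right 0)"
  proof (rule Lim_null_comparison[where g="\<lambda>t. M * (norm (?w t))\<^sup>2 * (norm (t ^ k *\<^sub>R ?w t) + norm (?z t))"])
    show "((\<lambda>t. M * (norm (?w t))\<^sup>2 * (norm (t ^ k *\<^sub>R ?w t) + norm (?z t))) \<longlongrightarrow> 0) (at_right 0)"
    proof -
      have "((\<lambda>t. M * (norm (?w t))\<^sup>2 * (norm (t ^ k *\<^sub>R ?w t) + norm (?z t))) \<longlongrightarrow>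
          M * (norm (T (k+1) y + projN n))\<^sup>2 * (norm (0::'a) + norm (0::'a))) (at_right 0)"
        by (intro tendsto_mult tendsto_add tendsto_norm tendsto_power tendsto_const W_limit hk z_limit)
      then show ?thesis by simp
    qed
    show "eventually (\<lambda>t. norm ((1 / t ^ (2 * k)) *\<^sub>R ?rem t) \<le> M * (norm (?w t))\<^sup>2 * (norm (t ^ k *\<^sub>R ?w t) + norm (?z t))) (at_right 0)"
      using ev1 ev2 eventually_at_right_less[of 0]
    proof eventually_elim
      case (elim t)
      have "norm (?rem t) \<le> M * (norm (t ^ k *\<^sub>R ?w t))\<^sup>2 * (norm (t ^ k *\<^sub>R ?w t) + norm (?z t))"
        using M[rule_format, of "?z t" "t ^ k *\<^sub>R ?w t"] elim by (simp only: jetG0 B0_eq diff_0_right)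
      also have "(norm (t ^ k *\<^sub>R ?w t))\<^sup>2 = t ^ (2 * k) * (norm (?w t))\<^sup>2"
        by (simp add: power_mult_distrib power_even_abs flip: power_mult) (simp add: mult.commute)
      finally have "norm (?rem t) \<le> t ^ (2 * k) * (M * (norm (?w t))\<^sup>2 * (norm (t ^ k *\<^sub>R ?w t) + norm (?z t)))"
        by (simp only: mult_ac)
      then show ?case using elim(3) by (simp add: pos_divide_le_eq mult.commute)
    qed
  qed
  have "((\<lambda>t. (1 / t ^ k) *\<^sub>R jetG (Suc 0) (?z t) [?w t] + bbar (of_real t) + B0 (?w t) (?w t) + (1 / t ^ (2 * k)) *\<^sub>R ?rem t)
      \<longlongrightarrow> y + bbar 0 + B0 (T (k+1) y + projN n) (T (k+1) y + projN n) + 0) (at_right 0)"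
    by (intro tendsto_add linear_part_limit rem C_on_tendsto_0[OF bbar_smooth q_pos nsC] B0.tendsto W_limit)
  then have lim: "((\<lambda>t. (1 / t ^ k) *\<^sub>R jetG (Suc 0) (?z t) [?w t] + bbar (of_real t) + B0 (?w t) (?w t) + (1 / t ^ (2 * k)) *\<^sub>R ?rem t)
      \<longlongrightarrow> y + bbar 0 + B0 (T (k+1) y + projN n) (T (k+1) y + projN n)) (at_right 0)" by simp
  have evU: "eventually (\<lambda>t. (of_real t :: 'k) \<in> U) (at_right 0)"
    by (rule eventually_compose_filterlim[OF eventually_at_in_open'[OF U_open U_zero] of_real_at_right])
  have "eventually (\<lambda>t. (1 / t ^ k) *\<^sub>R jetG (Suc 0) (?z t) [?w t] + bbar (of_real t) + B0 (?w t) (?w t) + (1 / t ^ (2 * k)) *\<^sub>R ?rem t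
      = (1 / t ^ (2 * k)) *\<^sub>R G (ansatz ((of_real t, n), y))) (at_right 0)"
    using evU eventually_at_right_less[of 0]
  proof eventually_elim
    case (elim t)
    have t2: "t ^ (2 * k) = t ^ k * t ^ k" by (simp add: mult_2 power_add)
    have "G (?z t) = t ^ (2 * k) *\<^sub>R bbar (of_real t)" using approx[OF elim(1)] by (simp only: sC_power)
    moreover have "jetG (Suc 0) (?z t) [t ^ k *\<^sub>R ?w t] = t ^ k *\<^sub>R jetG (Suc 0) (?z t) [?w t]"
      by (rule linear_cmul[OF jetG_linear])
    moreover have "B0 (t ^ k *\<^sub>R ?w t) (t ^ k *\<^sub>R ?w t) = t ^ (2 * k) *\<^sub>R B0 (?w t) (?w t)"
      by (simp add: B0.scaleR_left B0.scaleR_right t2)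
    ultimately have "?rem t = G (ansatz ((of_real t, n), y)) - t ^ (2 * k) *\<^sub>R bbar (of_real t)
        - t ^ k *\<^sub>R jetG (Suc 0) (?z t) [?w t] - t ^ (2 * k) *\<^sub>R B0 (?w t) (?w t)"
      by (simp only: ansatz_real)
    then have "(1 / t ^ (2 * k)) *\<^sub>R ?rem t = (1 / t ^ (2 * k)) *\<^sub>R G (ansatz ((of_real t, n), y)) - bbar (of_real t)
        - (1 / t ^ k) *\<^sub>R jetG (Suc 0) (?z t) [?w t] - B0 (?w t) (?w t)"
      using elim(2) by (simp add: scaleR_diff_right t2)
    then show ?case by simp
  qed
  from Lim_transform_eventually[OF lim this] show ?thesis .
qed

end

section \<open>Taylor division in \<epsilon> and the implicit equation for \<open>y\<close>\<close>

context approximate_solution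
begin

interpretation B0: bounded_bilinear B0 by (rule B0_bilinear)

text \<open>Contracts only \<epsilon>, so that integration over \<open>t\<close> yields Taylor's
  formula in \<epsilon> with \<open>n\<close> and \<open>y\<close> fixed.\<close>

definition \<Lambda> :: "real \<Rightarrow> ('k \<times> 'a) \<times> 'b \<Rightarrow> ('k \<times> 'a) \<times> 'b" where
  "\<Lambda> t x = ((t *\<^sub>R fst (fst x), snd (fst x)), snd x)"

lemma \<Lambda>_linear: "linear (\<Lambda> t)"
  by (rule linearI) (simp_all add: \<Lambda>_def scaleR_add_right)

lemma \<Lambda>_norm: "t \<in> {0..1} \<Longrightarrow> norm (\<Lambda> t x) \<le> norm x"
proof -
  assume t: "t \<in> {0..1}"
  have 1: "norm (t *\<^sub>R fst (fst x)) \<le> norm (fst (fst x))"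
    using t by (simp add: mult_left_le_one_le)
  have 2: "norm (t *\<^sub>R fst (fst x), snd (fst x)) \<le> norm (fst x)"
    unfolding norm_prod_def fst_conv snd_conv using 1 by (intro real_sqrt_le_mono add_mono power_mono) auto
  then show ?thesis
    unfolding \<Lambda>_def norm_prod_def[of "((_, _), _)"] norm_prod_def[of x] fst_conv snd_conv
    by (intro real_sqrt_le_mono add_mono power_mono) auto
qed

lemma \<Lambda>_derivative: "((\<lambda>t. \<Lambda> t x) has_derivative (\<lambda>h. h *\<^sub>R ((fst (fst x), 0), 0))) (at t)"
  unfolding \<Lambda>_def
  by (auto intro!: derivative_eq_intros has_derivative_Pair)

lemma \<Lambda>_scale: "\<Lambda> t (sX c x) = sX c (\<Lambda> t x)"
  by (simp add: \<Lambda>_def prod_scale_def)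

lemma \<Lambda>_dom: "t \<in> {0..1} \<Longrightarrow> x \<in> dom \<delta> \<Longrightarrow> \<Lambda> t x \<in> dom \<delta>"
proof -
  assume t: "t \<in> {0..1}" and x: "x \<in> dom \<delta>"
  have "norm (t *\<^sub>R fst (fst x)) \<le> norm (fst (fst x))"
    using t by (simp add: mult_left_le_one_le)
  then show ?thesis using x by (auto simp: \<Lambda>_def)
qed

text \<open>\<open>G \<circ> ansatz\<close> vanishes to order \<open>2 * k\<close> in \<open>\<epsilon>\<close>, so the Taylor remainder in \<open>\<epsilon>\<close> divides
  out \<open>\<epsilon> ^ (2 * k)\<close> and leaves a function that is smooth in all variables.\<close>

lemma divided_equation:
  assumes \<delta>: "ball 0 \<delta> \<subseteq> U" "\<delta> > 0"
  shows "\<exists>DF. lip_jet sX sC (q + 1) (dom \<delta>) DF \<and>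
     (\<forall>x\<in>dom \<delta>. G (ansatz x) = sC (fst (fst x) ^ (2 * k)) (DF 0 x [])) \<and>
     (\<forall>n y. DF 0 ((0, n), y) [] = y + bbar 0 + B0 (T (k+1) y + projN n) (T (k+1) y + projN n))"
proof -
  define DH where "DH = (\<lambda>(j::nat) x vs. iter_deriv (\<lambda>x. G (ansatz x)) vs x)"
  have JH: "lip_jet sX sC r (dom \<delta>) DH"
    using lip_class_imp_lip_jet[OF open_dom G_ansatz_class[OF \<delta>(1)] nsX nsC] unfolding DH_def .
  have DH0: "DH 0 x [] = G (ansatz x)" for x by (simp add: DH_def)
  define E :: "('k \<times> 'a) \<times> 'b" where "E = ((1, 0), 0)"
  define es where "es = replicate (2 * k) E"
  have les: "length es = 2 * k" by (simp add: es_def)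
  define D1 where "D1 = (\<lambda>j x vs. DH (j + length es) x (vs @ es))"
  \<comment> \<open>By \<open>r_large\<close> the 2k-th derivative in \<epsilon> still has q + 2
    orders; the parameter integral then leaves q + 1.\<close>
  have J1: "lip_jet sX sC (Suc (q + 1)) (dom \<delta>) D1"
  proof -
    have "Suc (q + 1) + length es \<le> r" using r_large les by simp
    from lip_jet_shift[OF JH this] show ?thesis unfolding D1_def .
  qed
  \<comment> \<open>The kernel of the integral remainder of order 2k on the unit interval.\<close>
  define c where "c = (\<lambda>t::real. (1 - t) ^ (2 * k - 1) / fact (2 * k - 1))"
  have cc: "continuous_on {0..1} c" unfolding c_def by (intro continuous_intros) simp
  define DF where "DF = (\<lambda>j x vs. integral {0..1} (\<lambda>t. c t *\<^sub>R D1 j (\<Lambda> t x) (map (\<Lambda> t) vs)))"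
  have JF: "lip_jet sX sC (q + 1) (dom \<delta>) DF"
    using lip_jet_integral[where \<Lambda>=\<Lambda> and D=D1 and c=c and d\<Lambda>="\<lambda>x h. h *\<^sub>R ((fst (fst x), 0), 0)",
        OF J1 nsX nsC \<Lambda>_linear \<Lambda>_norm \<Lambda>_derivative \<Lambda>_scale \<Lambda>_dom cc]
    unfolding DF_def .
  have taylor: "G (ansatz x) = (\<Sum>i<2*k. sC (fst (fst x) ^ i) ((1 / fact i) *\<^sub>R DH i ((0, snd (fst x)), snd x) (replicate i E)))
      + sC (fst (fst x) ^ (2 * k)) (DF 0 x [])" if x: "x \<in> dom \<delta>" for x
  proof -
    let ?\<epsilon> = "fst (fst x)"
    let ?v = "((?\<epsilon>, 0), 0) :: ('k \<times> 'a) \<times> 'b"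
    have v: "?v = sX ?\<epsilon> E" by (simp add: E_def prod_scale_def)
    have \<Lambda>x: "\<Lambda> t x \<in> dom \<delta>" if "t \<in> {0..1}" for t using \<Lambda>_dom[OF that x] .
    have \<Lambda>0: "\<Lambda> 0 x = ((0, snd (fst x)), snd x)" and \<Lambda>1: "\<Lambda> 1 x = x" by (simp_all add: \<Lambda>_def)
    have rep: "DH i (\<Lambda> t x) (replicate i ?v) = sC (?\<epsilon> ^ i) (DH i (\<Lambda> t x) (replicate i E))"
      if "i \<le> 2 * k" "t \<in> {0..1}" for i t
      using multilin_replicate[OF lip_jet_multilin[OF JH _ \<Lambda>x[OF that(2)]] nsC, of i "[]" i ?\<epsilon> E] that r_large
      by (simp add: v)
    define Df where "Df = (\<lambda>i t. DH i (\<Lambda> t x) (replicate i ?v))"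
    have der: "(Df m has_vector_derivative Df (Suc m) t) (at t within {0..1})"
      if m: "m < 2 * k" and t: "0 \<le> t" "t \<le> 1" for m t
    proof -
      have t': "t \<in> {0..1}" using t by simp
      have "((\<lambda>x. DH m x (replicate m ?v)) has_derivative (\<lambda>h. DH (Suc m) (\<Lambda> t x) (h # replicate m ?v))) (at (\<Lambda> t x))"
        by (rule lip_jet_deriv[OF JH _ \<Lambda>x[OF t']]) (use m r_large in simp_all)
      from diff_chain_at[OF \<Lambda>_derivative this]
      have D: "(Df m has_derivative (\<lambda>h. DH (Suc m) (\<Lambda> t x) (h *\<^sub>R ?v # replicate m ?v))) (at t)"
        by (simp only: o_def Df_def)
      have "bounded_linear (\<lambda>h. DH (Suc (length (replicate m ?v))) (\<Lambda> t x) (h # replicate m ?v))"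
        by (rule lip_jet_bounded_linear[OF JH \<Lambda>x[OF t']]) (use m r_large in simp)
      from linear_cmul[OF bounded_linear.linear[OF this]]
      have "DH (Suc m) (\<Lambda> t x) (h *\<^sub>R ?v # replicate m ?v) = h *\<^sub>R Df (Suc m) t" for h
        by (simp only: length_replicate Df_def replicate_Suc)
      with D show ?thesis
        unfolding has_vector_derivative_def by (simp only: has_derivative_at_withinI)
    qed
    have "G (ansatz (\<Lambda> 1 x)) = (\<Sum>i<2*k. ((1 - 0) ^ i / fact i) *\<^sub>R Df i 0)
        + integral {0..1} (\<lambda>t. ((1 - t) ^ (2 * k - 1) / fact (2 * k - 1)) *\<^sub>R Df (2 * k) t)"
      by (rule Taylor_integral[where Df=Df and f="\<lambda>t. G (ansatz (\<Lambda> t x))" and p="2 * k" and a=0 and b=1])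
         (use k_pos der in \<open>auto simp: Df_def DH0\<close>)
    also have "integral {0..1} (\<lambda>t. ((1 - t) ^ (2 * k - 1) / fact (2 * k - 1)) *\<^sub>R Df (2 * k) t)
        = integral {0..1} (sC (?\<epsilon> ^ (2 * k)) \<circ> (\<lambda>t. c t *\<^sub>R D1 0 (\<Lambda> t x) []))"
    proof (rule integral_cong)
      fix t :: real assume "t \<in> {0..1}"
      from rep[OF order_refl this]
      show "((1 - t) ^ (2 * k - 1) / fact (2 * k - 1)) *\<^sub>R Df (2 * k) t = (sC (?\<epsilon> ^ (2 * k)) \<circ> (\<lambda>t. c t *\<^sub>R D1 0 (\<Lambda> t x) [])) t"
        by (simp add: Df_def c_def D1_def es_def normed_scale.scale_scaleR[OF nsC])
    qed
    also have "\<dots> = sC (?\<epsilon> ^ (2 * k)) (integral {0..1} (\<lambda>t. c t *\<^sub>R D1 0 (\<Lambda> t x) []))"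
    proof (rule integral_linear[OF integrable_continuous_real normed_scale.bounded_linear_scale[OF nsC]])
      show "continuous_on {0..1} (\<lambda>t. c t *\<^sub>R D1 0 (\<Lambda> t x) [])"
      proof (intro continuous_on_scaleR cc continuous_at_imp_continuous_on ballI)
        fix t :: real assume t: "t \<in> {0..1}"
        have "((\<lambda>x. D1 0 x []) has_derivative (\<lambda>h. D1 (Suc 0) (\<Lambda> t x) (h # []))) (at (\<Lambda> t x))"
          by (rule lip_jet_deriv[OF J1 _ \<Lambda>x[OF t]]) simp_all
        from has_derivative_continuous[OF diff_chain_at[OF \<Lambda>_derivative this]]
        show "isCont (\<lambda>t. D1 0 (\<Lambda> t x) []) t" by (simp only: o_def)
      qed
    qed
    also have "integral {0..1} (\<lambda>t. c t *\<^sub>R D1 0 (\<Lambda> t x) []) = DF 0 x []" by (simp add: DF_def)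
    also have "(\<Sum>i<2*k. ((1 - 0) ^ i / fact i) *\<^sub>R Df i 0)
        = (\<Sum>i<2*k. sC (?\<epsilon> ^ i) ((1 / fact i) *\<^sub>R DH i ((0, snd (fst x)), snd x) (replicate i E)))"
    proof (intro sum.cong refl)
      fix i assume "i \<in> {..<2 * k}"
      then have r: "DH i (\<Lambda> 0 x) (replicate i ?v) = sC (?\<epsilon> ^ i) (DH i (\<Lambda> 0 x) (replicate i E))"
        by (intro rep) auto
      show "((1 - 0) ^ i / fact i) *\<^sub>R Df i 0
          = sC (?\<epsilon> ^ i) ((1 / fact i) *\<^sub>R DH i ((0, snd (fst x)), snd x) (replicate i E))"
        unfolding Df_def r by (simp only: \<Lambda>0 normed_scale.scale_scaleR[OF nsC] diff_0_right power_one)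
    qed
    finally show ?thesis by (simp only: \<Lambda>1)
  qed
  \<comment> \<open>The divided function and \<open>DF\<close> both have limits as t tends to 0,
    hence so has the Taylor polynomial divided by t^(2k), and \<open>poly_coeff_zero\<close>
    annihilates its coefficients. The limit of the resulting zero function then identifies
    \<open>DF\<close> at \<epsilon> = 0.\<close>
  have zero: "(\<forall>i<2*k. (1 / fact i) *\<^sub>R DH i ((0, n), y) (replicate i E) = 0) \<and>
      DF 0 ((0, n), y) [] = y + bbar 0 + B0 (T (k+1) y + projN n) (T (k+1) y + projN n)" for n y
  proof -
    let ?a = "\<lambda>i. (1 / fact i) *\<^sub>R DH i ((0, n), y) (replicate i E)"
    let ?x = "\<lambda>t::real. ((of_real t, n), y) :: ('k \<times> 'a) \<times> 'b"
    let ?H = "y + bbar 0 + B0 (T (k+1) y + projN n) (T (k+1) y + projN n)"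
    have x0: "((0, n), y) \<in> dom \<delta>" using \<delta>(2) by simp
    have "((\<lambda>x. DF 0 x []) has_derivative (\<lambda>h. DF (Suc 0) ((0, n), y) (h # []))) (at ((0, n), y))"
      by (rule lip_jet_deriv[OF JF _ x0]) simp_all
    then have cF: "isCont (\<lambda>x. DF 0 x []) ((0, n), y)" by (rule has_derivative_continuous)
    have "(?x \<longlongrightarrow> ((of_real 0, n), y)) (at_right 0)"
      by (intro tendsto_Pair tendsto_of_real tendsto_ident_at tendsto_const)
    then have "(?x \<longlongrightarrow> ((0, n), y)) (at_right 0)" by simp
    from isCont_tendsto_compose[OF cF this]
    have limF: "((\<lambda>t. DF 0 (?x t) []) \<longlongrightarrow> DF 0 ((0, n), y) []) (at_right 0)" .
    have ev: "eventually (\<lambda>t::real. t \<in> {0<..<\<delta>}) (at_right 0)"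
      by (rule eventually_at_right_real[OF \<delta>(2)])
    have "eventually (\<lambda>t. (1 / t ^ (2 * k)) *\<^sub>R G (ansatz (?x t)) - DF 0 (?x t) [] = (1 / t ^ (2 * k)) *\<^sub>R (\<Sum>i<2*k. t ^ i *\<^sub>R ?a i)) (at_right 0)"
      using ev
    proof eventually_elim
      case (elim t)
      then have "?x t \<in> dom \<delta>" by simp
      from taylor[OF this] have "G (ansatz (?x t)) = (\<Sum>i<2*k. t ^ i *\<^sub>R ?a i) + t ^ (2 * k) *\<^sub>R DF 0 (?x t) []"
        by (simp only: fst_conv snd_conv sC_power)
      then show ?case using elim by (simp add: scaleR_add_right)
    qed
    from Lim_transform_eventually[OF tendsto_diff[OF G_ansatz_limit limF] this]
    have lim: "((\<lambda>t. (1 / t ^ (2 * k)) *\<^sub>R (\<Sum>i<2*k. t ^ i *\<^sub>R ?a i)) \<longlongrightarrow> ?H - DF 0 ((0, n), y) []) (at_right 0)" .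
    from poly_coeff_zero[OF this] have a: "\<forall>i<2*k. ?a i = 0" .
    then have "(\<lambda>t::real. (1 / t ^ (2 * k)) *\<^sub>R (\<Sum>i<2*k. t ^ i *\<^sub>R ?a i)) = (\<lambda>_. 0)"
      by (intro ext) simp
    with lim have "((\<lambda>t::real. 0) \<longlongrightarrow> ?H - DF 0 ((0, n), y) []) (at_right 0)" by (simp only:)
    from tendsto_unique[OF trivial_limit_at_right_real this tendsto_const]
    show ?thesis using a by simp
  qed
  have "G (ansatz x) = sC (fst (fst x) ^ (2 * k)) (DF 0 x [])" if x: "x \<in> dom \<delta>" for x
  proof -
    have "(\<Sum>i<2*k. sC (fst (fst x) ^ i) ((1 / fact i) *\<^sub>R DH i ((0, snd (fst x)), snd x) (replicate i E))) = 0"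
      using zero[THEN conjunct1] by (intro sum.neutral) (simp del: scaleR_eq_0_iff)
    then show ?thesis using taylor[OF x] by simp
  qed
  then show ?thesis using JF zero by (intro exI[of _ DF] conjI ballI allI) auto
qed

text \<open>The fixed point map is \<open>y\<close> minus the divided equation. At \<epsilon> = 0
  and n = 0 the identity part cancels, and the derivative at \<open>y0\<close> is minus the
  linearization of the quadratic term, of norm at most 1/4 by \<open>small\<close>; nearby it stays
  below 1/2. The bound \<eta> keeps the solution close to \<open>y0\<close>, as the smallness claim
  of case (i) requires.\<close>

lemma implicit_solution:
  assumes y0: "y0 + bbar 0 + B0 (T (k+1) y0) (T (k+1) y0) = 0"
    and small: "\<And>v. norm (B0 (T (k+1) y0) (T (k+1) v) + B0 (T (k+1) v) (T (k+1) y0)) \<le> norm v / 4"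
    and \<eta>: "\<eta> > 0"
  shows "\<exists>\<rho>>0. \<exists>Y. ball 0 \<rho> \<subseteq> U \<and> lip_class sP sC (q + 1) (ball 0 \<rho> \<times> ball 0 \<rho>) {Y} \<and>
    (\<forall>p\<in>ball 0 \<rho> \<times> ball 0 \<rho>. norm (Y p - y0) \<le> \<eta> \<and> G (ansatz (p, Y p)) = 0) \<and>
    (\<forall>n\<in>ball 0 \<rho>. Y (0, n) + bbar 0 + B0 (T (k+1) (Y (0, n)) + projN n) (T (k+1) (Y (0, n)) + projN n) = 0)"
proof -
  let ?T = "T (k+1)"
  obtain \<delta> where \<delta>: "\<delta> > 0" "ball 0 \<delta> \<subseteq> U" using U_open U_zero open_contains_ball by blast
  obtain DF where JF: "lip_jet sX sC (q + 1) (dom \<delta>) DF"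
    and F: "\<forall>x\<in>dom \<delta>. G (ansatz x) = sC (fst (fst x) ^ (2 * k)) (DF 0 x [])"
    and F0: "\<forall>n y. DF 0 ((0, n), y) [] = y + bbar 0 + B0 (?T y + projN n) (?T y + projN n)"
    using divided_equation[OF \<delta>(2,1)] by (elim exE conjE)
  have "lip_class sX sC (q + 1) (dom \<delta>) {\<lambda>x. DF 0 x []}"
    by (rule lip_class_jet_comp0[OF open_dom JF nsX nsC _ _ lip_class_ident[OF open_dom nsX]])
       (auto intro: continuous_on_id)
  from lip_class_linear_comp1[OF open_dom _ _ this, of uminus sC]
  have Fc: "lip_class sX sC (q + 1) (dom \<delta>) {\<lambda>x. - DF 0 x []}"
    by (simp add: bounded_linear_minus bounded_linear_ident)
  have "lip_class sX sC (q + 1) (dom \<delta>) {\<lambda>x. snd x}"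
    by (rule lip_class_linear[OF open_dom nsC]) (auto simp: prod_scale_def bounded_linear_snd)
  from lip_class_add1[OF open_dom nsC this Fc]
  have \<Psi>c: "lip_class sX sC (q + 1) (dom \<delta>) {\<lambda>x. snd x - DF 0 x []}" by simp
  define \<Psi> where "\<Psi> = (\<lambda>x. snd x - DF 0 x [])"
  define D where "D = (\<lambda>(j::nat) x vs. iter_deriv \<Psi> vs x)"
  have J: "lip_jet sX sC (q + 1) (dom \<delta>) D"
    unfolding D_def using lip_class_imp_lip_jet[OF open_dom \<Psi>c nsX nsC] unfolding \<Psi>_def .
  have D0: "D 0 x [] = \<Psi> x" for x by (simp add: D_def)
  have d\<Psi>: "(\<Psi> has_derivative (\<lambda>h. D (Suc 0) x [h])) (at x)" if "x \<in> dom \<delta>" for x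
    using lip_jet_deriv[OF J _ that, of 0 "[]"] by (simp add: D0)
  let ?x0 = "((0, 0), y0) :: ('k \<times> 'a) \<times> 'b"
  have x0: "?x0 \<in> dom \<delta>" using \<delta> by simp
  have projN0: "projN 0 = 0" by (rule linear_0[OF bounded_linear.linear[OF projN_bounded_linear]])
  have Tbl: "bounded_linear ?T" by (rule T_bounded_linear) simp
  have \<Psi>0: "\<Psi> ((0, 0), y) = - bbar 0 - B0 (?T y) (?T y)" for y
    using F0 by (simp add: \<Psi>_def projN0)
  have quarter: "norm (D (Suc 0) ?x0 [(0, v)]) \<le> norm v / 4" for v
  proof -
    have "((\<lambda>y. ((0, 0), y)) has_derivative (\<lambda>v. ((0, 0), v) :: ('k \<times> 'a) \<times> 'b)) (at y0)"
      by (intro has_derivative_Pair has_derivative_const has_derivative_ident has_derivative_eq_rhs[OF has_derivative_Pair]) 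
         (auto simp: zero_prod_def)
    from diff_chain_at[OF this d\<Psi>[OF x0]]
    have 1: "((\<lambda>y. - bbar 0 - B0 (?T y) (?T y)) has_derivative (\<lambda>v. D (Suc 0) ?x0 [((0, 0), v)])) (at y0)"
      by (simp only: o_def \<Psi>0)
    have "((\<lambda>y. - bbar 0 - B0 (?T y) (?T y)) has_derivative
        (\<lambda>v. 0 - (B0 (?T y0) (?T v) + B0 (?T v) (?T y0)))) (at y0)"
      by (intro has_derivative_diff has_derivative_const B0.FDERIV bounded_linear.has_derivative[OF Tbl] has_derivative_ident)
    from has_derivative_unique[OF 1 this]
    have "D (Suc 0) ?x0 [((0, 0), v)] = 0 - (B0 (?T y0) (?T v) + B0 (?T v) (?T y0))" by (rule fun_cong)
    then have "norm (D (Suc 0) ?x0 [((0, 0), v)]) = norm (B0 (?T y0) (?T v) + B0 (?T v) (?T y0))"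
      by (simp only: diff_0 norm_minus_cancel)
    then show ?thesis using small[of v] by (simp add: zero_prod_def)
  qed
  obtain d M where d: "d > 0" "M \<ge> 0" "ball ?x0 d \<subseteq> dom \<delta>" and M: "\<forall>j\<le>q + 1. \<forall>y\<in>ball ?x0 d. \<forall>vs. length vs = j \<longrightarrow>
      norm (D j y vs) \<le> M * prod_list (map norm vs)"
    using lip_jet_bounded[OF J x0] by (elim exE conjE)
  \<comment> \<open>The derivative varies with Lipschitz constant \<open>M\<close>, so within
    distance \<open>1 / (4 * (M + 1))\<close> it grows from 1/4 to at most 1/2. Since q is at least
    1, the jet has the second derivative behind this bound.\<close>
  define e where "e = min (min d (1 / (4 * (M + 1)))) \<eta>"
  have e: "e > 0" using d \<eta> by (simp add: e_def)
  have half: "norm (D (Suc 0) x [(0, v)]) \<le> norm v / 2" if x: "x \<in> ball ?x0 e" for x v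
  proof -
    have "norm (D (Suc 0) x [(0, v)] - D (Suc 0) ?x0 [(0, v)]) \<le> M * norm (x - ?x0) * prod_list (map norm [(0 :: 'k \<times> 'a, v)])"
    proof (rule lip_jet_lipschitz[OF J convex_ball d(3) _ d(2)])
      show "norm (D (Suc (Suc 0)) y vs) \<le> M * prod_list (map norm vs)"
        if "y \<in> ball ?x0 d" "length vs = Suc (Suc 0)" for y vs
        using M[rule_format, of "Suc (Suc 0)" y vs] that q_pos by simp
    qed (use x d(1) q_pos in \<open>auto simp: e_def\<close>)
    also have "\<dots> = M * norm (x - ?x0) * norm v" by (simp add: norm_Pair)
    also have "\<dots> \<le> (1 / 4) * norm v"
    proof (intro mult_right_mono norm_ge_zero)
      have nx: "norm (x - ?x0) < 1 / (4 * (M + 1))" using x by (simp add: e_def dist_norm norm_minus_commute)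
      have "M * norm (x - ?x0) \<le> (M + 1) * norm (x - ?x0)" by (intro mult_right_mono) auto
      also have "\<dots> \<le> (M + 1) * (1 / (4 * (M + 1)))" using nx d(2) by (intro mult_left_mono) auto
      also have "\<dots> = 1 / 4" using d(2) by simp
      finally show "M * norm (x - ?x0) \<le> 1 / 4" .
    qed
    finally have "norm (D (Suc 0) x [(0, v)] - D (Suc 0) ?x0 [(0, v)]) \<le> norm v / 4" by simp
    then show ?thesis using quarter[of v] norm_triangle_sub[of "D (Suc 0) x [(0, v)]" "D (Suc 0) ?x0 [(0, v)]"] by simp
  qed
  \<comment> \<open>Together with \<open>norm p < e / 2\<close> this keeps the distance to the base
    point below \<open>e\<close>.\<close>
  define e1 where "e1 = e / 4"
  have e1: "e1 > 0" "e1 \<le> \<eta>"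
  proof -
    have "e \<le> \<eta>" by (simp add: e_def)
    then show "e1 > 0" "e1 \<le> \<eta>" using e unfolding e1_def by linarith+
  qed
  have inb: "(p, y) \<in> ball ?x0 e" if "norm p < e / 2" "y \<in> cball y0 e1" for p :: "'k \<times> 'a" and y
  proof -
    have "dist ?x0 (p, y) \<le> dist (0, 0) p + dist y0 y"
      unfolding dist_Pair_Pair by (rule sqrt_sum_squares_le_sum) auto
    also have "dist (0, 0) p = norm p" by (simp add: dist_norm flip: zero_prod_def)
    finally show ?thesis using that e by (simp add: e1_def)
  qed
  have sub: "ball ?x0 e \<subseteq> dom \<delta>" using d(3) by (auto simp: e_def)
  have contr: "norm (\<Psi> (p, y) - \<Psi> (p, y')) \<le> (1 / 2) * norm (y - y')"
    if p: "norm p < e / 2" and y: "y \<in> cball y0 e1" "y' \<in> cball y0 e1" for p y y'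
  proof (rule differentiable_bound[OF convex_cball _ _ y])
    fix u assume u: "u \<in> cball y0 e1"
    have id: "((\<lambda>u. (p, u)) has_derivative (\<lambda>v. (0, v))) (at u)"
      by (intro has_derivative_Pair has_derivative_const has_derivative_ident)
    have "(p, u) \<in> dom \<delta>" using inb[OF p u] sub by blast
    note D\<Psi> = diff_chain_at[OF id d\<Psi>[OF this], unfolded o_def]
    show "((\<lambda>u. \<Psi> (p, u)) has_derivative (\<lambda>v. D (Suc 0) (p, u) [(0, v)])) (at u within cball y0 e1)"
      by (rule has_derivative_at_withinI[OF D\<Psi>])
    show "onorm (\<lambda>v. D (Suc 0) (p, u) [(0, v)]) \<le> 1 / 2"
      by (rule onorm_bound) (use half[OF inb[OF p u]] in simp_all)
  qed
  have \<Psi>x0: "\<Psi> ?x0 = y0"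
  proof -
    have "y0 + (bbar 0 + B0 (?T y0) (?T y0)) = 0" using y0 by (simp only: add.assoc)
    then have "y0 = - (bbar 0 + B0 (?T y0) (?T y0))" by (rule eq_neg_iff_add_eq_0[THEN iffD2])
    then show ?thesis unfolding \<Psi>0 by simp
  qed
  have c\<Psi>: "isCont \<Psi> x" if "x \<in> dom \<delta>" for x by (rule has_derivative_continuous[OF d\<Psi>[OF that]])
  have "isCont (\<lambda>p. \<Psi> (p, y0)) (0, 0)"
    by (rule isCont_o2[where f="\<lambda>p. (p, y0)" and a="(0, 0)" and g=\<Psi>, OF _ c\<Psi>[OF x0]]) (intro continuous_intros)
  then obtain e2 where e2: "e2 > 0" "\<And>p. dist p (0, 0) < e2 \<Longrightarrow> dist (\<Psi> (p, y0)) (\<Psi> ?x0) < e1 / 2"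
    unfolding continuous_at_eps_delta using e1(1) by (metis half_gt_zero_iff)
  \<comment> \<open>The final halving makes the sum of the two component norms smaller than both
    \<open>e / 2\<close> and \<open>e2\<close>, and keeps \<rho> below \<delta>.\<close>
  define \<rho> where "\<rho> = min (min (e / 2) e2) \<delta> / 2"
  have \<rho>: "\<rho> > 0" using e e2 \<delta> by (simp add: \<rho>_def)
  let ?S = "ball 0 \<rho> \<times> ball 0 \<rho> :: ('k \<times> 'a) set"
  have pn: "norm p < e / 2" "norm p < e2" if "p \<in> ?S" for p
  proof -
    obtain \<epsilon> n where p: "p = (\<epsilon>, n)" "norm \<epsilon> < \<rho>" "norm n < \<rho>" using \<open>p \<in> ?S\<close> by auto
    have "norm p \<le> norm \<epsilon> + norm n" unfolding p norm_Pair by (rule sqrt_sum_squares_le_sum) auto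
    then have "norm p < 2 * \<rho>" using p by simp
    then show "norm p < e / 2" "norm p < e2" by (simp_all add: \<rho>_def)
  qed
  have fixp: "\<exists>y. y \<in> cball y0 e1 \<and> \<Psi> (p, y) = y" if p: "p \<in> ?S" for p
  proof -
    have "\<exists>!y. y \<in> cball y0 e1 \<and> \<Psi> (p, y) = y"
    proof (rule Banach_fix[where c="1/2"])
      show "complete (cball y0 e1)" by (simp add: complete_eq_closed)
      show "cball y0 e1 \<noteq> {}" using e1 by simp
      \<comment> \<open>The centre moves by less than \<open>e1 / 2\<close>, and the contraction
        adds at most half of the radius.\<close>
      show "(\<lambda>y. \<Psi> (p, y)) ` cball y0 e1 \<subseteq> cball y0 e1"
      proof
        fix u assume "u \<in> (\<lambda>y. \<Psi> (p, y)) ` cball y0 e1"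
        then obtain y where y: "y \<in> cball y0 e1" "u = \<Psi> (p, y)" by blast
        have "norm (\<Psi> (p, y) - \<Psi> (p, y0)) \<le> (1 / 2) * norm (y - y0)"
          using contr[OF pn(1)[OF p] y(1), of y0] e1 by simp
        also have "\<dots> \<le> e1 / 2" using y(1) by (simp add: dist_norm norm_minus_commute)
        finally have 1: "norm (\<Psi> (p, y) - \<Psi> (p, y0)) \<le> e1 / 2" .
        have "dist p (0, 0) < e2" using pn(2)[OF p] by (simp add: dist_norm flip: zero_prod_def)
        from e2(2)[OF this] have 2: "norm (\<Psi> (p, y0) - y0) < e1 / 2" by (simp add: \<Psi>x0 dist_norm)
        have "norm (u - y0) \<le> norm (\<Psi> (p, y) - \<Psi> (p, y0)) + norm (\<Psi> (p, y0) - y0)"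
          unfolding y(2) using norm_triangle_ineq[of "\<Psi> (p, y) - \<Psi> (p, y0)" "\<Psi> (p, y0) - y0"] by simp
        then show "u \<in> cball y0 e1" using 1 2 by (simp add: dist_norm norm_minus_commute)
      qed
      show "dist (\<Psi> (p, y)) (\<Psi> (p, y')) \<le> 1 / 2 * dist y y'" if "y \<in> cball y0 e1" "y' \<in> cball y0 e1" for y y'
        using contr[OF pn(1)[OF p] that] by (simp add: dist_norm)
    qed auto
    then show ?thesis by blast
  qed
  then have "\<forall>p\<in>?S. \<exists>y. y \<in> cball y0 e1 \<and> \<Psi> (p, y) = y" by blast
  from bchoice[OF this] obtain Y where Y: "\<forall>p\<in>?S. Y p \<in> cball y0 e1 \<and> \<Psi> (p, Y p) = Y p"
    by (elim exE)
  have Ymem: "Y p \<in> cball y0 e1" and Yfp: "\<Psi> (p, Y p) = Y p" if "p \<in> ?S" for p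
    using Y[rule_format, OF that] by simp_all
  have YS: "(p, Y p) \<in> dom \<delta>" if "p \<in> ?S" for p
    using inb[OF pn(1)[OF that] Ymem[OF that]] sub by blast
  have contrY: "norm (\<Psi> (q, Y q) - \<Psi> (q, Y p)) \<le> norm (Y q - Y p) / 2" if "p \<in> ?S" "q \<in> ?S" for p q
    using contr[OF pn(1)[OF that(2)] Ymem[OF that(2)] Ymem[OF that(1)]] by simp
  have openS: "open ?S" by (intro open_Times open_ball)
  have Yc: "continuous_on ?S Y"
  proof (intro continuous_at_imp_continuous_on ballI)
    fix p assume p: "p \<in> ?S"
    have cp: "isCont (\<lambda>q. \<Psi> (q, Y p)) p"
      by (rule isCont_o2[where f="\<lambda>q. (q, Y p)" and a=p and g=\<Psi>, OF _ c\<Psi>[OF YS[OF p]]]) (intro continuous_intros)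
    \<comment> \<open>The factor 2 absorbs the contraction: \<open>norm (Y q - Y p)\<close> is at
      most half of itself plus the change of \<Psi> with \<open>Y p\<close> frozen.\<close>
    have "((\<lambda>q. 2 * norm (\<Psi> (q, Y p) - \<Psi> (p, Y p))) \<longlongrightarrow> 2 * norm (\<Psi> (p, Y p) - \<Psi> (p, Y p))) (at p)"
      by (intro tendsto_mult tendsto_norm tendsto_diff tendsto_const cp[unfolded isCont_def])
    then have lim0: "((\<lambda>q. 2 * norm (\<Psi> (q, Y p) - \<Psi> (p, Y p))) \<longlongrightarrow> 0) (at p)" by simp
    have "((\<lambda>q. Y q - Y p) \<longlongrightarrow> 0) (at p)"
    proof (rule Lim_null_comparison[OF _ lim0])
      have "eventually (\<lambda>q. q \<in> ?S) (at p)" using openS p by (rule eventually_at_in_open')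
      then show "eventually (\<lambda>q. norm (Y q - Y p) \<le> 2 * norm (\<Psi> (q, Y p) - \<Psi> (p, Y p))) (at p)"
      proof eventually_elim
        case (elim q)
        have "Y q - Y p = (\<Psi> (q, Y q) - \<Psi> (q, Y p)) + (\<Psi> (q, Y p) - \<Psi> (p, Y p))"
          using Yfp[OF elim] Yfp[OF p] by simp
        then have "norm (Y q - Y p) \<le> norm (\<Psi> (q, Y q) - \<Psi> (q, Y p)) + norm (\<Psi> (q, Y p) - \<Psi> (p, Y p))"
          by (metis norm_triangle_ineq)
        then show ?case using contrY[OF p elim] by simp
      qed
    qed
    then show "isCont Y p" unfolding isCont_def by (simp add: LIM_zero_iff)
  qed
  have Ycl: "lip_class sP sC (q + 1) ?S {Y}"
  proof (rule lip_class_implicit[OF openS J nsP nsC Yc YS])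
    show "norm (D (Suc 0) (p, Y p) [(0, v)]) \<le> norm v / 2" if "p \<in> ?S" for p v
      by (rule half[OF inb[OF pn(1)[OF that] Ymem[OF that]]])
    show "Y p = D 0 (p, Y p) []" if "p \<in> ?S" for p using Yfp[OF that] by (simp add: D0)
    show "norm (D 0 (q, Y q) [] - D 0 (q, Y p) []) \<le> norm (Y q - Y p) / 2" if "p \<in> ?S" "q \<in> ?S" for p q
      using contrY[OF that] by (simp add: D0)
  qed simp_all
  have FY: "DF 0 (p, Y p) [] = 0" if "p \<in> ?S" for p
  proof -
    show ?thesis using Yfp[OF that] by (simp add: \<Psi>_def)
  qed
  show ?thesis
  proof (rule exI[of _ \<rho>], intro conjI exI[of _ Y] ballI)
    have "\<rho> \<le> \<delta> / 2" by (simp add: \<rho>_def)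
    then have "ball 0 \<rho> \<subseteq> ball (0::'k) \<delta>" using \<delta>(1) by (intro subset_ball) simp
    then show "ball 0 \<rho> \<subseteq> U" using \<delta>(2) by simp
    fix p assume p: "p \<in> ?S"
    show "norm (Y p - y0) \<le> \<eta>" using Ymem[OF p] e1(2) by (simp add: dist_norm norm_minus_commute)
    show "G (ansatz (p, Y p)) = 0"
      by (simp only: bspec[OF F YS[OF p]] FY[OF p]
          linear_0[OF bounded_linear.linear[OF normed_scale.bounded_linear_scale[OF nsC]]])
  next
    fix n :: 'a assume "n \<in> ball 0 \<rho>"
    then have "(0, n) \<in> ?S" using \<rho> by simp
    from FY[OF this] show "Y (0, n) + bbar 0 + B0 (?T (Y (0, n)) + projN n) (?T (Y (0, n)) + projN n) = 0"
      using F0 by simp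
  qed (use \<rho> Ycl in simp_all)
qed

end

subsection \<open>The two cases\<close>

context approximate_solution
begin

interpretation B0: bounded_bilinear B0 by (rule B0_bilinear)

lemma last_index: "k + 1 \<in> {1..k+1}" by simp

lemma B0_scale_right: "B0 v (sB c w) = sC c (B0 v w)"
proof -
  have m: "multilin sB sC (Suc (Suc 0)) (jetG (Suc (Suc 0)) 0)"
    using lip_jet_multilin[OF jetG _ UNIV_I] r5 by simp
  show ?thesis
    using multilin_scale[OF m, of "[v]" "[]"] by (simp add: B0_eq normed_scale.scale_scaleR[OF nsC])
qed

text \<open>The components are recovered as \<open>T i (Y (\<epsilon>, n))\<close>. They inherit the
  order q + 1 from \<open>Y\<close>, and the return to \<open>C_on\<close> leaves the prescribed q.
  The formula for \<open>Y (0, n)\<close> is the source of all component formulas, obtained by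
  applying projections and the operators \<open>T i\<close>. The bound \<open>\<rho>0\<close> serves
  case (ii), where \<open>n\<close> must also be small enough for an operator to be
  invertible.\<close>

lemma solution_family_of_zero:
  assumes y0: "y0 + bbar 0 + B0 (T (k+1) y0) (T (k+1) y0) = 0"
    and small: "\<And>v. norm (B0 (T (k+1) y0) (T (k+1) v) + B0 (T (k+1) v) (T (k+1) y0)) \<le> norm v / 4"
    and \<eta>: "\<eta> > 0" and \<rho>0: "\<rho>0 > 0"
  shows "\<exists>V \<rho> Y. open V \<and> 0 \<in> V \<and> V \<subseteq> U \<and> 0 < \<rho> \<and> \<rho> \<le> \<rho>0 \<and>
    solution_family sB k q G z Nc N \<phi> V \<rho> (\<lambda>i \<epsilon> n. T i (Y (\<epsilon>, n))) \<and>
    (\<forall>\<epsilon>\<in>V. \<forall>n\<in>N \<inter> ball 0 \<rho>. norm (Y (\<epsilon>, n) - y0) \<le> \<eta>) \<and>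
    (\<forall>n\<in>N \<inter> ball 0 \<rho>. Y (0, n) = - (B0 (T (k+1) (Y (0, n)) + n) (T (k+1) (Y (0, n)) + n) + bbar 0))"
proof -
  obtain \<rho>1 Y where \<rho>1: "\<rho>1 > 0" "ball 0 \<rho>1 \<subseteq> U" and Yc: "lip_class sP sC (q + 1) (ball 0 \<rho>1 \<times> ball 0 \<rho>1) {Y}"
    and Y: "\<forall>p\<in>ball 0 \<rho>1 \<times> ball 0 \<rho>1. norm (Y p - y0) \<le> \<eta> \<and> G (ansatz (p, Y p)) = 0"
    and Y0: "\<forall>n\<in>ball 0 \<rho>1. Y (0, n) + bbar 0 + B0 (T (k+1) (Y (0, n)) + projN n) (T (k+1) (Y (0, n)) + projN n) = 0"
    using implicit_solution[OF y0 small \<eta>] by (elim exE conjE)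
  define \<rho> where "\<rho> = min \<rho>1 \<rho>0"
  have \<rho>: "0 < \<rho>" "\<rho> \<le> \<rho>0" "\<rho> \<le> \<rho>1" using \<rho>1 \<rho>0 by (simp_all add: \<rho>_def)
  let ?W = "ball 0 \<rho> \<times> ball 0 \<rho> :: ('k \<times> 'a) set"
  let ?nbar = "\<lambda>i \<epsilon> n. T i (Y (\<epsilon>, n))"
  have oW: "open ?W" by (intro open_Times open_ball)
  have sub: "?W \<subseteq> ball 0 \<rho>1 \<times> ball 0 \<rho>1" using \<rho>(3) by auto
  have YW: "lip_class sP sC (q + 1) ?W {Y}" by (rule lip_class_subset[OF Yc sub])
  have Tc: "lip_class sP sB (q + 1) ?W {\<lambda>p. T i (Y p)}" if "i \<in> {1..k+1}" for i
    by (rule lip_class_linear_comp1[OF oW T_bounded_linear[OF that] T_scale[OF that] YW])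
  have e: "lip_class sP (*) (q + 1) ?W {fst}"
    by (rule lip_class_linear[OF oW normed_scale_mult bounded_linear_fst]) (simp add: prod_scale_def)
  have hc: "lip_class sP sB (q + 1) ?W {\<lambda>p. \<Sum>i\<in>{1..k+1}. sB (fst p ^ (k + 1 - i)) (T i (Y p))}"
    by (rule lip_class_sum1[OF oW nsB finite_atLeastAtMost])
       (rule lip_class_scale1[OF oW nsB lip_class_power[OF oW e] Tc])
  have WE: "?W \<inter> (UNIV \<times> N) = ball 0 \<rho> \<times> (N \<inter> ball 0 \<rho>)" by auto
  have C: "C_on sP sB q (UNIV \<times> N) (ball 0 \<rho> \<times> (N \<inter> ball 0 \<rho>)) f" if "lip_class sP sB (q + 1) ?W {f}" for f
    using C_on_subspace[OF lip_class_imp_C_on[OF oW _ nsP nsB], of q f "UNIV \<times> N"] that WE by simp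
  have "solution_family sB k q G z Nc N \<phi> (ball 0 \<rho>) \<rho> ?nbar"
    unfolding solution_family_def
  proof (intro conjI ballI)
    show "C_on sP sB q (UNIV \<times> N) (ball 0 \<rho> \<times> (N \<inter> ball 0 \<rho>)) (\<lambda>(\<epsilon>, n). T i (Y (\<epsilon>, n)))"
      if "i \<in> {1..k+1}" for i
      using C[OF Tc[OF that]] by (simp add: case_prod_beta')
    show "C_on sP sB q (UNIV \<times> N) (ball 0 \<rho> \<times> (N \<inter> ball 0 \<rho>)) (\<lambda>(\<epsilon>, n). hat_map sB k ?nbar \<epsilon> n)"
      using C[OF hc] unfolding hat_map_def case_prod_beta' by (simp only: prod.collapse)
    fix \<epsilon> :: 'k and n assume \<epsilon>: "\<epsilon> \<in> ball 0 \<rho>" and n: "n \<in> N \<inter> ball 0 \<rho>"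
    show "T i (Y (\<epsilon>, n)) \<in> Nc i" if "i \<in> {1..k+1}" for i by (rule T_mem[OF that])
    have "(\<epsilon>, n) \<in> ball 0 \<rho>1 \<times> ball 0 \<rho>1" using \<epsilon> n \<rho>(3) by simp
    then have "G (ansatz ((\<epsilon>, n), Y (\<epsilon>, n))) = 0" using Y by blast
    then show "G (z \<epsilon> + sB (\<epsilon> ^ k) (p_family sB k \<phi> \<epsilon> (hat_map sB k ?nbar \<epsilon> n + n))) = 0"
      using projN_same[of n] n by (simp only: ansatz_def W_def graded_sum_def hat_map_def fst_conv snd_conv Int_iff)
  qed
  moreover have "norm (Y (\<epsilon>, n) - y0) \<le> \<eta>" if "\<epsilon> \<in> ball 0 \<rho>" "n \<in> N \<inter> ball 0 \<rho>" for \<epsilon> n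
  proof -
    have "(\<epsilon>, n) \<in> ball 0 \<rho>1 \<times> ball 0 \<rho>1" using that \<rho>(3) by simp
    then show ?thesis using Y by blast
  qed
  moreover have "Y (0, n) = - (B0 (T (k+1) (Y (0, n)) + n) (T (k+1) (Y (0, n)) + n) + bbar 0)"
    if n: "n \<in> N \<inter> ball 0 \<rho>" for n
  proof -
    have "n \<in> ball 0 \<rho>1" "projN n = n" using n \<rho>(3) projN_same by auto
    then have "Y (0, n) + bbar 0 + B0 (T (k+1) (Y (0, n)) + n) (T (k+1) (Y (0, n)) + n) = 0"
      using Y0 by metis
    then have "Y (0, n) + (B0 (T (k+1) (Y (0, n)) + n) (T (k+1) (Y (0, n)) + n) + bbar 0) = 0"
      by (simp only: add.assoc add.commute[of "bbar 0"])
    then show ?thesis by (rule eq_neg_iff_add_eq_0[THEN iffD2])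
  qed
  moreover have "ball 0 \<rho> \<subseteq> U" using \<rho>1(2) \<rho>(3) by (meson subset_ball order_trans)
  ultimately show ?thesis
    using \<rho> by (intro exI[of _ "ball 0 \<rho>"] exI[of _ \<rho>] exI[of _ Y]) simp
qed

lemma T_neg_formula:
  assumes i: "i \<in> {1..k+1}"
  shows "T i (- (a + b)) = - inv_into (Nc i) (S i) (projR i a + projR i b)"
proof -
  have "T i (- (a + b)) = - T i (a + b)" using linear_neg[OF bounded_linear.linear[OF T_bounded_linear[OF i]]] .
  moreover have "projR i (a + b) = projR i a + projR i b" using linear_add[OF bounded_linear.linear[OF projR_bounded_linear[OF i]]] .
  ultimately show ?thesis by (simp add: T_def)
qed

text \<open>Only \<open>B0\<close>, \<open>T (k+1)\<close> and the projection to
  \<open>R (k+1)\<close> occur here. The same three bounds, with one constant, define the smallness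
  threshold of case (i), which must not depend on other data of the problem.\<close>

lemma bilinear_bound:
  "\<exists>C\<ge>0. (\<forall>x v. norm (B0 (T (k+1) x) (T (k+1) v)) \<le> C * norm x * norm v) \<and>
     (\<forall>x v. norm (projR (k+1) (B0 (T (k+1) x) (T (k+1) v))) \<le> C * norm x * norm v) \<and>
     (\<forall>x. norm (T (k+1) x) \<le> C * norm x)"
proof -
  let ?T = "T (k+1)" and ?P = "projR (k+1)"
  have T: "bounded_linear ?T" and P: "bounded_linear ?P"
    using T_bounded_linear[OF last_index] projR_bounded_linear[OF last_index] .
  have BT: "bounded_bilinear (\<lambda>x v. B0 (?T x) (?T v))" by (rule B0.comp[OF T T])
  obtain K1 where K1: "\<And>x v. norm (B0 (?T x) (?T v)) \<le> norm x * norm v * K1"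
    using bounded_bilinear.nonneg_bounded[OF BT] by blast
  obtain K2 where K2: "K2 \<ge> 0" "\<And>x. norm (?P x) \<le> norm x * K2"
    using bounded_linear.nonneg_bounded[OF P] by blast
  obtain K3 where K3: "\<And>x. norm (?T x) \<le> norm x * K3"
    using bounded_linear.nonneg_bounded[OF T] by blast
  define C where "C = max (max \<bar>K1\<bar> (\<bar>K1\<bar> * K2)) \<bar>K3\<bar>"
  have C: "C \<ge> 0" "K1 \<le> C" "K1 * K2 \<le> C" "K3 \<le> C"
  proof -
    have "K1 * K2 \<le> \<bar>K1\<bar> * K2" using K2(1) by (intro mult_right_mono) auto
    then show "C \<ge> 0" "K1 \<le> C" "K1 * K2 \<le> C" "K3 \<le> C" unfolding C_def by linarith+
  qed
  have 1: "norm (B0 (?T x) (?T v)) \<le> C * norm x * norm v" for x v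
  proof -
    have "norm x * norm v * K1 \<le> norm x * norm v * C" using C by (intro mult_left_mono) auto
    with K1[of x v] show ?thesis by (simp add: mult_ac)
  qed
  have 2: "norm (?P (B0 (?T x) (?T v))) \<le> C * norm x * norm v" for x v
  proof -
    have "norm (?P (B0 (?T x) (?T v))) \<le> (norm x * norm v * K1) * K2"
      using K2(2)[of "B0 (?T x) (?T v)"] mult_right_mono[OF K1[of x v] K2(1)] by linarith
    also have "\<dots> = norm x * norm v * (K1 * K2)" by simp
    also have "\<dots> \<le> norm x * norm v * C" using C by (intro mult_left_mono) auto
    finally show ?thesis by (simp add: mult_ac)
  qed
  have 3: "norm (?T x) \<le> C * norm x" for x
  proof -
    have "norm x * K3 \<le> norm x * C" using C by (intro mult_left_mono) auto
    with K3[of x] show ?thesis by (simp add: mult_ac)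
  qed
  show ?thesis using C(1) 1 2 3 by (intro exI[of _ C]) simp
qed

text \<open>The quadratic term sees \<open>y0\<close> only through \<open>T (k+1) y0\<close>, that
  is, through the component \<open>x\<close> of \<open>y0\<close> in \<open>R (k+1)\<close>. A
  contraction on the ball of radius \<open>s\<close> determines \<open>x\<close>, and all of
  \<open>y0\<close> is then given explicitly. Therefore only the projection of \<open>bbar 0\<close>
  to \<open>R (k+1)\<close> has to be small.\<close>

lemma quadratic_solution:
  assumes C: "C \<ge> 0" and B: "\<And>x v. norm (projR (k+1) (B0 (T (k+1) x) (T (k+1) v))) \<le> C * norm x * norm v"
    and s: "s > 0" "C * s \<le> 1 / 8" and b: "norm (projR (k+1) (bbar 0)) < s / 2"
  shows "\<exists>x y0. norm x \<le> s \<and> T (k+1) y0 = T (k+1) x \<and> y0 + bbar 0 + B0 (T (k+1) y0) (T (k+1) y0) = 0"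
proof -
  let ?T = "T (k+1)" and ?P = "projR (k+1)"
  let ?\<Phi> = "\<lambda>x. - ?P (B0 (?T x) (?T x)) - ?P (bbar 0)"
  have P: "linear ?P" and T: "linear ?T"
    using projR_bounded_linear[OF last_index] T_bounded_linear[OF last_index] bounded_linear.linear by blast+
  have "\<exists>!x. x \<in> cball 0 s \<and> ?\<Phi> x = x"
  \<comment> \<open>The Lipschitz constant is \<open>2 * C * s\<close>, at most 1/4, and the ball is
    mapped into itself since \<open>s / 8 + s / 2 \<le> s\<close>.\<close>
  proof (rule Banach_fix[where c="1/4"])
    show "complete (cball 0 s :: 'b set)" by (simp add: complete_eq_closed)
    show "cball 0 s \<noteq> ({} :: 'b set)" using s by simp
    show "?\<Phi> ` cball 0 s \<subseteq> cball 0 s"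
    proof
      fix u assume "u \<in> ?\<Phi> ` cball 0 s"
      then obtain x where x: "norm x \<le> s" "u = ?\<Phi> x" by auto
      have "norm u \<le> norm (?P (B0 (?T x) (?T x))) + norm (?P (bbar 0))"
        unfolding x(2) using norm_triangle_ineq4[of "- ?P (B0 (?T x) (?T x))" "?P (bbar 0)"] by simp
      also have "\<dots> \<le> C * norm x * norm x + s / 2" using B b by (intro add_mono) (auto intro: less_imp_le)
      also have "C * norm x * norm x \<le> (C * s) * s" using x(1) C s by (intro mult_mono) auto
      also have "(C * s) * s \<le> 1 / 8 * s" using s by (intro mult_right_mono) auto
      finally show "u \<in> cball 0 s" using s(1) by simp
    qed
    fix x y :: 'b assume xy: "x \<in> cball 0 s" "y \<in> cball 0 s"
    have "?\<Phi> x - ?\<Phi> y = - (?P (B0 (?T (x - y)) (?T x)) + ?P (B0 (?T y) (?T (x - y))))"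
      by (simp only: linear_diff[OF T] B0.diff_left B0.diff_right linear_diff[OF P]) simp
    then have "norm (?\<Phi> x - ?\<Phi> y) \<le> norm (?P (B0 (?T (x - y)) (?T x))) + norm (?P (B0 (?T y) (?T (x - y))))"
      by (metis norm_minus_cancel norm_triangle_ineq)
    also have "\<dots> \<le> C * norm (x - y) * norm x + C * norm y * norm (x - y)" by (intro add_mono B)
    also have "\<dots> = C * (norm x + norm y) * norm (x - y)" by (simp add: algebra_simps)
    also have "\<dots> \<le> C * (s + s) * norm (x - y)"
      using xy C by (intro mult_right_mono mult_left_mono add_mono) auto
    also have "\<dots> \<le> 1 / 4 * norm (x - y)" using s(2) by (intro mult_right_mono) auto
    finally show "dist (?\<Phi> x) (?\<Phi> y) \<le> 1 / 4 * dist x y" by (simp add: dist_norm)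
  qed auto
  then obtain x where x: "x \<in> cball 0 s" "?\<Phi> x = x" by blast
  define y0 where "y0 = - bbar 0 - B0 (?T x) (?T x)"
  have "?P y0 = ?\<Phi> x" by (simp only: y0_def linear_diff[OF P] linear_neg[OF P]) (simp add: algebra_simps)
  then have Py: "?P y0 = x" using x by simp
  have "?P x = x" using projR_same[OF last_index projR_mem[OF last_index, of y0]] unfolding Py .
  then have "?T y0 = ?T x" unfolding T_def Py by (rule arg_cong[OF sym])
  moreover have "y0 + bbar 0 + B0 (?T x) (?T x) = 0" by (simp add: y0_def)
  ultimately show ?thesis using x(1) by (intro exI[of _ x] exI[of _ y0]) simp
qed

lemma case_small_residual:
  assumes C: "C \<ge> 0" and B1: "\<And>x v. norm (B0 (T (k+1) x) (T (k+1) v)) \<le> C * norm x * norm v"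
    and B2: "\<And>x v. norm (projR (k+1) (B0 (T (k+1) x) (T (k+1) v))) \<le> C * norm x * norm v"
    and B3: "\<And>x. norm (T (k+1) x) \<le> C * norm x"
    and \<eta>: "\<eta> > 0" and s: "s > 0" "C * s \<le> 1 / 8" "C * s \<le> \<eta> / 4" and b: "norm (projR (k+1) (bbar 0)) < s / 2"
  shows "\<exists>V \<rho> nbar. open V \<and> 0 \<in> V \<and> V \<subseteq> U \<and> 0 < \<rho> \<and>
          solution_family sB k q G z Nc N \<phi> V \<rho> nbar \<and>
          (\<forall>\<epsilon>\<in>V. \<forall>n \<in> N \<inter> ball 0 \<rho>. norm (nbar (k+1) \<epsilon> n) < \<eta>) \<and>
          (\<forall>n \<in> N \<inter> ball 0 \<rho>.
             S (k+1) (nbar (k+1) 0 n) + projR (k+1) (B0 (nbar (k+1) 0 n + n) (nbar (k+1) 0 n + n))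
               + projR (k+1) (bbar 0) = 0 \<and>
             (\<forall>i\<in>{1..k}. nbar i 0 n =
                - inv_into (Nc i) (S i)
                    (projR i (B0 (nbar (k+1) 0 n + n) (nbar (k+1) 0 n + n)) + projR i (bbar 0))))"
proof -
  let ?T = "T (k+1)" and ?P = "projR (k+1)"
  have P: "linear ?P" and T: "linear ?T"
    using projR_bounded_linear[OF last_index] T_bounded_linear[OF last_index] bounded_linear.linear by blast+
  obtain x y0 where x: "norm x \<le> s" "?T y0 = ?T x" and y0: "y0 + bbar 0 + B0 (?T y0) (?T y0) = 0"
    using quadratic_solution[OF C B2 s(1,2) b] by (elim exE conjE)
  have small: "norm (B0 (?T y0) (?T v) + B0 (?T v) (?T y0)) \<le> norm v / 4" for v
  proof -
    have "norm (B0 (?T y0) (?T v) + B0 (?T v) (?T y0)) \<le> C * norm x * norm v + C * norm v * norm x"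
      unfolding x(2) using B1 by (intro norm_triangle_mono)
    also have "\<dots> = 2 * (C * norm x) * norm v" by simp
    also have "\<dots> \<le> 2 * (C * s) * norm v" using x(1) C by (intro mult_right_mono mult_left_mono) auto
    also have "\<dots> \<le> 2 * (1 / 8) * norm v" using s(2) by (intro mult_right_mono mult_left_mono) auto
    finally show ?thesis by simp
  qed
  \<comment> \<open>Chosen so that \<open>C * \<eta>'\<close> is at most \<open>\<eta> / 4\<close>;
    with \<open>C * s \<le> \<eta> / 4\<close> the last component stays below \<eta>.\<close>
  define \<eta>' where "\<eta>' = \<eta> / 4 / (C + 1)"
  have \<eta>': "\<eta>' > 0" using \<eta> C by (simp add: \<eta>'_def)
  have C\<eta>': "C * \<eta>' \<le> \<eta> / 4"
  proof -
    have "C * \<eta>' \<le> (C + 1) * \<eta>'" using \<eta>' by (intro mult_right_mono) auto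
    also have "\<dots> = \<eta> / 4"
    proof -
      have "C + 1 \<noteq> 0" using C by simp
      then have "\<eta> / 4 / (C + 1) * (C + 1) = \<eta> / 4" by (rule iffD1[OF nonzero_eq_divide_eq refl])
      then show ?thesis by (simp only: \<eta>'_def mult.commute)
    qed
    finally show ?thesis .
  qed
  obtain V \<rho> Y where V: "open V" "0 \<in> V" "V \<subseteq> U" "0 < \<rho>"
    and sol: "solution_family sB k q G z Nc N \<phi> V \<rho> (\<lambda>i \<epsilon> n. T i (Y (\<epsilon>, n)))"
    and Yn: "\<forall>\<epsilon>\<in>V. \<forall>n\<in>N \<inter> ball 0 \<rho>. norm (Y (\<epsilon>, n) - y0) \<le> \<eta>'"
    and Y0: "\<forall>n\<in>N \<inter> ball 0 \<rho>. Y (0, n) = - (B0 (?T (Y (0, n)) + n) (?T (Y (0, n)) + n) + bbar 0)"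
    using solution_family_of_zero[OF y0 small \<eta>' zero_less_one] by (elim exE conjE)
  show ?thesis
  proof (rule exI[of _ V], rule exI[of _ \<rho>], rule exI[of _ "\<lambda>i \<epsilon> n. T i (Y (\<epsilon>, n))"], intro conjI V sol ballI)
    fix \<epsilon> n assume en: "\<epsilon> \<in> V" "n \<in> N \<inter> ball 0 \<rho>"
    have "?T (Y (\<epsilon>, n)) = ?T x + ?T (Y (\<epsilon>, n) - y0)" unfolding x(2)[symmetric] linear_diff[OF T] by simp
    then have "norm (?T (Y (\<epsilon>, n))) \<le> norm (?T x) + norm (?T (Y (\<epsilon>, n) - y0))" by (metis norm_triangle_ineq)
    also have "\<dots> \<le> C * norm x + C * norm (Y (\<epsilon>, n) - y0)" by (intro add_mono B3)
    also have "\<dots> \<le> C * s + C * \<eta>'" using x(1) Yn en C by (intro add_mono mult_left_mono) auto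
    also have "\<dots> < \<eta>" using s(3) C\<eta>' \<eta> by simp
    finally show "norm (?T (Y (\<epsilon>, n))) < \<eta>" .
  next
    fix n assume n: "n \<in> N \<inter> ball 0 \<rho>"
    let ?c = "?T (Y (0, n))"
    have Y: "Y (0, n) = - (B0 (?c + n) (?c + n) + bbar 0)" using Y0 n by (rule bspec)
    have "S (k+1) ?c = ?P (Y (0, n))" by (rule S_T[OF last_index])
    also have "\<dots> = ?P (- (B0 (?c + n) (?c + n) + bbar 0))" by (rule arg_cong[OF Y])
    also have "\<dots> = - (?P (B0 (?c + n) (?c + n)) + ?P (bbar 0))" by (simp only: linear_neg[OF P] linear_add[OF P])
    finally show "S (k+1) ?c + ?P (B0 (?c + n) (?c + n)) + ?P (bbar 0) = 0" by simp
    fix i assume i: "i \<in> {1..k}"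
    have "T i (Y (0, n)) = T i (- (B0 (?c + n) (?c + n) + bbar 0))" by (rule arg_cong[OF Y])
    also have "\<dots> = - inv_into (Nc i) (S i) (projR i (B0 (?c + n) (?c + n)) + projR i (bbar 0))"
      by (rule T_neg_formula) (use i in simp)
    finally show "T i (Y (0, n)) = - inv_into (Nc i) (S i) (projR i (B0 (?c + n) (?c + n)) + projR i (bbar 0))" .
  qed
qed

text \<open>On \<open>Nc (k+1)\<close> the operator is \<open>S (k+1)\<close> followed by
  \<open>I - A'\<close>, where \<open>A'\<close> sends \<open>x\<close> to minus twice the
  projection of \<open>B0 n (T (k+1) x)\<close>, because \<open>T (k+1)\<close> inverts
  \<open>S (k+1)\<close> there. By \<open>half\<close> the resolvent of \<open>A'\<close> inverts
  the second factor, and following it by \<open>T (k+1)\<close> gives the inverse sought.\<close>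

lemma perturbed_GL_on:
  assumes half: "\<And>x. norm (2 *\<^sub>R projR (k+1) (B0 n (T (k+1) x))) \<le> norm x / 2"
  shows "GL_on sB sC (Nc (k+1)) (R (k+1)) (\<lambda>v. S (k+1) v + 2 *\<^sub>R projR (k+1) (B0 n v))"
    (is "GL_on _ _ ?X ?Y ?A")
proof -
  let ?T = "T (k+1)" and ?P = "projR (k+1)"
  note li = last_index
  have P: "linear ?P" and T: "linear ?T"
    using projR_bounded_linear[OF li] T_bounded_linear[OF li] bounded_linear.linear by blast+
  have X: "B.subspace ?X" and Y: "C.subspace ?Y" using subspace_Nc[OF li] subspace_R[OF li] .
  have GL: "GL_on sB sC ?X ?Y (S (k+1))" and op: "bounded_operator sB sC (S (k+1))" using S_op[OF li] by blast+
  have Sbl: "bounded_linear (S (k+1))" using op by (simp add: bounded_operator_def)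
  have Shom: "S (k+1) (sB c v) = sC c (S (k+1) v)" for c v
    using op unfolding bounded_operator_def by (meson Vector_Spaces.linear.axioms(3) Vector_Spaces.linear_def module_hom.scale)
  have Sbij: "bij_betw (S (k+1)) ?X ?Y" using GL unfolding GL_on_def by blast
  have inv: "?T (S (k+1) v) = v" if "v \<in> ?X" for v
  proof -
    have "S (k+1) v \<in> ?Y" using Sbij that by (auto simp: bij_betw_def)
    then show ?thesis
      unfolding T_def projR_same[OF li \<open>S (k+1) v \<in> ?Y\<close>]
      using Sbij that by (intro inv_into_f_f) (auto simp: bij_betw_def)
  qed
  have Ybl: "bounded_linear (\<lambda>v. 2 *\<^sub>R ?P (B0 n v))"
    by (intro bounded_linear_compose[OF bounded_linear_scaleR_right] bounded_linear_compose[OF projR_bounded_linear[OF li]] B0.bounded_linear_right)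
  have Abl: "bounded_linear ?A" by (rule bounded_linear_add[OF Sbl Ybl])
  let ?A' = "\<lambda>x. - (2 *\<^sub>R ?P (B0 n (?T x)))"
  have A'lin: "linear ?A'"
    by (rule bounded_linear.linear[OF bounded_linear_minus[OF bounded_linear_compose[OF Ybl T_bounded_linear[OF li]]]])
  have A'half: "norm (?A' x) \<le> norm x / 2" for x using half[of x] by simp
  have YR: "2 *\<^sub>R ?P v \<in> ?Y" for v
    using C.subspace_scale[OF Y projR_mem[OF li], of "of_real 2" v] by (simp only: normed_scale.scale_of_real[OF nsC])
  have memA: "?A v \<in> ?Y" if "v \<in> ?X" for v
  proof -
    have "S (k+1) v \<in> ?Y" using Sbij that by (auto simp: bij_betw_def)
    then show ?thesis by (intro C.subspace_add[OF Y] YR)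
  qed
  have surj: "?T (resolvent ?A' y) \<in> ?X \<and> ?A (?T (resolvent ?A' y)) = y" if y: "y \<in> ?Y" for y
  proof
    let ?x = "resolvent ?A' y"
    show "?T ?x \<in> ?X" by (rule T_mem[OF li])
    have eq: "?x = y + ?A' ?x" by (rule resolvent_eq[OF A'lin A'half])
    \<comment> \<open>By its fixed point equation the resolvent of \<open>y\<close> stays in
      \<open>R (k+1)\<close>, where \<open>S (k+1)\<close> after \<open>T (k+1)\<close> is the
      identity.\<close>
    have "y + ?A' ?x \<in> ?Y" by (intro C.subspace_add[OF Y y] C.subspace_neg[OF Y] YR)
    then have "?x \<in> ?Y" using eq by metis
    then have "S (k+1) (?T ?x) = ?x" unfolding S_T[OF li] by (rule projR_same[OF li])
    then have "?A (?T ?x) = ?x - ?A' ?x" by simp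
    also have "\<dots> = y" using eq by (metis add_diff_cancel_right')
    finally show "?A (?T ?x) = y" .
  qed
  have inj: "v = v'" if v: "v \<in> ?X" "v' \<in> ?X" "?A v = ?A v'" for v v'
  proof -
    have d: "v - v' \<in> ?X" by (rule B.subspace_diff[OF X v(1,2)])
    have "?A (v - v') = 0" using v(3) linear_diff[OF bounded_linear.linear[OF Abl], of v v'] by simp
    then have e1: "S (k+1) (v - v') = - (2 *\<^sub>R ?P (B0 n (v - v')))" by (rule eq_neg_iff_add_eq_0[THEN iffD2])
    have e2: "0 + ?A' (S (k+1) (v - v')) = - (2 *\<^sub>R ?P (B0 n (v - v')))" by (simp only: inv[OF d] add_0)
    have "S (k+1) (v - v') = 0 + ?A' (S (k+1) (v - v'))" by (rule trans[OF e1 e2[symmetric]])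
    from resolvent_unique[OF A'lin A'half this] have "S (k+1) (v - v') = resolvent ?A' 0" by simp
    also have "\<dots> = 0" using linear_0[OF bounded_linear.linear[OF bounded_linear_resolvent[OF A'lin A'half]]] .
    finally have "v - v' = ?T 0" using inv[OF d] by simp
    then show ?thesis using linear_0[OF T] by simp
  qed
  have bij: "bij_betw ?A ?X ?Y"
    unfolding bij_betw_def
  proof
    show "inj_on ?A ?X" using inj by (rule inj_onI)
    show "?A ` ?X = ?Y"
    proof
      show "?A ` ?X \<subseteq> ?Y" using memA by (rule image_subsetI)
      show "?Y \<subseteq> ?A ` ?X"
      proof
        fix y assume "y \<in> ?Y"
        from surj[OF this] show "y \<in> ?A ` ?X" by (intro image_eqI[of _ _ "?T (resolvent ?A' y)"]) simp_all
      qed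
    qed
  qed
  show ?thesis
    unfolding GL_on_def
  proof (intro conjI ballI allI bij)
    show "?A (x + y) = ?A x + ?A y" for x y by (rule linear_add[OF bounded_linear.linear[OF Abl]])
    show "?A (sB c v) = sC c (?A v)" for c v
      by (simp only: Shom B0_scale_right projR_scale[OF li] normed_scale.scale_scaleR[OF nsC] C.scale_right_distrib)
    obtain K where "\<And>x. norm (?A x) \<le> norm x * K" using bounded_linear.bounded[OF Abl] by blast
    then show "\<exists>M. \<forall>x\<in>?X. norm (?A x) \<le> M * norm x" by (intro exI[of _ K]) (simp add: mult.commute)
    obtain K1 where K1: "K1 \<ge> 0" "\<And>x. norm (?T x) \<le> norm x * K1"
      using bounded_linear.nonneg_bounded[OF T_bounded_linear[OF li]] by blast
    have "norm (inv_into ?X ?A y) \<le> (2 * K1) * norm y" if y: "y \<in> ?Y" for y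
    proof -
      have "inv_into ?X ?A y = ?T (resolvent ?A' y)"
      proof -
        have "inj_on ?A ?X" using bij by (rule bij_betw_imp_inj_on)
        from inv_into_f_f[OF this conjunct1[OF surj[OF y]]] show ?thesis
          unfolding conjunct2[OF surj[OF y]] .
      qed
      then have "norm (inv_into ?X ?A y) \<le> norm (resolvent ?A' y) * K1" using K1(2) by simp
      also have "\<dots> \<le> (2 * norm y) * K1" by (intro mult_right_mono norm_resolvent[OF A'lin A'half] K1(1))
      finally show ?thesis by (simp only: mult_ac)
    qed
    then show "\<exists>M. \<forall>y\<in>?Y. norm (inv_into ?X ?A y) \<le> M * norm y" by (intro exI[of _ "2 * K1"] ballI)
  qed
qed

text \<open>If \<open>B0\<close> vanishes on the diagonal of \<open>Nc (k+1)\<close>, polarization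
  annihilates its symmetrization there. So \<open>y0 = - bbar 0\<close> solves the equation at n = 0
  exactly, and the derivative that \<open>solution_family_of_zero\<close> wants small is 0, however
  large the residual. At \<epsilon> = 0 the equation is affine in the unknown component, whence the
  explicit formula.\<close>

lemma case_flat:
  assumes flat: "\<forall>n\<in>Nc (k+1). B0 n n = 0"
  shows "\<exists>V \<rho> nbar. open V \<and> 0 \<in> V \<and> V \<subseteq> U \<and> 0 < \<rho> \<and>
          solution_family sB k q G z Nc N \<phi> V \<rho> nbar \<and>
          (\<forall>n \<in> N \<inter> ball 0 \<rho>.
             GL_on sB sC (Nc (k+1)) (R (k+1)) (\<lambda>v. S (k+1) v + 2 *\<^sub>R projR (k+1) (B0 n v)) \<and>
             nbar (k+1) 0 n =
               - inv_into (Nc (k+1)) (\<lambda>v. S (k+1) v + 2 *\<^sub>R projR (k+1) (B0 n v)) (projR (k+1) (B0 n n + bbar 0)) \<and>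
             (\<forall>i\<in>{1..k}. nbar i 0 n =
                - inv_into (Nc i) (S i)
                    (projR i (B0 (nbar (k+1) 0 n + n) (nbar (k+1) 0 n + n)) + projR i (bbar 0))))"
proof -
  let ?T = "T (k+1)" and ?P = "projR (k+1)" and ?X = "Nc (k+1)"
  note li = last_index
  have P: "linear ?P" and T: "linear ?T"
    using projR_bounded_linear[OF li] T_bounded_linear[OF li] bounded_linear.linear by blast+
  have X: "B.subspace ?X" by (rule subspace_Nc[OF li])
  have TX: "?T y \<in> ?X" for y by (rule T_mem[OF li])
  have polar: "B0 a b + B0 b a = 0" if "a \<in> ?X" "b \<in> ?X" for a b
  proof -
    have "B0 (a + b) (a + b) = 0" "B0 a a = 0" "B0 b b = 0"
      using flat that B.subspace_add[OF X] by blast+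
    then show ?thesis by (simp add: B0.add_left B0.add_right add.commute)
  qed
  define y0 where "y0 = - bbar 0"
  have "B0 (?T y0) (?T y0) = 0" using flat TX by blast
  then have y0: "y0 + bbar 0 + B0 (?T y0) (?T y0) = 0" by (simp add: y0_def)
  have small: "norm (B0 (?T y0) (?T v) + B0 (?T v) (?T y0)) \<le> norm v / 4" for v
    using polar[OF TX TX, of y0 v] by simp
  have "bounded_bilinear (\<lambda>n x. B0 n (?T x))"
    by (rule B0.comp[OF bounded_linear_ident T_bounded_linear[OF li]])
  then obtain K1 where K1: "K1 \<ge> 0" "\<And>n x. norm (B0 n (?T x)) \<le> norm n * norm x * K1"
    using bounded_bilinear.nonneg_bounded by blast
  obtain K2 where K2: "K2 \<ge> 0" "\<And>x. norm (?P x) \<le> norm x * K2"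
    using bounded_linear.nonneg_bounded[OF projR_bounded_linear[OF li]] by blast
  \<comment> \<open>Makes \<open>norm n * (K1 * K2)\<close> at most 1/4, hence the doubled operator
    at most 1/2, as \<open>perturbed_GL_on\<close> requires.\<close>
  define \<rho>0 where "\<rho>0 = 1 / 4 / (K1 * K2 + 1)"
  have K: "K1 * K2 \<ge> 0" using K1 K2 by simp
  then have \<rho>0: "\<rho>0 > 0" by (simp add: \<rho>0_def add_nonneg_pos)
  have half: "norm (2 *\<^sub>R ?P (B0 n (?T x))) \<le> norm x / 2" if n: "norm n \<le> \<rho>0" for n x
  proof -
    have "norm (?P (B0 n (?T x))) \<le> norm (B0 n (?T x)) * K2" by (rule K2)
    also have "\<dots> \<le> (norm n * norm x * K1) * K2" by (intro mult_right_mono K1 K2)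
    also have "\<dots> = norm n * (K1 * K2) * norm x" by simp
    also have "\<dots> \<le> \<rho>0 * (K1 * K2 + 1) * norm x"
      using n K \<rho>0 by (intro mult_right_mono mult_mono) auto
    also have "\<rho>0 * (K1 * K2 + 1) = 1 / 4"
    proof -
      have "K1 * K2 + 1 \<noteq> 0" using K by simp
      then show ?thesis unfolding \<rho>0_def by (rule iffD1[OF nonzero_eq_divide_eq refl])
    qed
    finally show ?thesis by simp
  qed
  obtain V \<rho> Y where V: "open V" "0 \<in> V" "V \<subseteq> U" "0 < \<rho>" and \<rho>: "\<rho> \<le> \<rho>0"
    and sol: "solution_family sB k q G z Nc N \<phi> V \<rho> (\<lambda>i \<epsilon> n. T i (Y (\<epsilon>, n)))"
    and Y0: "\<forall>n\<in>N \<inter> ball 0 \<rho>. Y (0, n) = - (B0 (?T (Y (0, n)) + n) (?T (Y (0, n)) + n) + bbar 0)"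
    using solution_family_of_zero[OF y0 small zero_less_one \<rho>0] by (elim exE conjE)
  show ?thesis
  proof (rule exI[of _ V], rule exI[of _ \<rho>], rule exI[of _ "\<lambda>i \<epsilon> n. T i (Y (\<epsilon>, n))"], intro conjI V sol ballI)
    fix n assume n: "n \<in> N \<inter> ball 0 \<rho>"
    let ?c = "?T (Y (0, n))" and ?A = "\<lambda>v. S (k+1) v + 2 *\<^sub>R ?P (B0 n v)"
    have Y: "Y (0, n) = - (B0 (?c + n) (?c + n) + bbar 0)" using Y0 n by (rule bspec)
    have "norm n \<le> \<rho>0" using n \<rho> by simp
    from perturbed_GL_on[OF half[OF this]] show GL: "GL_on sB sC ?X (R (k+1)) ?A" .
    have cc: "B0 ?c ?c = 0" using flat TX by blast
    \<comment> \<open>The term quadratic in \<open>?c\<close> drops out by flatness, and symmetry of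
      \<open>B0\<close> merges the two mixed terms into the factor 2.\<close>
    have Bc: "B0 (?c + n) (?c + n) = 2 *\<^sub>R B0 n ?c + B0 n n"
    proof -
      have "B0 (c + n) (c + n) = 2 *\<^sub>R B0 n c + B0 n n" if "B0 c c = 0" for c
        by (simp add: B0.add_left B0.add_right that B0_sym[of c n] scaleR_2)
      then show ?thesis using cc .
    qed
    have "S (k+1) ?c = ?P (Y (0, n))" by (rule S_T[OF li])
    also have "\<dots> = ?P (- (B0 (?c + n) (?c + n) + bbar 0))" by (rule arg_cong[OF Y])
    also have "\<dots> = - (2 *\<^sub>R ?P (B0 n ?c) + ?P (B0 n n + bbar 0))"
      by (simp only: Bc linear_neg[OF P] linear_add[OF P] linear_cmul[OF P] add.assoc)
    finally have "?A ?c = - ?P (B0 n n + bbar 0)" by simp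
    moreover have "?A (- ?c) = - ?A ?c"
    proof -
      have "bounded_linear (S (k+1))" using S_op[OF li] by (simp add: bounded_operator_def)
      then have "S (k+1) (- ?c) = - S (k+1) ?c" by (rule linear_neg[OF bounded_linear.linear])
      moreover have "?P (B0 n (- ?c)) = - ?P (B0 n ?c)" by (simp only: B0.minus_right linear_neg[OF P])
      ultimately show ?thesis by simp
    qed
    ultimately have A: "?A (- ?c) = ?P (B0 n n + bbar 0)" by simp
    have "- ?c \<in> ?X" by (rule B.subspace_neg[OF X TX])
    moreover have "inj_on ?A ?X" using GL unfolding GL_on_def bij_betw_def by blast
    ultimately have "inv_into ?X ?A (?A (- ?c)) = - ?c" by (intro inv_into_f_f)
    then show "?c = - inv_into ?X ?A (?P (B0 n n + bbar 0))" unfolding A by simp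
    fix i assume i: "i \<in> {1..k}"
    have "T i (Y (0, n)) = T i (- (B0 (?c + n) (?c + n) + bbar 0))" by (rule arg_cong[OF Y])
    also have "\<dots> = - inv_into (Nc i) (S i) (projR i (B0 (?c + n) (?c + n)) + projR i (bbar 0))"
      by (rule T_neg_formula) (use i in simp)
    finally show "T i (Y (0, n)) = - inv_into (Nc i) (S i) (projR i (B0 (?c + n) (?c + n)) + projR i (bbar 0))" .
  qed
qed

end

theorem corollary2:
  fixes sB :: "'k::real_normed_field \<Rightarrow> 'a::banach \<Rightarrow> 'a"
    and sC :: "'k \<Rightarrow> 'b::banach \<Rightarrow> 'b"
  shows
   "(\<forall>M T Q B0. \<forall>\<eta>>0. \<exists>\<delta>>0. \<forall>k q r U G z bbar Nc N R S \<phi>.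
       approximate_solution sB sC k q r U G z bbar Nc N R S \<phi> \<longrightarrow>
       Nc (k+1) = M \<longrightarrow> (\<forall>x\<in>M. S (k+1) x = T x) \<longrightarrow>
       component {1..k+1} R (k+1) = Q \<longrightarrow> half_second_derivative G 0 = B0 \<longrightarrow>
       norm (Q (bbar 0)) < \<delta> \<longrightarrow>
       (\<exists>V \<rho> nbar. open V \<and> 0 \<in> V \<and> V \<subseteq> U \<and> 0 < \<rho> \<and>
          solution_family sB k q G z Nc N \<phi> V \<rho> nbar \<and>
          (\<forall>\<epsilon>\<in>V. \<forall>n \<in> N \<inter> ball 0 \<rho>. norm (nbar (k+1) \<epsilon> n) < \<eta>) \<and>
          (\<forall>n \<in> N \<inter> ball 0 \<rho>.
             S (k+1) (nbar (k+1) 0 n) + Q (B0 (nbar (k+1) 0 n + n) (nbar (k+1) 0 n + n))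
               + Q (bbar 0) = 0 \<and>
             (\<forall>i\<in>{1..k}. nbar i 0 n =
                - inv_into (Nc i) (S i)
                    (component {1..k+1} R i (B0 (nbar (k+1) 0 n + n) (nbar (k+1) 0 n + n))
                     + component {1..k+1} R i (bbar 0))))))
    \<and>
    (\<forall>k q r U G z bbar Nc N R S \<phi> Q B0.
       approximate_solution sB sC k q r U G z bbar Nc N R S \<phi> \<longrightarrow>
       component {1..k+1} R (k+1) = Q \<longrightarrow> half_second_derivative G 0 = B0 \<longrightarrow>
       (\<forall>n\<in>Nc (k+1). B0 n n = 0) \<longrightarrow>
       (\<exists>V \<rho> nbar. open V \<and> 0 \<in> V \<and> V \<subseteq> U \<and> 0 < \<rho> \<and>
          solution_family sB k q G z Nc N \<phi> V \<rho> nbar \<and>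
          (\<forall>n \<in> N \<inter> ball 0 \<rho>.
             GL_on sB sC (Nc (k+1)) (R (k+1)) (\<lambda>v. S (k+1) v + 2 *\<^sub>R Q (B0 n v)) \<and>
             nbar (k+1) 0 n =
               - inv_into (Nc (k+1)) (\<lambda>v. S (k+1) v + 2 *\<^sub>R Q (B0 n v)) (Q (B0 n n + bbar 0)) \<and>
             (\<forall>i\<in>{1..k}. nbar i 0 n =
                - inv_into (Nc i) (S i)
                    (component {1..k+1} R i (B0 (nbar (k+1) 0 n + n) (nbar (k+1) 0 n + n))
                     + component {1..k+1} R i (bbar 0))))))"
proof (intro conjI allI impI)
  fix M :: "'a set" and T :: "'a \<Rightarrow> 'b" and Q :: "'b \<Rightarrow> 'b" and B0 :: "'a \<Rightarrow> 'a \<Rightarrow> 'b" and \<eta> :: real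
  assume \<eta>: "\<eta> > 0"
  \<comment> \<open>The threshold must be found from \<open>M\<close>, \<open>T\<close>,
    \<open>Q\<close>, \<open>B0\<close> and \<eta> alone, before the problem is given. In every
    problem with these data \<tau> coincides with the operator \<open>T (k+1)\<close> of the
    locale.\<close>
  define \<tau> where "\<tau> = (\<lambda>x. inv_into M T (Q x))"
  define bd where "bd = (\<lambda>C. C \<ge> 0 \<and> (\<forall>x v. norm (B0 (\<tau> x) (\<tau> v)) \<le> C * norm x * norm v) \<and>
     (\<forall>x v. norm (Q (B0 (\<tau> x) (\<tau> v))) \<le> C * norm x * norm v) \<and> (\<forall>x. norm (\<tau> x) \<le> C * norm x))"
  \<comment> \<open>Chosen from data available before the quantifiers over problems; existence
    follows from \<open>bilinear_bound\<close> once some approximate solution with these data is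
    given.\<close>
  define C where "C = (SOME C. bd C)"
  \<comment> \<open>The two entries give \<open>C * s \<le> 1 / 8\<close> for the contraction and
    \<open>C * s \<le> \<eta> / 4\<close> for the smallness of the last component.\<close>
  define s where "s = min (1 / 8 / (C + 1)) (\<eta> / 4 / (C + 1))"
  show "\<exists>\<delta>>0. \<forall>k q r U G z bbar Nc N R S \<phi>.
       approximate_solution sB sC k q r U G z bbar Nc N R S \<phi> \<longrightarrow>
       Nc (k+1) = M \<longrightarrow> (\<forall>x\<in>M. S (k+1) x = T x) \<longrightarrow>
       component {1..k+1} R (k+1) = Q \<longrightarrow> half_second_derivative G 0 = B0 \<longrightarrow>
       norm (Q (bbar 0)) < \<delta> \<longrightarrow>
       (\<exists>V \<rho> nbar. open V \<and> 0 \<in> V \<and> V \<subseteq> U \<and> 0 < \<rho> \<and>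
          solution_family sB k q G z Nc N \<phi> V \<rho> nbar \<and>
          (\<forall>\<epsilon>\<in>V. \<forall>n \<in> N \<inter> ball 0 \<rho>. norm (nbar (k+1) \<epsilon> n) < \<eta>) \<and>
          (\<forall>n \<in> N \<inter> ball 0 \<rho>.
             S (k+1) (nbar (k+1) 0 n) + Q (B0 (nbar (k+1) 0 n + n) (nbar (k+1) 0 n + n))
               + Q (bbar 0) = 0 \<and>
             (\<forall>i\<in>{1..k}. nbar i 0 n =
                - inv_into (Nc i) (S i)
                    (component {1..k+1} R i (B0 (nbar (k+1) 0 n + n) (nbar (k+1) 0 n + n))
                     + component {1..k+1} R i (bbar 0)))))"
  \<comment> \<open>If \<open>bd C\<close> fails, no approximate solution has these data and any
    positive threshold is correct; 1 is a default value.\<close>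
  proof (rule exI[of _ "if bd C then s / 2 else 1"], intro conjI allI impI)
    have pos: "C + 1 > 0" "0 < s" if "bd C"
      using that \<eta> by (simp_all add: bd_def s_def add_nonneg_pos)
    then show "(if bd C then s / 2 else 1) > 0" by simp
    fix k q r U G z bbar Nc N R S \<phi>
    assume A: "approximate_solution sB sC k q r U G z bbar Nc N R S \<phi>"
      and M: "Nc (k+1) = M" and T: "\<forall>x\<in>M. S (k+1) x = T x"
      and Q: "component {1..k+1} R (k+1) = Q" and B0: "half_second_derivative G 0 = B0"
      and b: "norm (Q (bbar 0)) < (if bd C then s / 2 else 1)"
    interpret A: approximate_solution sB sC k q r U G z bbar Nc N R S \<phi> by (rule A)
    have projR: "A.projR (k+1) = Q" and Pri: "A.projR i = component {1..k+1} R i" for i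
      using Q by (simp_all only: A.projR_def[abs_def])
    \<comment> \<open>\<open>inv_into\<close> looks only at values on \<open>M\<close>, so
      \<open>S (k+1)\<close> may be replaced by any \<open>T\<close> that agrees with it
      there.\<close>
    have "inv_into M (S (k+1)) y = inv_into M T y" for y
    proof -
      have "(\<lambda>x. x \<in> M \<and> S (k+1) x = y) = (\<lambda>x. x \<in> M \<and> T x = y)" using T by auto
      then show ?thesis by (simp only: inv_into_def)
    qed
    then have \<tau>: "A.T (k+1) = \<tau>" by (intro ext) (simp only: A.T_def M projR \<tau>_def)
    have "\<exists>C. bd C" using A.bilinear_bound unfolding \<tau> projR B0 bd_def .
    then have C: "bd C" unfolding C_def by (rule someI_ex)
    then have C0: "C \<ge> 0" by (simp add: bd_def)
    have Cs: "C * s \<le> c" if "s \<le> c / (C + 1)" for c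
    proof -
      have "C * s \<le> (C + 1) * s" using pos[OF C] by (intro mult_right_mono) auto
      also have "\<dots> \<le> c" using that pos[OF C] by (simp add: pos_le_divide_eq mult.commute)
      finally show ?thesis .
    qed
    have s: "C * s \<le> 1 / 8" "C * s \<le> \<eta> / 4" by (rule Cs, simp only: s_def min.cobounded1 min.cobounded2)+
    show "\<exists>V \<rho> nbar. open V \<and> 0 \<in> V \<and> V \<subseteq> U \<and> 0 < \<rho> \<and>
          solution_family sB k q G z Nc N \<phi> V \<rho> nbar \<and>
          (\<forall>\<epsilon>\<in>V. \<forall>n \<in> N \<inter> ball 0 \<rho>. norm (nbar (k+1) \<epsilon> n) < \<eta>) \<and>
          (\<forall>n \<in> N \<inter> ball 0 \<rho>.
             S (k+1) (nbar (k+1) 0 n) + Q (B0 (nbar (k+1) 0 n + n) (nbar (k+1) 0 n + n))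
               + Q (bbar 0) = 0 \<and>
             (\<forall>i\<in>{1..k}. nbar i 0 n =
                - inv_into (Nc i) (S i)
                    (component {1..k+1} R i (B0 (nbar (k+1) 0 n + n) (nbar (k+1) 0 n + n))
                     + component {1..k+1} R i (bbar 0))))"
    proof (rule A.case_small_residual[unfolded projR B0 \<tau>, unfolded Pri])
      show "C \<ge> 0" "\<eta> > 0" "s > 0" "C * s \<le> 1 / 8" "C * s \<le> \<eta> / 4" by (fact C0 \<eta> pos(2)[OF C] s)+
      show "norm (Q (bbar 0)) < s / 2" using b C by simp
    qed (use C in \<open>simp_all add: bd_def\<close>)
  qed
next
  fix k q r U G z bbar Nc N R S \<phi> Q B0
  assume A: "approximate_solution sB sC k q r U G z bbar Nc N R S \<phi>"
    and Q: "component {1..k+1} R (k+1) = Q" and B0: "half_second_derivative G 0 = B0"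
    and flat: "\<forall>n\<in>Nc (k+1). B0 n n = 0"
  interpret A: approximate_solution sB sC k q r U G z bbar Nc N R S \<phi> by (rule A)
  have projR: "A.projR (k+1) = Q" and Pri: "A.projR i = component {1..k+1} R i" for i
    using Q by (simp_all only: A.projR_def[abs_def])
  show "\<exists>V \<rho> nbar. open V \<and> 0 \<in> V \<and> V \<subseteq> U \<and> 0 < \<rho> \<and>
          solution_family sB k q G z Nc N \<phi> V \<rho> nbar \<and>
          (\<forall>n \<in> N \<inter> ball 0 \<rho>.
             GL_on sB sC (Nc (k+1)) (R (k+1)) (\<lambda>v. S (k+1) v + 2 *\<^sub>R Q (B0 n v)) \<and>
             nbar (k+1) 0 n =
               - inv_into (Nc (k+1)) (\<lambda>v. S (k+1) v + 2 *\<^sub>R Q (B0 n v)) (Q (B0 n n + bbar 0)) \<and>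
             (\<forall>i\<in>{1..k}. nbar i 0 n =
                - inv_into (Nc i) (S i)
                    (component {1..k+1} R i (B0 (nbar (k+1) 0 n + n) (nbar (k+1) 0 n + n))
                     + component {1..k+1} R i (bbar 0))))"
    by (rule A.case_flat[unfolded projR B0, unfolded Pri, OF flat])
qed

end
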